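(* Let $(\mathscr{C},\mathbf{W})$ satisfy conditions (BF), and fix a set of choices $\mathrm{C}(\mathbf{W})$. Let $\underline f=(A',u,f):A\to B$, $\underline g=(B',v,g):B\to C$, $\underline h=(C',w,h):C\to D$ be morphisms in $\mathscr{C}[\mathbf{W}^{-1}]$. Suppose that $\mathrm{C}(\mathbf{W})$ gives the following data, with $u^1,u^2,v^1,u^3$ in $\mathbf{W}$ and $\delta,\sigma,\xi,\eta$ invertible: - for $(f,v)$: $(A^1,\ u^1:A^1\to A',\ f^1:A^1\to B',\ \delta:f\circ u^1\Rightarrow v\circ f^1)$; - for $(g\circ f^1,w)$: $(A^2,\ u^2:A^2\to A^1,\ l:A^2\to C',\ \sigma:g\circ f^1\circ u^2\Rightarrow w\circ l)$; - for $(g,w)$: $(B^2,\ v^1:B^2\to B',\ g^1:B^2\to C',\ \xi:g\circ v^1\Rightarrow w\circ g^1)$; - for $(f,v\circ v^1)$: $(A^3,\ u^3:A^3\to A',\ f^2:A^3\to B^2,\ \eta:f\circ u^3\Rightarrow v\circ v^1\circ f^2)$; so that $\underline h\circ(\underline g\circ\underline f)=(A^2,u\circ u^1\circ u^2,h\circ l)$ and $(\underline h\circ\underline g)\circ\underline f=(A^3,u\circ u^3,h\circ g^1\circ f^2)$. Fix any set of data in $\mathscr{C}$ as follows: (F1) an object $A^4$, a morphism $u^4:A^4\to A^2$ such that $u\circ u^1\circ u^2\circ u^4$ belongs to $\mathbf{W}$, a morphism $u^5:A^4\to A^3$ and an invertible 2-morphism $\gamma:u^1\circ u^2\circ u^4\Rightarrow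 u^3\circ u^5$; (F2) an invertible 2-morphism $\omega:f^1\circ u^2\circ u^4\Rightarrow v^1\circ f^2\circ u^5$ such that $v\circ\omega=(\eta\circ u^5)\bullet(f\circ\gamma)\bullet(\delta^{-1}\circ u^2\circ u^4)$; (F3) an invertible 2-morphism $\rho:l\circ u^4\Rightarrow g^1\circ f^2\circ u^5$ such that $w\circ\rho=(\xi\circ f^2\circ u^5)\bullet(g\circ\omega)\bullet(\sigma^{-1}\circ u^4)$. Then the associator $\Theta^{\mathscr{C},\mathbf{W}}_{\underline h,\underline g,\underline f}:\underline h\circ(\underline g\circ\underline f)\Rightarrow(\underline h\circ\underline g)\circ\underline f$ is represented by $(A^4,u^4,u^5,u\circ\gamma,h\circ\rho)$. Given any other data as in (F1)–(F3), the quintuple induced by the new data is equivalent to this one.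
   Context: Conventions. $\mathscr{C}$ is a bicategory and $\mathbf{W}$ a class of 1-morphisms in it. $\circ$ denotes composition of 1-morphisms and whiskering; $\bullet$ denotes vertical composition of 2-morphisms ($\beta\bullet\alpha$ means first $\alpha$, then $\beta$). Associators and unitors of $\mathscr{C}$ are omitted from the notation, as if $\mathscr{C}$ were a 2-category (by coherence they can be inserted unambiguously); the statement is meant for arbitrary bicategories. Conditions (BF): (BF1) every $\mathrm{id}_A$ is in $\mathbf{W}$. (BF2) $\mathbf{W}$ is closed under composition. (BF3) For every $w:A\to B$ in $\mathbf{W}$ and every $f:C\to B$ there are an object $D$, $w':D\to C$ in $\mathbf{W}$, $f':D\to A$ and an invertible 2-morphism $f\circ w'\Rightarrow w\circ f'$. (BF4a) For every $w:B\to A$ in $\mathbf{W}$, $f^1,f^2:C\to B$ and $\alpha:w\circ f^1\Rightarrow w\circ f^2$ there are an object $D$, $v:D\to C$ in $\mathbf{W}$ and $\beta:f^1\circ v\Rightarrow f^2\circ v$ with $\alpha\circ v=w\circ\beta$. (BF4b) If $\alpha$ in (BF4a) is invertible, so is $\beta$. (BF4c) If $(D',v',\beta')$ is another triple with the same properties as $(D,v,\beta)$ in (BF4a), there are an object $E$, $u:E\to D$, $u':E\to D'$ and an invertible $\zeta:v\circ u\Rightarrow v'\circ u'$ with $v\circ u\in\mathbf{W}$ and $(\beta'\circ u')\bullet(f^1\circ\zeta)=(f^2\circ\zeta)\bullet(\beta\circ u)$. (BF5) If $w:A\to B$ is in $\mathbf{W}$ and there is an invertible $v\Rightarrow w$,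 then $v\in\mathbf{W}$. Choices. $\mathrm{C}(\mathbf{W})$: for every $f:A'\to B$ and $v:B'\to B$ in $\mathbf{W}$, a chosen $(A'',v',f',\rho)$ with $v':A''\to A'$ in $\mathbf{W}$, $f':A''\to B'$, $\rho:f\circ v'\Rightarrow v\circ f'$ invertible. $\mathrm{D}(\mathbf{W})$: for every $w:B\to A$ in $\mathbf{W}$, $f^1,f^2:C\to B$, $\alpha:w\circ f^1\Rightarrow w\circ f^2$, a chosen $v:D\to C$ in $\mathbf{W}$ and $\beta:f^1\circ v\Rightarrow f^2\circ v$ with $\alpha\circ v=w\circ\beta$. Bicategory of fractions $\mathscr{C}[\mathbf{W}^{-1}]$ (Pronk). Objects: those of $\mathscr{C}$. A morphism $A\to B$ is a triple $(A',w,f)$ with $w:A'\to A$ in $\mathbf{W}$, $f:A'\to B$. Composition: $(B',v,g)\circ(A',w,f):=(A'',w\circ v',g\circ f')$ with $(A'',v',f',\rho)$ the choice in $\mathrm{C}(\mathbf{W})$ for $(f,v)$. A 2-morphism $(A^1,w^1,f^1)\Rightarrow(A^2,w^2,f^2)$ (both $A\to B$) is an equivalence class of data (its representatives) $(A^3,v^1,v^2,\alpha,\beta)$ with $v^m:A^3\to A^m$, $w^1\circ v^1\in\mathbf{W}$, $\alpha:w^1\circ v^1\Rightarrow w^2\circ v^2$ invertible, $\beta:f^1\circ v^1\Rightarrow f^2\circ v^2$; $(A^3,v^1,v^2,\alpha,\beta)$ and $(A'^3,v'^1,v'^2,\alpha',\beta')$ are equivalent iff there are $z:A^4\to A^3$,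 $z':A^4\to A'^3$ and invertible $\sigma^1:v'^1\circ z'\Rightarrow v^1\circ z$, $\sigma^2:v^2\circ z\Rightarrow v'^2\circ z'$ with $w^1\circ v^1\circ z\in\mathbf{W}$, $(w^2\circ\sigma^2)\bullet(\alpha\circ z)\bullet(w^1\circ\sigma^1)=\alpha'\circ z'$ and $(f^2\circ\sigma^2)\bullet(\beta\circ z)\bullet(f^1\circ\sigma^1)=\beta'\circ z'$. In Pronk's construction the associator $\Theta^{\mathscr{C},\mathbf{W}}_{\underline h,\underline g,\underline f}$ is defined as the class of the quintuple $(A^4,u^4,u^5,u\circ\gamma,h\circ\rho)$ for one particular set of data satisfying (F1)–(F3) of the claim, selected by means of the fixed choices $\mathrm{C}(\mathbf{W})$ and $\mathrm{D}(\mathbf{W})$. *)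

theory Defs
  imports Main
begin

record ('o, 'm, 'c) bicat =
  Obj :: "'o set"
  Mor :: "'m set"
  Cell :: "'c set"
  Src :: "'m \<Rightarrow> 'o"
  Trg :: "'m \<Rightarrow> 'o"
  Dom :: "'c \<Rightarrow> 'm"
  Cod :: "'c \<Rightarrow> 'm"
  Id1 :: "'o \<Rightarrow> 'm"
  Comp :: "'m \<Rightarrow> 'm \<Rightarrow> 'm"  (infixr \<open>\<cdot>\<index>\<close> 80)
  Id2 :: "'m \<Rightarrow> 'c"
  VComp :: "'c \<Rightarrow> 'c \<Rightarrow> 'c"  (infixr \<open>\<bullet>\<index>\<close> 65)
  HComp :: "'c \<Rightarrow> 'c \<Rightarrow> 'c"  (infixr \<open>\<star>\<index>\<close> 70)
  Assoc :: "'m \<Rightarrow> 'm \<Rightarrow> 'm \<Rightarrow> 'c"  (\<open>\<a>\<index>[_, _, _]\<close>)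
  LUnit :: "'m \<Rightarrow> 'c"
  RUnit :: "'m \<Rightarrow> 'c"

definition hom1 :: "('o, 'm, 'c) bicat \<Rightarrow> 'm \<Rightarrow> 'o \<Rightarrow> 'o \<Rightarrow> bool"
    (\<open>\<guillemotleft>_ : _ \<rightarrow>\<index> _\<guillemotright>\<close>) where
  "hom1 C f A B \<longleftrightarrow> f \<in> Mor C \<and> A \<in> Obj C \<and> B \<in> Obj C \<and> Src C f = A \<and> Trg C f = B"

definition hom2 :: "('o, 'm, 'c) bicat \<Rightarrow> 'c \<Rightarrow> 'm \<Rightarrow> 'm \<Rightarrow> bool"
    (\<open>\<guillemotleft>_ : _ \<Rightarrow>\<index> _\<guillemotright>\<close>) where
  "hom2 C \<alpha> f g \<longleftrightarrow> \<alpha> \<in> Cell C \<and> f \<in> Mor C \<and> g \<in> Mor C \<and> Dom C \<alpha> = f \<and> Cod C \<alpha> = g"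

definition inverse_cells :: "('o, 'm, 'c) bicat \<Rightarrow> 'c \<Rightarrow> 'c \<Rightarrow> bool" where
  "inverse_cells C \<alpha> \<beta> \<longleftrightarrow>
     \<guillemotleft>\<alpha> : Dom C \<alpha> \<Rightarrow>\<^bsub>C\<^esub> Cod C \<alpha>\<guillemotright> \<and> \<guillemotleft>\<beta> : Cod C \<alpha> \<Rightarrow>\<^bsub>C\<^esub> Dom C \<alpha>\<guillemotright> \<and>
     \<beta> \<bullet>\<^bsub>C\<^esub> \<alpha> = Id2 C (Dom C \<alpha>) \<and> \<alpha> \<bullet>\<^bsub>C\<^esub> \<beta> = Id2 C (Cod C \<alpha>)"

definition iso2 :: "('o, 'm, 'c) bicat \<Rightarrow> 'c \<Rightarrow> 'm \<Rightarrow> 'm \<Rightarrow> bool"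
    (\<open>\<guillemotleft>_ : _ \<cong>\<index> _\<guillemotright>\<close>) where
  "iso2 C \<alpha> f g \<longleftrightarrow> hom2 C \<alpha> f g \<and> (\<exists>\<beta>. inverse_cells C \<alpha> \<beta>)"

definition inv2 :: "('o, 'm, 'c) bicat \<Rightarrow> 'c \<Rightarrow> 'c"  (\<open>(_\<^sup>-\<index>)\<close> [1000] 999) where
  "inv2 C \<alpha> = (THE \<beta>. inverse_cells C \<alpha> \<beta>)"

abbreviation lwhisk :: "('o, 'm, 'c) bicat \<Rightarrow> 'm \<Rightarrow> 'c \<Rightarrow> 'c"  (infixr \<open>\<rhd>\<index>\<close> 75) where
  "lwhisk C f \<alpha> \<equiv> Id2 C f \<star>\<^bsub>C\<^esub> \<alpha>"

abbreviation rwhisk :: "('o, 'm, 'c) bicat \<Rightarrow> 'c \<Rightarrow> 'm \<Rightarrow> 'c"  (infixl \<open>\<lhd>\<index>\<close> 75) where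
  "rwhisk C \<alpha> f \<equiv> \<alpha> \<star>\<^bsub>C\<^esub> Id2 C f"

text \<open>
  Bicategories in the sense of Benabou. All compositions are written in applicative order:
  \<open>g \<cdot> f\<close> and \<open>\<beta> \<bullet> \<alpha>\<close> mean first \<open>f\<close>, respectively first \<open>\<alpha>\<close>. The associator goes in the direction
  \<open>\<a>[h, g, f] : h \<cdot> (g \<cdot> f) \<Rightarrow> (h \<cdot> g) \<cdot> f\<close>.
\<close>

locale bicategory =
  fixes C :: "('o, 'm, 'c) bicat" (structure)
  assumes Src_in: "f \<in> Mor C \<Longrightarrow> Src C f \<in> Obj C"
    and Trg_in: "f \<in> Mor C \<Longrightarrow> Trg C f \<in> Obj C"
    and Dom_in: "\<alpha> \<in> Cell C \<Longrightarrow> Dom C \<alpha> \<in> Mor C"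
    and Cod_in: "\<alpha> \<in> Cell C \<Longrightarrow> Cod C \<alpha> \<in> Mor C"
    and Src_Cod: "\<alpha> \<in> Cell C \<Longrightarrow> Src C (Cod C \<alpha>) = Src C (Dom C \<alpha>)"
    and Trg_Cod: "\<alpha> \<in> Cell C \<Longrightarrow> Trg C (Cod C \<alpha>) = Trg C (Dom C \<alpha>)"
    and Id1_in: "A \<in> Obj C \<Longrightarrow> \<guillemotleft>Id1 C A : A \<rightarrow> A\<guillemotright>"
    and Comp_in: "\<guillemotleft>f : A \<rightarrow> B\<guillemotright> \<Longrightarrow> \<guillemotleft>g : B \<rightarrow> D\<guillemotright> \<Longrightarrow> \<guillemotleft>g \<cdot> f : A \<rightarrow> D\<guillemotright>"
    and Id2_in: "f \<in> Mor C \<Longrightarrow> \<guillemotleft>Id2 C f : f \<Rightarrow> f\<guillemotright>"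
    and VComp_in: "\<guillemotleft>\<alpha> : f \<Rightarrow> g\<guillemotright> \<Longrightarrow> \<guillemotleft>\<beta> : g \<Rightarrow> h\<guillemotright> \<Longrightarrow> \<guillemotleft>\<beta> \<bullet> \<alpha> : f \<Rightarrow> h\<guillemotright>"
    and VComp_Id_left: "\<guillemotleft>\<alpha> : f \<Rightarrow> g\<guillemotright> \<Longrightarrow> Id2 C g \<bullet> \<alpha> = \<alpha>"
    and VComp_Id_right: "\<guillemotleft>\<alpha> : f \<Rightarrow> g\<guillemotright> \<Longrightarrow> \<alpha> \<bullet> Id2 C f = \<alpha>"
    and VComp_assoc: "\<guillemotleft>\<alpha> : f \<Rightarrow> g\<guillemotright> \<Longrightarrow> \<guillemotleft>\<beta> : g \<Rightarrow> h\<guillemotright> \<Longrightarrow> \<guillemotleft>\<gamma> : h \<Rightarrow> k\<guillemotright> \<Longrightarrow>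
      (\<gamma> \<bullet> \<beta>) \<bullet> \<alpha> = \<gamma> \<bullet> (\<beta> \<bullet> \<alpha>)"
    and HComp_in: "\<guillemotleft>\<alpha> : f \<Rightarrow> f'\<guillemotright> \<Longrightarrow> \<guillemotleft>\<beta> : g \<Rightarrow> g'\<guillemotright> \<Longrightarrow> Src C g = Trg C f \<Longrightarrow>
      \<guillemotleft>\<beta> \<star> \<alpha> : g \<cdot> f \<Rightarrow> g' \<cdot> f'\<guillemotright>"
    and HComp_Id: "\<guillemotleft>f : A \<rightarrow> B\<guillemotright> \<Longrightarrow> \<guillemotleft>g : B \<rightarrow> D\<guillemotright> \<Longrightarrow> Id2 C g \<star> Id2 C f = Id2 C (g \<cdot> f)"
    and interchange: "\<guillemotleft>\<alpha> : f \<Rightarrow> f'\<guillemotright> \<Longrightarrow> \<guillemotleft>\<alpha>' : f' \<Rightarrow> f''\<guillemotright> \<Longrightarrow>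
      \<guillemotleft>\<beta> : g \<Rightarrow> g'\<guillemotright> \<Longrightarrow> \<guillemotleft>\<beta>' : g' \<Rightarrow> g''\<guillemotright> \<Longrightarrow> Src C g = Trg C f \<Longrightarrow>
      (\<beta>' \<bullet> \<beta>) \<star> (\<alpha>' \<bullet> \<alpha>) = (\<beta>' \<star> \<alpha>') \<bullet> (\<beta> \<star> \<alpha>)"
    and Assoc_iso: "\<guillemotleft>f : A \<rightarrow> B\<guillemotright> \<Longrightarrow> \<guillemotleft>g : B \<rightarrow> D\<guillemotright> \<Longrightarrow> \<guillemotleft>h : D \<rightarrow> E\<guillemotright> \<Longrightarrow>
      \<guillemotleft>\<a>[h, g, f] : h \<cdot> (g \<cdot> f) \<cong> (h \<cdot> g) \<cdot> f\<guillemotright>"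
    and Assoc_natural: "\<guillemotleft>\<alpha> : f \<Rightarrow> f'\<guillemotright> \<Longrightarrow> \<guillemotleft>\<beta> : g \<Rightarrow> g'\<guillemotright> \<Longrightarrow> \<guillemotleft>\<gamma> : h \<Rightarrow> h'\<guillemotright> \<Longrightarrow>
      Src C g = Trg C f \<Longrightarrow> Src C h = Trg C g \<Longrightarrow>
      \<a>[h', g', f'] \<bullet> (\<gamma> \<star> (\<beta> \<star> \<alpha>)) = ((\<gamma> \<star> \<beta>) \<star> \<alpha>) \<bullet> \<a>[h, g, f]"
    and LUnit_iso: "\<guillemotleft>f : A \<rightarrow> B\<guillemotright> \<Longrightarrow> \<guillemotleft>LUnit C f : Id1 C B \<cdot> f \<cong> f\<guillemotright>"
    and LUnit_natural: "\<guillemotleft>\<alpha> : f \<Rightarrow> f'\<guillemotright> \<Longrightarrow>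
      LUnit C f' \<bullet> (Id1 C (Trg C f) \<rhd> \<alpha>) = \<alpha> \<bullet> LUnit C f"
    and RUnit_iso: "\<guillemotleft>f : A \<rightarrow> B\<guillemotright> \<Longrightarrow> \<guillemotleft>RUnit C f : f \<cdot> Id1 C A \<cong> f\<guillemotright>"
    and RUnit_natural: "\<guillemotleft>\<alpha> : f \<Rightarrow> f'\<guillemotright> \<Longrightarrow>
      RUnit C f' \<bullet> (\<alpha> \<lhd> Id1 C (Src C f)) = \<alpha> \<bullet> RUnit C f"
    and pentagon: "\<guillemotleft>f : A \<rightarrow> B\<guillemotright> \<Longrightarrow> \<guillemotleft>g : B \<rightarrow> D\<guillemotright> \<Longrightarrow> \<guillemotleft>h : D \<rightarrow> E\<guillemotright> \<Longrightarrow> \<guillemotleft>k : E \<rightarrow> F\<guillemotright> \<Longrightarrow>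
      (\<a>[k, h, g] \<lhd> f) \<bullet> \<a>[k, h \<cdot> g, f] \<bullet> (k \<rhd> \<a>[h, g, f]) = \<a>[k \<cdot> h, g, f] \<bullet> \<a>[k, h, g \<cdot> f]"
    and triangle: "\<guillemotleft>f : A \<rightarrow> B\<guillemotright> \<Longrightarrow> \<guillemotleft>g : B \<rightarrow> D\<guillemotright> \<Longrightarrow>
      (RUnit C g \<lhd> f) \<bullet> \<a>[g, Id1 C B, f] = g \<rhd> LUnit C f"

text \<open>
  The conditions below are usually written with the associators omitted; here they are spelled out.
  Unbracketed composites are read as bracketed to the right (which is how \<open>\<cdot>\<close> associates),
  except where the definition of composition in the bicategory of fractions produces another bracketing.
\<close>

context
  fixes C :: "('o, 'm, 'c) bicat" (structure) and W :: "'m set"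
begin

definition BF1 :: bool where
  "BF1 \<longleftrightarrow> (\<forall>A \<in> Obj C. Id1 C A \<in> W)"

definition BF2 :: bool where
  "BF2 \<longleftrightarrow> (\<forall>A B D v w. \<guillemotleft>w : A \<rightarrow> B\<guillemotright> \<longrightarrow> \<guillemotleft>v : B \<rightarrow> D\<guillemotright> \<longrightarrow> w \<in> W \<longrightarrow> v \<in> W \<longrightarrow> v \<cdot> w \<in> W)"

definition BF3 :: bool where
  "BF3 \<longleftrightarrow> (\<forall>A B E w f. \<guillemotleft>w : A \<rightarrow> B\<guillemotright> \<longrightarrow> w \<in> W \<longrightarrow> \<guillemotleft>f : E \<rightarrow> B\<guillemotright> \<longrightarrow>
     (\<exists>D w' f' \<alpha>. \<guillemotleft>w' : D \<rightarrow> E\<guillemotright> \<and> w' \<in> W \<and> \<guillemotleft>f' : D \<rightarrow> A\<guillemotright> \<and> \<guillemotleft>\<alpha> : f \<cdot> w' \<cong> w \<cdot> f'\<guillemotright>))"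

definition BF4_triple :: "'m \<Rightarrow> 'm \<Rightarrow> 'm \<Rightarrow> 'c \<Rightarrow> 'o \<Rightarrow> 'm \<Rightarrow> 'c \<Rightarrow> bool" where
  "BF4_triple w f1 f2 \<alpha> D v \<beta> \<longleftrightarrow>
     \<guillemotleft>v : D \<rightarrow> Src C f1\<guillemotright> \<and> v \<in> W \<and> \<guillemotleft>\<beta> : f1 \<cdot> v \<Rightarrow> f2 \<cdot> v\<guillemotright> \<and>
     (\<alpha> \<lhd> v) \<bullet> \<a>[w, f1, v] = \<a>[w, f2, v] \<bullet> (w \<rhd> \<beta>)"

definition BF4_input :: "'m \<Rightarrow> 'm \<Rightarrow> 'm \<Rightarrow> 'c \<Rightarrow> bool" where
  "BF4_input w f1 f2 \<alpha> \<longleftrightarrow> (\<exists>A B E. \<guillemotleft>w : B \<rightarrow> A\<guillemotright> \<and> w \<in> W \<and> \<guillemotleft>f1 : E \<rightarrow> B\<guillemotright> \<and> \<guillemotleft>f2 : E \<rightarrow> B\<guillemotright> \<and>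
     \<guillemotleft>\<alpha> : w \<cdot> f1 \<Rightarrow> w \<cdot> f2\<guillemotright>)"

definition BF4a :: bool where
  "BF4a \<longleftrightarrow> (\<forall>w f1 f2 \<alpha>. BF4_input w f1 f2 \<alpha> \<longrightarrow> (\<exists>D v \<beta>. BF4_triple w f1 f2 \<alpha> D v \<beta>))"

definition BF4b :: bool where
  "BF4b \<longleftrightarrow> (\<forall>w f1 f2 \<alpha> D v \<beta>. BF4_input w f1 f2 \<alpha> \<longrightarrow> BF4_triple w f1 f2 \<alpha> D v \<beta> \<longrightarrow>
     \<guillemotleft>\<alpha> : w \<cdot> f1 \<cong> w \<cdot> f2\<guillemotright> \<longrightarrow> \<guillemotleft>\<beta> : f1 \<cdot> v \<cong> f2 \<cdot> v\<guillemotright>)"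

definition BF4c :: bool where
  "BF4c \<longleftrightarrow> (\<forall>w f1 f2 \<alpha> D v \<beta> D' v' \<beta>'. BF4_input w f1 f2 \<alpha> \<longrightarrow>
     BF4_triple w f1 f2 \<alpha> D v \<beta> \<longrightarrow> BF4_triple w f1 f2 \<alpha> D' v' \<beta>' \<longrightarrow>
     (\<exists>E u u' \<zeta>. \<guillemotleft>u : E \<rightarrow> D\<guillemotright> \<and> \<guillemotleft>u' : E \<rightarrow> D'\<guillemotright> \<and> \<guillemotleft>\<zeta> : v \<cdot> u \<cong> v' \<cdot> u'\<guillemotright> \<and> v \<cdot> u \<in> W \<and>
        \<a>[f2, v', u']\<^sup>- \<bullet> (\<beta>' \<lhd> u') \<bullet> \<a>[f1, v', u'] \<bullet> (f1 \<rhd> \<zeta>) =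
        (f2 \<rhd> \<zeta>) \<bullet> \<a>[f2, v, u]\<^sup>- \<bullet> (\<beta> \<lhd> u) \<bullet> \<a>[f1, v, u]))"

definition BF5 :: bool where
  "BF5 \<longleftrightarrow> (\<forall>w v \<alpha>. w \<in> W \<longrightarrow> \<guillemotleft>\<alpha> : v \<cong> w\<guillemotright> \<longrightarrow> v \<in> W)"

definition BF :: bool where
  "BF \<longleftrightarrow> W \<subseteq> Mor C \<and> BF1 \<and> BF2 \<and> BF3 \<and> BF4a \<and> BF4b \<and> BF4c \<and> BF5"

definition C_choices :: "('m \<Rightarrow> 'm \<Rightarrow> 'o \<times> 'm \<times> 'm \<times> 'c) \<Rightarrow> bool" where
  "C_choices cW \<longleftrightarrow> (\<forall>A' B B' f v. \<guillemotleft>f : A' \<rightarrow> B\<guillemotright> \<longrightarrow> \<guillemotleft>v : B' \<rightarrow> B\<guillemotright> \<longrightarrow> v \<in> W \<longrightarrow>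
     (case cW f v of (A'', v', f', \<rho>) \<Rightarrow>
        \<guillemotleft>v' : A'' \<rightarrow> A'\<guillemotright> \<and> v' \<in> W \<and> \<guillemotleft>f' : A'' \<rightarrow> B'\<guillemotright> \<and> \<guillemotleft>\<rho> : f \<cdot> v' \<cong> v \<cdot> f'\<guillemotright>))"

definition D_choices :: "('m \<Rightarrow> 'm \<Rightarrow> 'm \<Rightarrow> 'c \<Rightarrow> 'o \<times> 'm \<times> 'c) \<Rightarrow> bool" where
  "D_choices dW \<longleftrightarrow> (\<forall>w f1 f2 \<alpha>. BF4_input w f1 f2 \<alpha> \<longrightarrow>
     (case dW w f1 f2 \<alpha> of (D, v, \<beta>) \<Rightarrow> BF4_triple w f1 f2 \<alpha> D v \<beta>))"

definition frac_mor :: "'o \<Rightarrow> 'o \<Rightarrow> ('o \<times> 'm \<times> 'm) set" where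
  "frac_mor A B = {(A', w, f). \<guillemotleft>w : A' \<rightarrow> A\<guillemotright> \<and> w \<in> W \<and> \<guillemotleft>f : A' \<rightarrow> B\<guillemotright>}"

fun frac_reps :: "'o \<times> 'm \<times> 'm \<Rightarrow> 'o \<times> 'm \<times> 'm \<Rightarrow> ('o \<times> 'm \<times> 'm \<times> 'c \<times> 'c) set" where
  "frac_reps (A1, w1, f1) (A2, w2, f2) =
     {(A3, v1, v2, \<alpha>, \<beta>). \<guillemotleft>v1 : A3 \<rightarrow> A1\<guillemotright> \<and> \<guillemotleft>v2 : A3 \<rightarrow> A2\<guillemotright> \<and> w1 \<cdot> v1 \<in> W \<and>
        \<guillemotleft>\<alpha> : w1 \<cdot> v1 \<cong> w2 \<cdot> v2\<guillemotright> \<and> \<guillemotleft>\<beta> : f1 \<cdot> v1 \<Rightarrow> f2 \<cdot> v2\<guillemotright>}"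

fun frac_equiv :: "'o \<times> 'm \<times> 'm \<Rightarrow> 'o \<times> 'm \<times> 'm \<Rightarrow>
    (('o \<times> 'm \<times> 'm \<times> 'c \<times> 'c) \<times> ('o \<times> 'm \<times> 'm \<times> 'c \<times> 'c)) set" where
  "frac_equiv (A1, w1, f1) (A2, w2, f2) =
     {((A3, v1, v2, \<alpha>, \<beta>), (A3', v1', v2', \<alpha>', \<beta>')).
        (A3, v1, v2, \<alpha>, \<beta>) \<in> frac_reps (A1, w1, f1) (A2, w2, f2) \<and>
        (A3', v1', v2', \<alpha>', \<beta>') \<in> frac_reps (A1, w1, f1) (A2, w2, f2) \<and>
        (\<exists>A4 z z' \<sigma>1 \<sigma>2. \<guillemotleft>z : A4 \<rightarrow> A3\<guillemotright> \<and> \<guillemotleft>z' : A4 \<rightarrow> A3'\<guillemotright> \<and>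
           \<guillemotleft>\<sigma>1 : v1' \<cdot> z' \<cong> v1 \<cdot> z\<guillemotright> \<and> \<guillemotleft>\<sigma>2 : v2 \<cdot> z \<cong> v2' \<cdot> z'\<guillemotright> \<and> w1 \<cdot> v1 \<cdot> z \<in> W \<and>
           \<a>[w2, v2', z'] \<bullet> (w2 \<rhd> \<sigma>2) \<bullet> \<a>[w2, v2, z]\<^sup>- \<bullet> (\<alpha> \<lhd> z) \<bullet>
             \<a>[w1, v1, z] \<bullet> (w1 \<rhd> \<sigma>1) \<bullet> \<a>[w1, v1', z']\<^sup>- = \<alpha>' \<lhd> z' \<and>
           \<a>[f2, v2', z'] \<bullet> (f2 \<rhd> \<sigma>2) \<bullet> \<a>[f2, v2, z]\<^sup>- \<bullet> (\<beta> \<lhd> z) \<bullet>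
             \<a>[f1, v1, z] \<bullet> (f1 \<rhd> \<sigma>1) \<bullet> \<a>[f1, v1', z']\<^sup>- = \<beta>' \<lhd> z')}"

definition frac_cells :: "'o \<times> 'm \<times> 'm \<Rightarrow> 'o \<times> 'm \<times> 'm \<Rightarrow> ('o \<times> 'm \<times> 'm \<times> 'c \<times> 'c) set set" where
  "frac_cells p q = frac_reps p q // frac_equiv p q"

fun frac_comp :: "('m \<Rightarrow> 'm \<Rightarrow> 'o \<times> 'm \<times> 'm \<times> 'c) \<Rightarrow> 'o \<times> 'm \<times> 'm \<Rightarrow> 'o \<times> 'm \<times> 'm \<Rightarrow> 'o \<times> 'm \<times> 'm" where
  "frac_comp cW (B', v, g) (A', w, f) =
     (case cW f v of (A'', v', f', \<rho>) \<Rightarrow> (A'', w \<cdot> v', g \<cdot> f'))"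

text \<open>
  The composites \<open>(\<eta> \<circ> u\<^sup>5) \<bullet> (f \<circ> \<gamma>) \<bullet> (\<delta>\<^sup>-\<^sup>1 \<circ> u\<^sup>2 \<circ> u\<^sup>4)\<close> and
  \<open>(\<xi> \<circ> f\<^sup>2 \<circ> u\<^sup>5) \<bullet> (g \<circ> \<omega>) \<bullet> (\<sigma>\<^sup>-\<^sup>1 \<circ> u\<^sup>4)\<close>, with associators inserted, as 2-morphisms
  \<open>v \<cdot> f1 \<cdot> u2 \<cdot> u4 \<Rightarrow> v \<cdot> v1 \<cdot> f2 \<cdot> u5\<close> and \<open>w \<cdot> l \<cdot> u4 \<Rightarrow> w \<cdot> g1 \<cdot> f2 \<cdot> u5\<close>.
\<close>

definition F2_paste where
  "F2_paste f v u1 f1 \<delta> u2 v1 u3 f2 \<eta> u4 u5 \<gamma> =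
     \<a>[v, v1, f2 \<cdot> u5]\<^sup>- \<bullet> \<a>[v \<cdot> v1, f2, u5]\<^sup>- \<bullet> (\<eta> \<lhd> u5) \<bullet> \<a>[f, u3, u5] \<bullet>
     (f \<rhd> \<gamma>) \<bullet>
     \<a>[f, u1, u2 \<cdot> u4]\<^sup>- \<bullet> (\<delta>\<^sup>- \<lhd> (u2 \<cdot> u4)) \<bullet> \<a>[v, f1, u2 \<cdot> u4]"

definition F3_paste where
  "F3_paste g w f1 u2 l \<sigma> v1 g1 \<xi> f2 u4 u5 \<omega> =
     \<a>[w, g1, f2 \<cdot> u5]\<^sup>- \<bullet> (\<xi> \<lhd> (f2 \<cdot> u5)) \<bullet> \<a>[g, v1, f2 \<cdot> u5] \<bullet>
     (g \<rhd> \<omega>) \<bullet>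
     \<a>[g, f1, u2 \<cdot> u4]\<^sup>- \<bullet> \<a>[g \<cdot> f1, u2, u4]\<^sup>- \<bullet> (\<sigma>\<^sup>- \<lhd> u4) \<bullet> \<a>[w, l, u4]"

definition F1 where
  "F1 A2 A3 u u1 u2 u3 A4 u4 u5 \<gamma> \<longleftrightarrow>
     \<guillemotleft>u4 : A4 \<rightarrow> A2\<guillemotright> \<and> u \<cdot> u1 \<cdot> u2 \<cdot> u4 \<in> W \<and> \<guillemotleft>u5 : A4 \<rightarrow> A3\<guillemotright> \<and>
     \<guillemotleft>\<gamma> : u1 \<cdot> u2 \<cdot> u4 \<cong> u3 \<cdot> u5\<guillemotright>"

definition F2 where
  "F2 f v u1 f1 \<delta> u2 v1 u3 f2 \<eta> u4 u5 \<gamma> \<omega> \<longleftrightarrow>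
     \<guillemotleft>\<omega> : f1 \<cdot> u2 \<cdot> u4 \<cong> v1 \<cdot> f2 \<cdot> u5\<guillemotright> \<and>
     v \<rhd> \<omega> = F2_paste f v u1 f1 \<delta> u2 v1 u3 f2 \<eta> u4 u5 \<gamma>"

definition F3 where
  "F3 g w f1 u2 l \<sigma> v1 g1 \<xi> f2 u4 u5 \<omega> \<rho> \<longleftrightarrow>
     \<guillemotleft>\<rho> : l \<cdot> u4 \<cong> g1 \<cdot> f2 \<cdot> u5\<guillemotright> \<and>
     w \<rhd> \<rho> = F3_paste g w f1 u2 l \<sigma> v1 g1 \<xi> f2 u4 u5 \<omega>"

text \<open>
  The quintuple \<open>(A4, u4, u5, u \<circ> \<gamma>, h \<circ> \<rho>)\<close>, with its last two entries rebracketed to 2-morphisms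
  \<open>((u \<cdot> u1) \<cdot> u2) \<cdot> u4 \<Rightarrow> (u \<cdot> u3) \<cdot> u5\<close> and \<open>(h \<cdot> l) \<cdot> u4 \<Rightarrow> ((h \<cdot> g1) \<cdot> f2) \<cdot> u5\<close>.
\<close>

definition assoc_quintuple where
  "assoc_quintuple u h u1 u2 l g1 u3 f2 A4 u4 u5 \<gamma> \<rho> =
     (A4, u4, u5,
      \<a>[u, u3, u5] \<bullet> (u \<rhd> \<gamma>) \<bullet> \<a>[u, u1, u2 \<cdot> u4]\<^sup>- \<bullet> \<a>[u \<cdot> u1, u2, u4]\<^sup>-,
      \<a>[h \<cdot> g1, f2, u5] \<bullet> \<a>[h, g1, f2 \<cdot> u5] \<bullet> (h \<rhd> \<rho>) \<bullet> \<a>[h, l, u4]\<^sup>-)"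

text \<open>The rebracketing \<open>x \<cdot> (y \<cdot> (t \<cdot> p)) \<Rightarrow> (x \<cdot> (y \<cdot> t)) \<cdot> p\<close>.\<close>

definition rebracket where
  "rebracket x y t p = \<a>[x, y \<cdot> t, p] \<bullet> (x \<rhd> \<a>[y, t, p])"

text \<open>
  The associator of the bicategory of fractions. The data are selected in three steps: a square
  \<open>(u1 \<cdot> u2) \<cdot> t \<Rightarrow> u3 \<cdot> s\<close> given by \<open>cW\<close>, and then the 2-morphisms required by \<open>F2\<close> and by \<open>F3\<close>,
  given by \<open>dW\<close> applied to \<open>v\<close> and to \<open>w\<close>. Each application of \<open>dW\<close> precomposes everything found so far
  with a new element of W, called \<open>p\<close> and \<open>q\<close>.
\<close>

fun frac_assoc :: "('m \<Rightarrow> 'm \<Rightarrow> 'o \<times> 'm \<times> 'm \<times> 'c) \<Rightarrow> ('m \<Rightarrow> 'm \<Rightarrow> 'm \<Rightarrow> 'c \<Rightarrow> 'o \<times> 'm \<times> 'c) \<Rightarrow>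
    'o \<times> 'm \<times> 'm \<Rightarrow> 'o \<times> 'm \<times> 'm \<Rightarrow> 'o \<times> 'm \<times> 'm \<Rightarrow> ('o \<times> 'm \<times> 'm \<times> 'c \<times> 'c) set" where
  "frac_assoc cW dW (C', w, h) (B', v, g) (A', u, f) =
     (let (A1, u1, f1, \<delta>) = cW f v;
          (A2, u2, l, \<sigma>) = cW (g \<cdot> f1) w;
          (B2, v1, g1, \<xi>) = cW g w;
          (A3, u3, f2, \<eta>) = cW f (v \<cdot> v1);
          (E, t, s, \<gamma>0) = cW (u1 \<cdot> u2) u3;
          \<gamma>1 = \<gamma>0 \<bullet> \<a>[u1, u2, t];
          (F, p, \<omega>0) = dW v (f1 \<cdot> u2 \<cdot> t) (v1 \<cdot> f2 \<cdot> s) (F2_paste f v u1 f1 \<delta> u2 v1 u3 f2 \<eta> t s \<gamma>1);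
          \<gamma>2 = \<a>[u3, s, p]\<^sup>- \<bullet> (\<gamma>1 \<lhd> p) \<bullet> rebracket u1 u2 t p;
          \<omega>2 = (rebracket v1 f2 s p)\<^sup>- \<bullet> \<omega>0 \<bullet> rebracket f1 u2 t p;
          (A4, q, \<rho>0) = dW w (l \<cdot> t \<cdot> p) (g1 \<cdot> f2 \<cdot> s \<cdot> p)
                          (F3_paste g w f1 u2 l \<sigma> v1 g1 \<xi> f2 (t \<cdot> p) (s \<cdot> p) \<omega>2);
          \<gamma> = \<a>[u3, s \<cdot> p, q]\<^sup>- \<bullet> (\<gamma>2 \<lhd> q) \<bullet> rebracket u1 u2 (t \<cdot> p) q;
          \<rho> = (rebracket g1 f2 (s \<cdot> p) q)\<^sup>- \<bullet> \<rho>0 \<bullet> \<a>[l, t \<cdot> p, q]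
      in frac_equiv (frac_comp cW (C', w, h) (frac_comp cW (B', v, g) (A', u, f)))
                    (frac_comp cW (frac_comp cW (C', w, h) (B', v, g)) (A', u, f)) ``
           {assoc_quintuple u h u1 u2 l g1 u3 f2 A4 ((t \<cdot> p) \<cdot> q) ((s \<cdot> p) \<cdot> q) \<gamma> \<rho>})"

end

end

theory Submission
  imports Defs
begin

text \<open>
  Two quintuples are compared by morphisms \<open>z\<close>, \<open>z'\<close> and invertible 2-morphisms
  \<open>\<sigma> : u4' \<cdot> z' \<Rightarrow> u4 \<cdot> z\<close>, \<open>\<tau> : u5 \<cdot> z \<Rightarrow> u5' \<cdot> z'\<close>. Condition (BF3) and the lifting condition (BF4) for
  \<open>u \<cdot> u1 \<cdot> u2\<close> give \<open>\<sigma>\<close>, and (BF4) for \<open>u3\<close> gives \<open>\<tau>\<close> matching \<open>\<gamma>\<close> with \<open>\<gamma>'\<close>. Then (F2) forces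
  \<open>\<omega>\<close> and \<open>\<omega>'\<close> to match after whiskering with \<open>v\<close>, hence, by the uniqueness in (BF4c), after precomposition
  with an element of \<open>W\<close>; in the same way (F3) and \<open>w\<close> make \<open>\<rho>\<close> and \<open>\<rho>'\<close> match. The data chosen for the
  associator satisfy (F1)-(F3), because these are stable under precomposition with elements of \<open>W\<close>.

  To keep the associators under control, every composite of 1-morphisms is bracketed to the right, which makes
  left whiskering strict; right whiskering is made strict by conjugating with canonical associators.
\<close>

section \<open>Cells of a bicategory\<close>

text \<open>The legs \<open>u4\<close> and \<open>u4'\<close> need not lie in \<open>W\<close>; only
  their composites with \<open>u \<cdot> u1 \<cdot> u2\<close> do. So (BF3) cannot be applied to
  them directly: the square is formed after composition with this element of \<open>W\<close>, which
  a lift removes again. Every lift holds only after one more precomposition, and the new morphism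
  has to be pushed through all cells obtained before. This forces precomposition to be an operation
  on cells between right-bracketed composites that commutes with pasting, and \<open>rw\<close> and
  \<open>family\<close> provide it. Four passages have the same shape, a cell
  \<open>\<alpha>\<close> going to \<open>Z t \<bullet> (e \<rhd> \<alpha>) \<bullet> Y k\<close>
  with \<open>Y\<close> and \<open>Z\<close> natural: from \<open>\<gamma>\<close> to
  \<open>v \<rhd> \<omega>\<close> (\<open>e = f\<close>), from \<open>\<omega>\<close> to
  \<open>w \<rhd> \<rho>\<close> (\<open>e = g\<close>), and from \<open>\<gamma>\<close> and
  \<open>\<rho>\<close> to the two cells of the quintuple (\<open>e = u\<close> and
  \<open>e = h\<close>). One pasting lemma serves all of them. Equivalence is proved for two
  arbitrary sets of data; that the given quintuple lies in the associator class and that new data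
  give an equivalent quintuple are both instances.\<close>

context bicategory
begin

text \<open>Invertibility without source and target. Together with equations for \<open>Dom\<close>
  and \<open>Cod\<close> it replaces the judgement \<open>iso2\<close>, so that typing becomes
  rewriting.\<close>

definition invertible :: "'c \<Rightarrow> bool" where
  "invertible \<alpha> \<longleftrightarrow> (\<exists>\<beta>. inverse_cells C \<alpha> \<beta>)"

lemma hom1_iff: "\<guillemotleft>f : A \<rightarrow> B\<guillemotright> \<longleftrightarrow> f \<in> Mor C \<and> Src C f = A \<and> Trg C f = B"
  using Src_in Trg_in by (auto simp: hom1_def)

lemma hom2_iff: "\<guillemotleft>\<alpha> : f \<Rightarrow> g\<guillemotright> \<longleftrightarrow> \<alpha> \<in> Cell C \<and> Dom C \<alpha> = f \<and> Cod C \<alpha> = g"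
  using Dom_in Cod_in by (auto simp: hom2_def)

lemma inverse_cells_iff:
  "inverse_cells C \<alpha> \<beta> \<longleftrightarrow> \<alpha> \<in> Cell C \<and> \<beta> \<in> Cell C \<and> Dom C \<beta> = Cod C \<alpha> \<and> Cod C \<beta> = Dom C \<alpha> \<and>
     \<beta> \<bullet> \<alpha> = Id2 C (Dom C \<alpha>) \<and> \<alpha> \<bullet> \<beta> = Id2 C (Cod C \<alpha>)"
  by (auto simp: inverse_cells_def hom2_iff)

lemma iso2_iff: "\<guillemotleft>\<alpha> : f \<cong> g\<guillemotright> \<longleftrightarrow> invertible \<alpha> \<and> Dom C \<alpha> = f \<and> Cod C \<alpha> = g"
  by (auto simp: iso2_def invertible_def hom2_iff inverse_cells_iff)

lemma Comp_simps [simp]: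
  assumes "f \<in> Mor C" "g \<in> Mor C" "Src C g = Trg C f"
  shows "g \<cdot> f \<in> Mor C" "Src C (g \<cdot> f) = Src C f" "Trg C (g \<cdot> f) = Trg C g"
  using Comp_in[of f "Src C f" "Trg C f" g "Trg C g"] assms by (auto simp: hom1_iff)

lemma Dom_Cod_simps [simp]:
  assumes "\<alpha> \<in> Cell C"
  shows "Dom C \<alpha> \<in> Mor C" "Cod C \<alpha> \<in> Mor C"
    "Src C (Cod C \<alpha>) = Src C (Dom C \<alpha>)" "Trg C (Cod C \<alpha>) = Trg C (Dom C \<alpha>)"
  using Dom_in Cod_in Src_Cod Trg_Cod assms by auto

lemma Id2_simps [simp]:
  assumes "f \<in> Mor C"
  shows "Id2 C f \<in> Cell C" "Dom C (Id2 C f) = f" "Cod C (Id2 C f) = f"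
  using Id2_in assms by (auto simp: hom2_iff)

lemma VComp_simps [simp]:
  assumes "\<alpha> \<in> Cell C" "\<beta> \<in> Cell C" "Dom C \<beta> = Cod C \<alpha>"
  shows "\<beta> \<bullet> \<alpha> \<in> Cell C" "Dom C (\<beta> \<bullet> \<alpha>) = Dom C \<alpha>" "Cod C (\<beta> \<bullet> \<alpha>) = Cod C \<beta>"
  using VComp_in[of \<alpha> "Dom C \<alpha>" "Cod C \<alpha>" \<beta> "Cod C \<beta>"] assms by (auto simp: hom2_iff)

lemma HComp_simps [simp]:
  assumes "\<alpha> \<in> Cell C" "\<beta> \<in> Cell C" "Src C (Dom C \<beta>) = Trg C (Dom C \<alpha>)"
  shows "\<beta> \<star> \<alpha> \<in> Cell C" "Dom C (\<beta> \<star> \<alpha>) = Dom C \<beta> \<cdot> Dom C \<alpha>" "Cod C (\<beta> \<star> \<alpha>) = Cod C \<beta> \<cdot> Cod C \<alpha>"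
  using HComp_in[of \<alpha> "Dom C \<alpha>" "Cod C \<alpha>" \<beta> "Dom C \<beta>" "Cod C \<beta>"] assms by (auto simp: hom2_iff)

lemma VComp_Id [simp]:
  assumes "\<alpha> \<in> Cell C"
  shows "Cod C \<alpha> = f \<Longrightarrow> Id2 C f \<bullet> \<alpha> = \<alpha>" "Dom C \<alpha> = f \<Longrightarrow> \<alpha> \<bullet> Id2 C f = \<alpha>"
  using VComp_Id_left VComp_Id_right assms by (auto simp: hom2_iff)

lemma VComp_assoc' [simp]:
  assumes "\<alpha> \<in> Cell C" "\<beta> \<in> Cell C" "\<gamma> \<in> Cell C" "Dom C \<beta> = Cod C \<alpha>" "Dom C \<gamma> = Cod C \<beta>"
  shows "(\<gamma> \<bullet> \<beta>) \<bullet> \<alpha> = \<gamma> \<bullet> \<beta> \<bullet> \<alpha>"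
  using VComp_assoc assms by (auto simp: hom2_iff)

lemma HComp_Id' [simp]:
  assumes "f \<in> Mor C" "g \<in> Mor C" "Src C g = Trg C f"
  shows "Id2 C g \<star> Id2 C f = Id2 C (g \<cdot> f)"
  using HComp_Id assms by (auto simp: hom1_iff)

lemma interchange':
  assumes "\<alpha> \<in> Cell C" "\<alpha>' \<in> Cell C" "\<beta> \<in> Cell C" "\<beta>' \<in> Cell C"
    "Dom C \<alpha>' = Cod C \<alpha>" "Dom C \<beta>' = Cod C \<beta>" "Src C (Dom C \<beta>) = Trg C (Dom C \<alpha>)"
  shows "(\<beta>' \<star> \<alpha>') \<bullet> (\<beta> \<star> \<alpha>) = (\<beta>' \<bullet> \<beta>) \<star> (\<alpha>' \<bullet> \<alpha>)"
  using interchange[of \<alpha> "Dom C \<alpha>" "Cod C \<alpha>" \<alpha>' "Cod C \<alpha>'" \<beta> "Dom C \<beta>" "Cod C \<beta>" \<beta>' "Cod C \<beta>'"] assms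
  by (auto simp: hom2_iff)

lemma whisker_VComp:
  assumes "\<alpha> \<in> Cell C" "\<alpha>' \<in> Cell C" "Dom C \<alpha>' = Cod C \<alpha>" "x \<in> Mor C"
  shows "Src C x = Trg C (Dom C \<alpha>) \<Longrightarrow> x \<rhd> (\<alpha>' \<bullet> \<alpha>) = (x \<rhd> \<alpha>') \<bullet> (x \<rhd> \<alpha>)"
    "Src C (Dom C \<alpha>) = Trg C x \<Longrightarrow> (\<alpha>' \<bullet> \<alpha>) \<lhd> x = (\<alpha>' \<lhd> x) \<bullet> (\<alpha> \<lhd> x)"
  using assms by (simp_all add: interchange')

text \<open>By interchange both sides equal \<open>\<beta> \<star> \<alpha>\<close>.\<close>

lemma whisker_exchange:
  assumes "\<alpha> \<in> Cell C" "\<beta> \<in> Cell C" "Src C (Dom C \<beta>) = Trg C (Dom C \<alpha>)"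
  shows "(\<beta> \<lhd> Cod C \<alpha>) \<bullet> (Dom C \<beta> \<rhd> \<alpha>) = (Cod C \<beta> \<rhd> \<alpha>) \<bullet> (\<beta> \<lhd> Dom C \<alpha>)"
  using assms by (simp add: interchange')

section \<open>Invertible 2-morphisms and their inverses\<close>

lemma invertible_Cell [simp]: "invertible \<alpha> \<Longrightarrow> \<alpha> \<in> Cell C"
  by (auto simp: invertible_def inverse_cells_iff)

lemma invertibleI:
  assumes "\<alpha> \<in> Cell C" "\<beta> \<in> Cell C" "Dom C \<beta> = Cod C \<alpha>" "Cod C \<beta> = Dom C \<alpha>"
    "\<beta> \<bullet> \<alpha> = Id2 C (Dom C \<alpha>)" "\<alpha> \<bullet> \<beta> = Id2 C (Cod C \<alpha>)"
  shows "invertible \<alpha>"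
  using assms unfolding invertible_def inverse_cells_iff by blast

lemma inverse_cells_unique:
  assumes "inverse_cells C \<alpha> \<beta>" "inverse_cells C \<alpha> \<beta>'"
  shows "\<beta> = \<beta>'"
proof -
  have cells: "\<alpha> \<in> Cell C" "\<beta> \<in> Cell C" "\<beta>' \<in> Cell C"
    and bounds: "Dom C \<beta> = Cod C \<alpha>" "Cod C \<beta> = Dom C \<alpha>" "Dom C \<beta>' = Cod C \<alpha>" "Cod C \<beta>' = Dom C \<alpha>"
    and inv: "\<alpha> \<bullet> \<beta>' = Id2 C (Cod C \<alpha>)" "\<beta> \<bullet> \<alpha> = Id2 C (Dom C \<alpha>)"
    using assms[unfolded inverse_cells_iff] by blast+
  have "\<beta> = \<beta> \<bullet> (\<alpha> \<bullet> \<beta>')" unfolding inv by (rule VComp_Id(2)[symmetric]) fact+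
  also have "\<dots> = (\<beta> \<bullet> \<alpha>) \<bullet> \<beta>'" by (rule VComp_assoc'[symmetric]) (simp_all only: cells bounds)
  also have "\<dots> = \<beta>'" unfolding inv by (rule VComp_Id(1)) fact+
  finally show ?thesis .
qed

lemma inverse_cells_inv2:
  assumes "inverse_cells C \<alpha> \<beta>"
  shows "\<alpha>\<^sup>- = \<beta>"
  unfolding inv2_def using assms
proof (rule the_equality)
  fix \<gamma> assume "inverse_cells C \<alpha> \<gamma>"
  then show "\<gamma> = \<beta>" using assms by (rule inverse_cells_unique)
qed

lemma inv2_eqI:
  assumes "\<alpha> \<in> Cell C" "\<beta> \<in> Cell C" "Dom C \<beta> = Cod C \<alpha>" "Cod C \<beta> = Dom C \<alpha>"
    "\<beta> \<bullet> \<alpha> = Id2 C (Dom C \<alpha>)" "\<alpha> \<bullet> \<beta> = Id2 C (Cod C \<alpha>)"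
  shows "\<alpha>\<^sup>- = \<beta>"
  using assms by (intro inverse_cells_inv2) (simp only: inverse_cells_iff)

lemma inv2_simps [simp]:
  assumes "invertible \<alpha>"
  shows "\<alpha>\<^sup>- \<in> Cell C" "Dom C (\<alpha>\<^sup>-) = Cod C \<alpha>" "Cod C (\<alpha>\<^sup>-) = Dom C \<alpha>"
    "\<alpha>\<^sup>- \<bullet> \<alpha> = Id2 C (Dom C \<alpha>)" "\<alpha> \<bullet> \<alpha>\<^sup>- = Id2 C (Cod C \<alpha>)"
proof -
  obtain \<beta> where \<beta>: "inverse_cells C \<alpha> \<beta>" using assms by (auto simp: invertible_def)
  then show "\<alpha>\<^sup>- \<in> Cell C" "Dom C (\<alpha>\<^sup>-) = Cod C \<alpha>" "Cod C (\<alpha>\<^sup>-) = Dom C \<alpha>"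
    "\<alpha>\<^sup>- \<bullet> \<alpha> = Id2 C (Dom C \<alpha>)" "\<alpha> \<bullet> \<alpha>\<^sup>- = Id2 C (Cod C \<alpha>)"
    using inverse_cells_inv2[OF \<beta>] by (simp_all add: inverse_cells_iff)
qed

lemma invertible_inv2 [simp]: "invertible \<alpha> \<Longrightarrow> invertible (\<alpha>\<^sup>-)"
  by (rule invertibleI[where \<beta> = \<alpha>]) auto

lemma inv2_inv2 [simp]: "invertible \<alpha> \<Longrightarrow> (\<alpha>\<^sup>-)\<^sup>- = \<alpha>"
  by (rule inv2_eqI) auto

text \<open>Vertical composites are normalised to the right, so a cell and its inverse usually meet
  in front of a tail; these are the cancellation rules for that position.\<close>

lemma inv2_cancel [simp]:
  assumes "invertible \<alpha>" "\<beta> \<in> Cell C"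
  shows "Cod C \<beta> = Dom C \<alpha> \<Longrightarrow> \<alpha>\<^sup>- \<bullet> \<alpha> \<bullet> \<beta> = \<beta>" "Cod C \<beta> = Cod C \<alpha> \<Longrightarrow> \<alpha> \<bullet> \<alpha>\<^sup>- \<bullet> \<beta> = \<beta>"
  using assms by (simp_all add: VComp_assoc'[symmetric] del: VComp_assoc')

lemma invertible_cancel_left:
  assumes "\<alpha> \<bullet> \<beta> = \<alpha> \<bullet> \<beta>'" "invertible \<alpha>" "\<beta> \<in> Cell C" "\<beta>' \<in> Cell C" "Cod C \<beta> = Dom C \<alpha>" "Cod C \<beta>' = Dom C \<alpha>"
  shows "\<beta> = \<beta>'"
  using arg_cong[OF assms(1), of "\<lambda>x. \<alpha>\<^sup>- \<bullet> x"] assms(2-) by simp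

lemma invertible_Id2 [simp]: "f \<in> Mor C \<Longrightarrow> invertible (Id2 C f)"
  by (rule invertibleI[where \<beta> = "Id2 C f"]) auto

lemma inv2_Id2 [simp]: "f \<in> Mor C \<Longrightarrow> (Id2 C f)\<^sup>- = Id2 C f"
  by (rule inv2_eqI) auto

lemma invertible_VComp [simp]:
  assumes "invertible \<alpha>" "invertible \<beta>" "Dom C \<beta> = Cod C \<alpha>"
  shows "invertible (\<beta> \<bullet> \<alpha>)" "(\<beta> \<bullet> \<alpha>)\<^sup>- = \<alpha>\<^sup>- \<bullet> \<beta>\<^sup>-"
  using assms by (auto intro!: invertibleI[where \<beta> = "\<alpha>\<^sup>- \<bullet> \<beta>\<^sup>-"] inv2_eqI)

lemma invertible_HComp [simp]:
  assumes "invertible \<alpha>" "invertible \<beta>" "Src C (Dom C \<beta>) = Trg C (Dom C \<alpha>)"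
  shows "invertible (\<beta> \<star> \<alpha>)" "(\<beta> \<star> \<alpha>)\<^sup>- = \<beta>\<^sup>- \<star> \<alpha>\<^sup>-"
proof -
  have [simp]: "Src C (Cod C \<beta>) = Trg C (Cod C \<alpha>)" using assms by simp
  show "invertible (\<beta> \<star> \<alpha>)"
    by (rule invertibleI[where \<beta> = "\<beta>\<^sup>- \<star> \<alpha>\<^sup>-"]) (use assms in \<open>simp_all add: interchange'\<close>)
  show "(\<beta> \<star> \<alpha>)\<^sup>- = \<beta>\<^sup>- \<star> \<alpha>\<^sup>-"
    by (rule inv2_eqI) (use assms in \<open>simp_all add: interchange'\<close>)
qed

section \<open>Associators: naturality and the pentagon\<close>

lemma Assoc_simps [simp]:
  assumes "f \<in> Mor C" "g \<in> Mor C" "h \<in> Mor C" "Src C g = Trg C f" "Src C h = Trg C g"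
  shows "invertible \<a>[h, g, f]" "Dom C \<a>[h, g, f] = h \<cdot> g \<cdot> f" "Cod C \<a>[h, g, f] = (h \<cdot> g) \<cdot> f"
  using Assoc_iso[of f _ _ g _ h] assms by (auto simp: hom1_iff iso2_iff)

lemma Assoc_natural':
  assumes "\<alpha> \<in> Cell C" "\<beta> \<in> Cell C" "\<gamma> \<in> Cell C"
    "Src C (Dom C \<beta>) = Trg C (Dom C \<alpha>)" "Src C (Dom C \<gamma>) = Trg C (Dom C \<beta>)"
  shows "\<a>[Cod C \<gamma>, Cod C \<beta>, Cod C \<alpha>] \<bullet> (\<gamma> \<star> \<beta> \<star> \<alpha>) =
    ((\<gamma> \<star> \<beta>) \<star> \<alpha>) \<bullet> \<a>[Dom C \<gamma>, Dom C \<beta>, Dom C \<alpha>]"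
  using Assoc_natural assms by (auto simp: hom2_iff)

lemma Assoc_inv_natural:
  assumes "\<alpha> \<in> Cell C" "\<beta> \<in> Cell C" "\<gamma> \<in> Cell C"
    "Src C (Dom C \<beta>) = Trg C (Dom C \<alpha>)" "Src C (Dom C \<gamma>) = Trg C (Dom C \<beta>)"
  shows "\<a>[Cod C \<gamma>, Cod C \<beta>, Cod C \<alpha>]\<^sup>- \<bullet> ((\<gamma> \<star> \<beta>) \<star> \<alpha>) =
    (\<gamma> \<star> \<beta> \<star> \<alpha>) \<bullet> \<a>[Dom C \<gamma>, Dom C \<beta>, Dom C \<alpha>]\<^sup>-"
proof (rule invertible_cancel_left[where \<alpha> = "\<a>[Cod C \<gamma>, Cod C \<beta>, Cod C \<alpha>]"])
  have "\<a>[Cod C \<gamma>, Cod C \<beta>, Cod C \<alpha>] \<bullet> (\<gamma> \<star> \<beta> \<star> \<alpha>) \<bullet> \<a>[Dom C \<gamma>, Dom C \<beta>, Dom C \<alpha>]\<^sup>- =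
    (\<a>[Cod C \<gamma>, Cod C \<beta>, Cod C \<alpha>] \<bullet> (\<gamma> \<star> \<beta> \<star> \<alpha>)) \<bullet> \<a>[Dom C \<gamma>, Dom C \<beta>, Dom C \<alpha>]\<^sup>-"
    using assms by simp
  also have "\<dots> = (\<gamma> \<star> \<beta>) \<star> \<alpha>" using assms by (subst Assoc_natural') simp_all
  finally show "\<a>[Cod C \<gamma>, Cod C \<beta>, Cod C \<alpha>] \<bullet> \<a>[Cod C \<gamma>, Cod C \<beta>, Cod C \<alpha>]\<^sup>- \<bullet> ((\<gamma> \<star> \<beta>) \<star> \<alpha>) =
    \<a>[Cod C \<gamma>, Cod C \<beta>, Cod C \<alpha>] \<bullet> (\<gamma> \<star> \<beta> \<star> \<alpha>) \<bullet> \<a>[Dom C \<gamma>, Dom C \<beta>, Dom C \<alpha>]\<^sup>-"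
    using assms by simp
qed (use assms in simp_all)

lemma pentagon':
  assumes "f \<in> Mor C" "g \<in> Mor C" "h \<in> Mor C" "k \<in> Mor C"
    "Src C g = Trg C f" "Src C h = Trg C g" "Src C k = Trg C h"
  shows "(\<a>[k, h, g] \<lhd> f) \<bullet> \<a>[k, h \<cdot> g, f] \<bullet> (k \<rhd> \<a>[h, g, f]) = \<a>[k \<cdot> h, g, f] \<bullet> \<a>[k, h, g \<cdot> f]"
  using pentagon assms by (auto simp: hom1_iff)

section \<open>Right-bracketed composites\<close>

text \<open>The last factor \<open>k\<close> is kept apart from the list because it varies while the
  list stays fixed: it is \<open>u4\<close> or \<open>u5\<close>, later followed by further
  morphisms. Appending lists composes the actions with no associator.\<close>

primrec act :: "'m list \<Rightarrow> 'm \<Rightarrow> 'm" where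
  "act [] k = k"
| "act (x # xs) k = x \<cdot> act xs k"

text \<open>\<open>A\<close> is the target of whatever follows the list; it supplies the answer for
  the empty list.\<close>

primrec tgt :: "'m list \<Rightarrow> 'o \<Rightarrow> 'o" where
  "tgt [] A = A"
| "tgt (x # xs) A = Trg C x"

primrec path :: "'m list \<Rightarrow> 'o \<Rightarrow> bool" where
  "path [] A \<longleftrightarrow> True"
| "path (x # xs) A \<longleftrightarrow> x \<in> Mor C \<and> path xs A \<and> Src C x = tgt xs A"

primrec lw :: "'m list \<Rightarrow> 'c \<Rightarrow> 'c" where
  "lw [] \<beta> = \<beta>"
| "lw (x # xs) \<beta> = x \<rhd> lw xs \<beta>"

text \<open>The canonical cell from \<open>act xs k \<cdot> z\<close> to
  \<open>act xs (k \<cdot> z)\<close>: inverse associators carry \<open>z\<close> inwards past one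
  factor of the list at a time.\<close>

primrec reassoc :: "'m list \<Rightarrow> 'm \<Rightarrow> 'm \<Rightarrow> 'c" where
  "reassoc [] k z = Id2 C (k \<cdot> z)"
| "reassoc (x # xs) k z = (x \<rhd> reassoc xs k z) \<bullet> \<a>[x, act xs k, z]\<^sup>-"

text \<open>
  If \<open>\<alpha> : act xs k \<Rightarrow> act ys t\<close>, then \<open>rw xs k ys t \<alpha> z : act xs (k \<cdot> z) \<Rightarrow> act ys (t \<cdot> z)\<close>. The bracketing of source
  and target cannot be read off \<open>\<alpha>\<close>, so it is passed explicitly.
\<close>

definition rw :: "'m list \<Rightarrow> 'm \<Rightarrow> 'm list \<Rightarrow> 'm \<Rightarrow> 'c \<Rightarrow> 'm \<Rightarrow> 'c" where
  "rw xs k ys t \<alpha> z = reassoc ys t z \<bullet> (\<alpha> \<lhd> z) \<bullet> (reassoc xs k z)\<^sup>-"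

lemma act_simps [simp]:
  assumes "path xs (Trg C k)" "k \<in> Mor C"
  shows "act xs k \<in> Mor C" "Src C (act xs k) = Src C k" "Trg C (act xs k) = tgt xs (Trg C k)"
  using assms by (induction xs) auto

lemma act_append [simp]: "act (xs @ ys) k = act xs (act ys k)"
  by (induction xs) auto

lemma tgt_append [simp]: "tgt (xs @ ys) A = tgt xs (tgt ys A)"
  by (induction xs) auto

lemma path_append [simp]: "path (xs @ ys) A \<longleftrightarrow> path xs (tgt ys A) \<and> path ys A"
  by (induction xs) auto

lemma lw_append [simp]: "lw (xs @ ys) \<beta> = lw xs (lw ys \<beta>)"
  by (induction xs) auto

lemma lw_simps [simp]:
  assumes "path xs (Trg C (Dom C \<beta>))" "\<beta> \<in> Cell C"
  shows "lw xs \<beta> \<in> Cell C" "Dom C (lw xs \<beta>) = act xs (Dom C \<beta>)" "Cod C (lw xs \<beta>) = act xs (Cod C \<beta>)"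
  using assms by (induction xs) auto

lemma lw_invertible [simp]:
  assumes "path xs (Trg C (Dom C \<beta>))" "invertible \<beta>"
  shows "invertible (lw xs \<beta>)" "(lw xs \<beta>)\<^sup>- = lw xs (\<beta>\<^sup>-)"
  using assms by (induction xs) auto

lemma lw_Id2 [simp]: "path xs (Trg C k) \<Longrightarrow> k \<in> Mor C \<Longrightarrow> lw xs (Id2 C k) = Id2 C (act xs k)"
  by (induction xs) auto

lemma lw_VComp:
  assumes "path xs (Trg C (Dom C \<alpha>))" "\<alpha> \<in> Cell C" "\<beta> \<in> Cell C" "Dom C \<beta> = Cod C \<alpha>"
  shows "lw xs (\<beta> \<bullet> \<alpha>) = lw xs \<beta> \<bullet> lw xs \<alpha>"
  using assms by (induction xs) (simp_all add: whisker_VComp)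

lemma reassoc_simps [simp]:
  assumes "path xs (Trg C k)" "k \<in> Mor C" "z \<in> Mor C" "Src C k = Trg C z"
  shows "invertible (reassoc xs k z)" "Dom C (reassoc xs k z) = act xs k \<cdot> z"
    "Cod C (reassoc xs k z) = act xs (k \<cdot> z)"
  using assms by (induction xs) auto

lemma reassoc_append:
  assumes "path (xs @ ys) (Trg C k)" "k \<in> Mor C" "z \<in> Mor C" "Src C k = Trg C z"
  shows "reassoc (xs @ ys) k z = lw xs (reassoc ys k z) \<bullet> reassoc xs (act ys k) z"
  using assms by (induction xs) (simp_all add: whisker_VComp)

lemma rw_simps [simp]:
  assumes "path xs (Trg C k)" "path ys (Trg C t)" "k \<in> Mor C" "t \<in> Mor C" "z \<in> Mor C"
    "Src C k = Trg C z" "Src C t = Trg C z" "\<alpha> \<in> Cell C" "Dom C \<alpha> = act xs k" "Cod C \<alpha> = act ys t"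
  shows "rw xs k ys t \<alpha> z \<in> Cell C" "Dom C (rw xs k ys t \<alpha> z) = act xs (k \<cdot> z)"
    "Cod C (rw xs k ys t \<alpha> z) = act ys (t \<cdot> z)"
  using assms by (simp_all add: rw_def)

lemma rw_invertible [simp]:
  assumes "path xs (Trg C k)" "path ys (Trg C t)" "k \<in> Mor C" "t \<in> Mor C" "z \<in> Mor C"
    "Src C k = Trg C z" "Src C t = Trg C z" "invertible \<alpha>" "Dom C \<alpha> = act xs k" "Cod C \<alpha> = act ys t"
  shows "invertible (rw xs k ys t \<alpha> z)" "(rw xs k ys t \<alpha> z)\<^sup>- = rw ys t xs k (\<alpha>\<^sup>-) z"
  using assms by (simp_all add: rw_def)

lemma rw_VComp:
  assumes "path xs (Trg C k)" "path ys (Trg C t)" "path zs (Trg C r)"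
    "k \<in> Mor C" "t \<in> Mor C" "r \<in> Mor C" "z \<in> Mor C"
    "Src C k = Trg C z" "Src C t = Trg C z" "Src C r = Trg C z" "\<alpha> \<in> Cell C" "\<beta> \<in> Cell C"
    "Dom C \<alpha> = act xs k" "Cod C \<alpha> = act ys t" "Dom C \<beta> = act ys t" "Cod C \<beta> = act zs r"
  shows "rw xs k zs r (\<beta> \<bullet> \<alpha>) z = rw ys t zs r \<beta> z \<bullet> rw xs k ys t \<alpha> z"
  using assms by (simp add: rw_def whisker_VComp)

text \<open>Naturality of the associator in its middle argument. The codomain enters as the variable
  \<open>g\<close> with an equation, so that the rule rewrites whichever form the codomain has in
  the goal.\<close>

lemma Assoc_inv_whisker:
  assumes "\<alpha> \<in> Cell C" "x \<in> Mor C" "z \<in> Mor C" "Src C x = Trg C (Dom C \<alpha>)" "Src C (Dom C \<alpha>) = Trg C z"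
    "g = Cod C \<alpha>"
  shows "\<a>[x, g, z]\<^sup>- \<bullet> ((x \<rhd> \<alpha>) \<lhd> z) = (x \<rhd> (\<alpha> \<lhd> z)) \<bullet> \<a>[x, Dom C \<alpha>, z]\<^sup>-"
  using Assoc_inv_natural[of "Id2 C z" \<alpha> "Id2 C x"] assms by simp

text \<open>The outermost associators at the two ends of \<open>rw\<close> meet across
  \<open>(x \<rhd> \<alpha>) \<lhd> z\<close> and cancel by naturality in the middle
  argument.\<close>

lemma rw_lwhisk:
  assumes "path xs (Trg C k)" "path ys (Trg C t)" "k \<in> Mor C" "t \<in> Mor C" "z \<in> Mor C"
    "Src C k = Trg C z" "Src C t = Trg C z" "\<alpha> \<in> Cell C" "Dom C \<alpha> = act xs k" "Cod C \<alpha> = act ys t"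
    "x \<in> Mor C" "Src C x = tgt xs (Trg C k)"
  shows "rw (x # xs) k (x # ys) t (x \<rhd> \<alpha>) z = x \<rhd> rw xs k ys t \<alpha> z"
proof -
  have e: "tgt ys (Trg C t) = tgt xs (Trg C k)"
    using assms Dom_Cod_simps(4)[of \<alpha>] by simp
  have "rw (x # xs) k (x # ys) t (x \<rhd> \<alpha>) z =
     (x \<rhd> reassoc ys t z) \<bullet> (\<a>[x, act ys t, z]\<^sup>- \<bullet> ((x \<rhd> \<alpha>) \<lhd> z)) \<bullet> \<a>[x, act xs k, z] \<bullet> (x \<rhd> (reassoc xs k z)\<^sup>-)"
    using assms e by (simp add: rw_def)
  also have "\<dots> = x \<rhd> rw xs k ys t \<alpha> z"
    using assms e by (simp add: rw_def Assoc_inv_whisker whisker_VComp)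
  finally show ?thesis .
qed

text \<open>Meant for comparison cells such as
  \<open>k' \<cdot> z' \<Rightarrow> k \<cdot> z\<close>: under precomposition the trailing factors
  are \<open>z'\<close> and \<open>z\<close>, so the legs \<open>a\<close> and \<open>b\<close> join
  the common prefix \<open>xs\<close>. Iterating \<open>rw_lwhisk\<close> strips the prefix.\<close>

lemma rw_lw:
  assumes "path xs (Trg C (Dom C \<alpha>))" "k \<in> Mor C" "t \<in> Mor C" "z \<in> Mor C" "a \<in> Mor C" "b \<in> Mor C"
    "Src C k = Trg C z" "Src C t = Trg C z" "Src C a = Trg C k" "Src C b = Trg C t"
    "\<alpha> \<in> Cell C" "Dom C \<alpha> = a \<cdot> k" "Cod C \<alpha> = b \<cdot> t"
  shows "rw (xs @ [a]) k (xs @ [b]) t (lw xs \<alpha>) z = lw xs (rw [a] k [b] t \<alpha> z)"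
  using assms
proof (induction xs)
  case (Cons x xs)
  have e: "Trg C b = Trg C a" using assms Dom_Cod_simps(4)[of \<alpha>] by simp
  show ?case using Cons e by (subst append_Cons, subst append_Cons, subst lw.simps, subst rw_lwhisk) simp_all
qed simp

text \<open>
  The 2-morphisms \<open>act xs k \<Rightarrow> act ys k\<close> that do not touch \<open>k\<close>. All rebracketings and all whiskerings by
  \<open>\<delta>\<close>, \<open>\<sigma>\<close>, \<open>\<xi>\<close>, \<open>\<eta>\<close> are of this kind; the pentagon enters only through \<open>family_Assoc\<close>.
\<close>

definition family :: "'o \<Rightarrow> 'm list \<Rightarrow> 'm list \<Rightarrow> ('m \<Rightarrow> 'c) \<Rightarrow> bool" where
  "family A xs ys Y \<longleftrightarrow> path xs A \<and> path ys A \<and> tgt xs A = tgt ys A \<and>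
     (\<forall>k \<in> Mor C. Trg C k = A \<longrightarrow> invertible (Y k) \<and> Dom C (Y k) = act xs k \<and> Cod C (Y k) = act ys k) \<and>
     (\<forall>\<beta> \<in> Cell C. Trg C (Dom C \<beta>) = A \<longrightarrow> Y (Cod C \<beta>) \<bullet> lw xs \<beta> = lw ys \<beta> \<bullet> Y (Dom C \<beta>)) \<and>
     (\<forall>k \<in> Mor C. \<forall>z \<in> Mor C. Trg C k = A \<longrightarrow> Src C k = Trg C z \<longrightarrow>
        Y (k \<cdot> z) \<bullet> reassoc xs k z = reassoc ys k z \<bullet> (Y k \<lhd> z))"

lemma familyD:
  assumes "family A xs ys Y"
  shows "path xs A" "path ys A" "tgt xs A = tgt ys A"
    "k \<in> Mor C \<Longrightarrow> Trg C k = A \<Longrightarrow> invertible (Y k)"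
    "k \<in> Mor C \<Longrightarrow> Trg C k = A \<Longrightarrow> Dom C (Y k) = act xs k"
    "k \<in> Mor C \<Longrightarrow> Trg C k = A \<Longrightarrow> Cod C (Y k) = act ys k"
    "\<beta> \<in> Cell C \<Longrightarrow> Trg C (Dom C \<beta>) = A \<Longrightarrow> Y (Cod C \<beta>) \<bullet> lw xs \<beta> = lw ys \<beta> \<bullet> Y (Dom C \<beta>)"
    "k \<in> Mor C \<Longrightarrow> z \<in> Mor C \<Longrightarrow> Trg C k = A \<Longrightarrow> Src C k = Trg C z \<Longrightarrow>
        Y (k \<cdot> z) \<bullet> reassoc xs k z = reassoc ys k z \<bullet> (Y k \<lhd> z)"
  using assms unfolding family_def by blast+

text \<open>The precomposition clause of \<open>family\<close>, with one rebracketing moved to the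
  other side: precomposing a member of the family by \<open>z\<close> gives the member at
  \<open>k \<cdot> z\<close>.\<close>

lemma family_rw:
  assumes "family A xs ys Y" "k \<in> Mor C" "Trg C k = A" "z \<in> Mor C" "Src C k = Trg C z"
  shows "rw xs k ys k (Y k) z = Y (k \<cdot> z)"
proof -
  note [simp] = familyD(1-6)[OF assms(1)] and [simp] = assms(2-)
  have "rw xs k ys k (Y k) z = (reassoc ys k z \<bullet> (Y k \<lhd> z)) \<bullet> (reassoc xs k z)\<^sup>-"
    by (simp add: rw_def)
  also have "\<dots> = (Y (k \<cdot> z) \<bullet> reassoc xs k z) \<bullet> (reassoc xs k z)\<^sup>-"
    using familyD(8)[OF assms(1), of k z] by simp
  finally show ?thesis by simp
qed

section \<open>Construction of families\<close>

lemma family_Id: "path xs A \<Longrightarrow> family A xs xs (\<lambda>k. Id2 C (act xs k))"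
  unfolding family_def by (intro conjI ballI impI) simp_all

lemma family_VComp:
  assumes Y: "family A xs ys Y" and Z: "family A ys zs Z"
  shows "family A xs zs (\<lambda>k. Z k \<bullet> Y k)"
proof -
  note [simp] = familyD(1,2,4-6)[OF Y] familyD(2,4-6)[OF Z]
  have [simp]: "tgt xs A = tgt zs A" "tgt ys A = tgt zs A" using familyD(3)[OF Y] familyD(3)[OF Z] by auto
  show ?thesis
    unfolding family_def
  proof (intro conjI ballI impI)
    fix \<beta> assume \<beta> [simp]: "\<beta> \<in> Cell C" "Trg C (Dom C \<beta>) = A"
    have "(Z (Cod C \<beta>) \<bullet> Y (Cod C \<beta>)) \<bullet> lw xs \<beta> = Z (Cod C \<beta>) \<bullet> (lw ys \<beta> \<bullet> Y (Dom C \<beta>))"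
      by (simp add: familyD(7)[OF Y])
    also have "\<dots> = (Z (Cod C \<beta>) \<bullet> lw ys \<beta>) \<bullet> Y (Dom C \<beta>)" by simp
    also have "\<dots> = (lw zs \<beta> \<bullet> Z (Dom C \<beta>)) \<bullet> Y (Dom C \<beta>)" by (subst familyD(7)[OF Z]) simp_all
    finally show "(Z (Cod C \<beta>) \<bullet> Y (Cod C \<beta>)) \<bullet> lw xs \<beta> = lw zs \<beta> \<bullet> Z (Dom C \<beta>) \<bullet> Y (Dom C \<beta>)"
      by simp
  next
    fix k z assume [simp]: "k \<in> Mor C" "z \<in> Mor C" "Trg C k = A" "Src C k = Trg C z"
    have "(Z (k \<cdot> z) \<bullet> Y (k \<cdot> z)) \<bullet> reassoc xs k z = Z (k \<cdot> z) \<bullet> (reassoc ys k z \<bullet> (Y k \<lhd> z))"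
      by (simp add: familyD(8)[OF Y])
    also have "\<dots> = (Z (k \<cdot> z) \<bullet> reassoc ys k z) \<bullet> (Y k \<lhd> z)" by simp
    also have "\<dots> = (reassoc zs k z \<bullet> (Z k \<lhd> z)) \<bullet> (Y k \<lhd> z)" by (subst familyD(8)[OF Z]) simp_all
    finally show "(Z (k \<cdot> z) \<bullet> Y (k \<cdot> z)) \<bullet> reassoc xs k z = reassoc zs k z \<bullet> ((Z k \<bullet> Y k) \<lhd> z)"
      by (simp add: whisker_VComp)
  qed simp_all
qed

lemma family_inv:
  assumes Y: "family A xs ys Y"
  shows "family A ys xs (\<lambda>k. (Y k)\<^sup>-)"
proof -
  note [simp] = familyD(1-6)[OF Y]
  show ?thesis
    unfolding family_def
  proof (intro conjI ballI impI)
    fix \<beta> assume \<beta> [simp]: "\<beta> \<in> Cell C" "Trg C (Dom C \<beta>) = A"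
    have "(Y (Cod C \<beta>))\<^sup>- \<bullet> lw ys \<beta> = (Y (Cod C \<beta>))\<^sup>- \<bullet> (lw ys \<beta> \<bullet> Y (Dom C \<beta>)) \<bullet> (Y (Dom C \<beta>))\<^sup>-"
      by simp
    also have "\<dots> = (Y (Cod C \<beta>))\<^sup>- \<bullet> (Y (Cod C \<beta>) \<bullet> lw xs \<beta>) \<bullet> (Y (Dom C \<beta>))\<^sup>-"
      by (subst familyD(7)[OF Y]) simp_all
    finally show "(Y (Cod C \<beta>))\<^sup>- \<bullet> lw ys \<beta> = lw xs \<beta> \<bullet> (Y (Dom C \<beta>))\<^sup>-" by simp
  next
    fix k z assume [simp]: "k \<in> Mor C" "z \<in> Mor C" "Trg C k = A" "Src C k = Trg C z"
    have "(Y (k \<cdot> z))\<^sup>- \<bullet> reassoc ys k z = (Y (k \<cdot> z))\<^sup>- \<bullet> (reassoc ys k z \<bullet> (Y k \<lhd> z)) \<bullet> ((Y k)\<^sup>- \<lhd> z)"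
      by (simp flip: whisker_VComp)
    also have "\<dots> = (Y (k \<cdot> z))\<^sup>- \<bullet> (Y (k \<cdot> z) \<bullet> reassoc xs k z) \<bullet> ((Y k)\<^sup>- \<lhd> z)"
      by (subst familyD(8)[OF Y]) simp_all
    finally show "(Y (k \<cdot> z))\<^sup>- \<bullet> reassoc ys k z = reassoc xs k z \<bullet> ((Y k)\<^sup>- \<lhd> z)" by simp
  qed simp_all
qed

lemma family_lwhisk:
  assumes Y: "family A xs ys Y" and x: "x \<in> Mor C" "Src C x = tgt xs A"
  shows "family A (x # xs) (x # ys) (\<lambda>k. x \<rhd> Y k)"
proof -
  note [simp] = familyD(1-6)[OF Y] x
  show ?thesis
    unfolding family_def
  proof (intro conjI ballI impI)
    fix \<beta> assume \<beta> [simp]: "\<beta> \<in> Cell C" "Trg C (Dom C \<beta>) = A"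
    show "(x \<rhd> Y (Cod C \<beta>)) \<bullet> lw (x # xs) \<beta> = lw (x # ys) \<beta> \<bullet> (x \<rhd> Y (Dom C \<beta>))"
      by (simp add: familyD(7)[OF Y] flip: whisker_VComp)
  next
    fix k z assume [simp]: "k \<in> Mor C" "z \<in> Mor C" "Trg C k = A" "Src C k = Trg C z"
    have "(x \<rhd> Y (k \<cdot> z)) \<bullet> reassoc (x # xs) k z = (x \<rhd> (Y (k \<cdot> z) \<bullet> reassoc xs k z)) \<bullet> \<a>[x, act xs k, z]\<^sup>-"
      by (simp add: whisker_VComp)
    also have "\<dots> = (x \<rhd> (reassoc ys k z \<bullet> (Y k \<lhd> z))) \<bullet> \<a>[x, act xs k, z]\<^sup>-"
      by (subst familyD(8)[OF Y]) simp_all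
    also have "\<dots> = (x \<rhd> reassoc ys k z) \<bullet> (\<a>[x, act ys k, z]\<^sup>- \<bullet> ((x \<rhd> Y k) \<lhd> z))"
      by (subst Assoc_inv_whisker) (simp_all add: whisker_VComp)
    finally show "(x \<rhd> Y (k \<cdot> z)) \<bullet> reassoc (x # xs) k z = reassoc (x # ys) k z \<bullet> ((x \<rhd> Y k) \<lhd> z)"
      by simp
  qed simp_all
qed

text \<open>Naturality in \<open>k\<close> is the exchange law; the precomposition clause is
  naturality of the associator in its first argument.\<close>

lemma family_rwhisk:
  assumes "invertible \<alpha>" "Dom C \<alpha> = x" "Cod C \<alpha> = y" "Src C x = A"
  shows "family A [x] [y] (\<lambda>k. \<alpha> \<lhd> k)"
proof -
  have [simp]: "x \<in> Mor C" "y \<in> Mor C" "Trg C x = Trg C y" "Src C y = A" "invertible \<alpha>" "Dom C \<alpha> = x" "Cod C \<alpha> = y" "Src C x = A"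
    using assms Dom_Cod_simps[of \<alpha>] by auto
  show ?thesis
    unfolding family_def
  proof (intro conjI ballI impI)
    fix \<beta> assume \<beta> [simp]: "\<beta> \<in> Cell C" "Trg C (Dom C \<beta>) = A"
    show "(\<alpha> \<lhd> Cod C \<beta>) \<bullet> lw [x] \<beta> = lw [y] \<beta> \<bullet> (\<alpha> \<lhd> Dom C \<beta>)"
      using whisker_exchange[of \<beta> \<alpha>] by simp
  next
    fix k z assume [simp]: "k \<in> Mor C" "z \<in> Mor C" "Trg C k = A" "Src C k = Trg C z"
    show "(\<alpha> \<lhd> (k \<cdot> z)) \<bullet> reassoc [x] k z = reassoc [y] k z \<bullet> ((\<alpha> \<lhd> k) \<lhd> z)"
      using Assoc_inv_natural[of "Id2 C z" "Id2 C k" \<alpha>] by simp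
  qed simp_all
qed

text \<open>The precomposition clause is the pentagon for \<open>x, y, k, z\<close>, with the three
  associators whose last argument is \<open>z\<close> moved to the opposite sides.\<close>

lemma family_Assoc:
  assumes [simp]: "x \<in> Mor C" "y \<in> Mor C" "Src C x = Trg C y" "Src C y = A"
  shows "family A [x, y] [x \<cdot> y] (\<lambda>k. \<a>[x, y, k])"
  unfolding family_def
proof (intro conjI ballI impI)
  fix \<beta> assume \<beta> [simp]: "\<beta> \<in> Cell C" "Trg C (Dom C \<beta>) = A"
  show "\<a>[x, y, Cod C \<beta>] \<bullet> lw [x, y] \<beta> = lw [x \<cdot> y] \<beta> \<bullet> \<a>[x, y, Dom C \<beta>]"
    using Assoc_natural'[of \<beta> "Id2 C y" "Id2 C x"] by simp
next
  fix k z assume [simp]: "k \<in> Mor C" "z \<in> Mor C" "Trg C k = A" "Src C k = Trg C z"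
  \<comment> \<open>Folds the whiskered inverse into the inverse of a whiskered cell, so that
    cancellation applies; the simp rule in the opposite direction is switched off where this is
    used.\<close>
  have inv: "x \<rhd> \<a>[y, k, z]\<^sup>- = (x \<rhd> \<a>[y, k, z])\<^sup>-" by simp
  have "\<a>[x, y, k \<cdot> z] \<bullet> reassoc [x, y] k z =
      \<a>[x \<cdot> y, k, z]\<^sup>- \<bullet> (\<a>[x \<cdot> y, k, z] \<bullet> \<a>[x, y, k \<cdot> z]) \<bullet> (x \<rhd> \<a>[y, k, z]\<^sup>-) \<bullet> \<a>[x, y \<cdot> k, z]\<^sup>-"
    by simp
  also have "\<dots> = \<a>[x \<cdot> y, k, z]\<^sup>- \<bullet> ((\<a>[x, y, k] \<lhd> z) \<bullet> \<a>[x, y \<cdot> k, z] \<bullet> (x \<rhd> \<a>[y, k, z])) \<bullet>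
      (x \<rhd> \<a>[y, k, z]\<^sup>-) \<bullet> \<a>[x, y \<cdot> k, z]\<^sup>-"
    by (subst pentagon'[symmetric]) simp_all
  also have "\<dots> = \<a>[x \<cdot> y, k, z]\<^sup>- \<bullet> (\<a>[x, y, k] \<lhd> z)"
    by (simp add: inv del: invertible_HComp(2))
  finally show "\<a>[x, y, k \<cdot> z] \<bullet> reassoc [x, y] k z = reassoc [x \<cdot> y] k z \<bullet> (\<a>[x, y, k] \<lhd> z)"
    by simp
qed simp_all

text \<open>Naturality of \<open>Y\<close> at the cell \<open>reassoc ks k z\<close> reduces the
  precomposition clause for \<open>k\<close> to the one for \<open>act ks k\<close>.\<close>

lemma family_shift:
  assumes Y: "family A xs ys Y" and ks: "path ks B" "tgt ks B = A"
  shows "family B (xs @ ks) (ys @ ks) (\<lambda>k. Y (act ks k))"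
proof -
  note [simp] = familyD(1-6)[OF Y] ks
  show ?thesis
    unfolding family_def
  proof (intro conjI ballI impI)
    fix \<beta> assume \<beta> [simp]: "\<beta> \<in> Cell C" "Trg C (Dom C \<beta>) = B"
    show "Y (act ks (Cod C \<beta>)) \<bullet> lw (xs @ ks) \<beta> = lw (ys @ ks) \<beta> \<bullet> Y (act ks (Dom C \<beta>))"
      using familyD(7)[OF Y, of "lw ks \<beta>"] by simp
  next
    fix k z assume [simp]: "k \<in> Mor C" "z \<in> Mor C" "Trg C k = B" "Src C k = Trg C z"
    have "Y (act ks (k \<cdot> z)) \<bullet> reassoc (xs @ ks) k z =
        (Y (act ks (k \<cdot> z)) \<bullet> lw xs (reassoc ks k z)) \<bullet> reassoc xs (act ks k) z"
      by (simp add: reassoc_append)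
    also have "\<dots> = (lw ys (reassoc ks k z) \<bullet> Y (act ks k \<cdot> z)) \<bullet> reassoc xs (act ks k) z"
      using familyD(7)[OF Y, of "reassoc ks k z"] by simp
    also have "\<dots> = lw ys (reassoc ks k z) \<bullet> (Y (act ks k \<cdot> z) \<bullet> reassoc xs (act ks k) z)"
      by simp
    also have "\<dots> = lw ys (reassoc ks k z) \<bullet> reassoc ys (act ks k) z \<bullet> (Y (act ks k) \<lhd> z)"
      by (subst familyD(8)[OF Y]) simp_all
    finally show "Y (act ks (k \<cdot> z)) \<bullet> reassoc (xs @ ks) k z = reassoc (ys @ ks) k z \<bullet> (Y (act ks k) \<lhd> z)"
      by (simp add: reassoc_append)
  qed simp_all
qed

text \<open>The roles change here: \<open>k\<close> is frozen and the morphism precomposed with is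
  the variable. Each step of the induction composes an inverse associator with a whiskered
  family.\<close>

lemma family_reassoc:
  assumes "path xs (Trg C k)" "k \<in> Mor C"
  shows "family (Src C k) [act xs k] (xs @ [k]) (reassoc xs k)"
  using assms(1)
proof (induction xs)
  case Nil
  show ?case using family_Id[of "[k]" "Src C k"] assms by simp
next
  case (Cons x xs)
  note [simp] = assms(2)
  have 1: "family (Src C k) [x \<cdot> act xs k] [x, act xs k] (\<lambda>z. \<a>[x, act xs k, z]\<^sup>-)"
    by (rule family_inv, rule family_Assoc) (use Cons.prems in simp_all)
  have 2: "family (Src C k) [x, act xs k] (x # xs @ [k]) (\<lambda>z. x \<rhd> reassoc xs k z)"
    by (rule family_lwhisk, rule Cons.IH) (use Cons.prems in simp_all)
  show ?case using family_VComp[OF 1 2] by simp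
qed

text \<open>No naturality of \<open>\<alpha>\<close> is involved: \<open>rw\<close> whiskers the
  fixed cell \<open>\<alpha>\<close> by the variable and conjugates with \<open>reassoc\<close>, and
  all three constituents are families in that variable.\<close>

lemma family_rw_fun:
  assumes "path xs (Trg C k)" "path ys (Trg C t)" "k \<in> Mor C" "t \<in> Mor C" "Src C t = Src C k"
    "invertible \<alpha>" "Dom C \<alpha> = act xs k" "Cod C \<alpha> = act ys t"
  shows "family (Src C k) (xs @ [k]) (ys @ [t]) (rw xs k ys t \<alpha>)"
proof -
  have "family (Src C k) [act xs k] [act ys t] (\<lambda>z. \<alpha> \<lhd> z)"
    by (rule family_rwhisk) (use assms in simp_all)
  moreover have "family (Src C k) (xs @ [k]) [act xs k] (\<lambda>z. (reassoc xs k z)\<^sup>-)"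
    by (rule family_inv, rule family_reassoc) (use assms in simp_all)
  moreover have "family (Src C k) [act ys t] (ys @ [t]) (reassoc ys t)"
    using family_reassoc[of ys t] assms by simp
  ultimately have "family (Src C k) (xs @ [k]) (ys @ [t]) (\<lambda>z. reassoc ys t z \<bullet> (\<alpha> \<lhd> z) \<bullet> (reassoc xs k z)\<^sup>-)"
    by (intro family_VComp)
  then show ?thesis unfolding rw_def .
qed

section \<open>Comparison of spans\<close>

text \<open>The pairs \<open>k, t\<close> and \<open>k', t'\<close> stand for the legs
  \<open>u4, u5\<close> of two sets of data. As in \<open>frac_equiv\<close>,
  \<open>\<sigma>\<close> runs from the primed to the unprimed composite and \<open>\<tau>\<close>
  runs back, so that they can be placed on both sides of a cell of the unprimed data.\<close>

definition comparison :: "'m \<Rightarrow> 'm \<Rightarrow> 'm \<Rightarrow> 'm \<Rightarrow> 'm \<Rightarrow> 'm \<Rightarrow> 'c \<Rightarrow> 'c \<Rightarrow> bool" where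
  "comparison k t k' t' z z' \<sigma> \<tau> \<longleftrightarrow>
     k \<in> Mor C \<and> t \<in> Mor C \<and> k' \<in> Mor C \<and> t' \<in> Mor C \<and> z \<in> Mor C \<and> z' \<in> Mor C \<and>
     Src C k = Trg C z \<and> Src C t = Trg C z \<and> Src C k' = Trg C z' \<and> Src C t' = Trg C z' \<and>
     Src C z' = Src C z \<and> Trg C k' = Trg C k \<and> Trg C t' = Trg C t \<and>
     invertible \<sigma> \<and> Dom C \<sigma> = k' \<cdot> z' \<and> Cod C \<sigma> = k \<cdot> z \<and>
     invertible \<tau> \<and> Dom C \<tau> = t \<cdot> z \<and> Cod C \<tau> = t' \<cdot> z'"

definition iso_between :: "'m list \<Rightarrow> 'm \<Rightarrow> 'm list \<Rightarrow> 'm \<Rightarrow> 'c \<Rightarrow> bool" where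
  "iso_between xs k ys t \<alpha> \<longleftrightarrow> path xs (Trg C k) \<and> path ys (Trg C t) \<and>
     invertible \<alpha> \<and> Dom C \<alpha> = act xs k \<and> Cod C \<alpha> = act ys t"

text \<open>The equation of \<open>frac_equiv\<close> with its associators absorbed into
  \<open>rw\<close>; \<open>compatible_single\<close> recovers the original form.\<close>

definition compatible ::
    "'m list \<Rightarrow> 'm list \<Rightarrow> 'm \<Rightarrow> 'm \<Rightarrow> 'm \<Rightarrow> 'm \<Rightarrow> 'm \<Rightarrow> 'm \<Rightarrow> 'c \<Rightarrow> 'c \<Rightarrow> 'c \<Rightarrow> 'c \<Rightarrow> bool" where
  "compatible xs ys k t k' t' z z' \<sigma> \<tau> \<alpha> \<alpha>' \<longleftrightarrow>
     lw ys \<tau> \<bullet> rw xs k ys t \<alpha> z \<bullet> lw xs \<sigma> = rw xs k' ys t' \<alpha>' z'"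

lemma comparisonD:
  assumes "comparison k t k' t' z z' \<sigma> \<tau>"
  shows "k \<in> Mor C" "t \<in> Mor C" "k' \<in> Mor C" "t' \<in> Mor C" "z \<in> Mor C" "z' \<in> Mor C"
     "Src C k = Trg C z" "Src C t = Trg C z" "Src C k' = Trg C z'" "Src C t' = Trg C z'"
     "Src C z' = Src C z" "Trg C k' = Trg C k" "Trg C t' = Trg C t"
     "invertible \<sigma>" "Dom C \<sigma> = k' \<cdot> z'" "Cod C \<sigma> = k \<cdot> z"
     "invertible \<tau>" "Dom C \<tau> = t \<cdot> z" "Cod C \<tau> = t' \<cdot> z'"
  using assms unfolding comparison_def by blast+

lemma iso_betweenD:
  assumes "iso_between xs k ys t \<alpha>"
  shows "path xs (Trg C k)" "path ys (Trg C t)" "invertible \<alpha>" "Dom C \<alpha> = act xs k" "Cod C \<alpha> = act ys t"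
  using assms unfolding iso_between_def by blast+

lemma iso_between_tgt:
  assumes "iso_between xs k ys t \<alpha>" "k \<in> Mor C" "t \<in> Mor C"
  shows "tgt ys (Trg C t) = tgt xs (Trg C k)"
  using iso_betweenD[OF assms(1)] assms Dom_Cod_simps(4)[of \<alpha>] by simp

lemma comparison_precomp:
  assumes "comparison k t k' t' z z' \<sigma> \<tau>" "x \<in> Mor C" "Trg C x = Src C z"
  shows "comparison k t k' t' (z \<cdot> x) (z' \<cdot> x) (rw [k'] z' [k] z \<sigma> x) (rw [t] z [t'] z' \<tau> x)"
proof -
  note [simp] = comparisonD[OF assms(1)] assms(2,3)
  show ?thesis unfolding comparison_def by simp
qed

lemma rw_VComp3:
  assumes "path xs (Trg C k)" "path ys (Trg C t)" "path zs (Trg C r)" "path ws (Trg C s)"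
    "k \<in> Mor C" "t \<in> Mor C" "r \<in> Mor C" "s \<in> Mor C" "z \<in> Mor C"
    "Src C k = Trg C z" "Src C t = Trg C z" "Src C r = Trg C z" "Src C s = Trg C z"
    "\<alpha> \<in> Cell C" "\<beta> \<in> Cell C" "\<gamma> \<in> Cell C" "Dom C \<alpha> = act xs k" "Cod C \<alpha> = act ys t"
    "Dom C \<beta> = act ys t" "Cod C \<beta> = act zs r" "Dom C \<gamma> = act zs r" "Cod C \<gamma> = act ws s"
  shows "rw xs k ws s (\<gamma> \<bullet> \<beta> \<bullet> \<alpha>) z = rw zs r ws s \<gamma> z \<bullet> rw ys t zs r \<beta> z \<bullet> rw xs k ys t \<alpha> z"
  using rw_VComp[of xs k zs r ws s z "\<beta> \<bullet> \<alpha>" \<gamma>] rw_VComp[of xs k ys t zs r z \<alpha> \<beta>] assms by simp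

text \<open>Precomposition by \<open>z\<close> and by \<open>x\<close> in turn agrees with
  precomposition by \<open>z \<cdot> x\<close>, because \<open>rw xs k ys t \<alpha>\<close> is
  itself a family, to which \<open>family_rw\<close> applies.\<close>

lemma rw_rw:
  assumes "iso_between xs k ys t \<alpha>" "k \<in> Mor C" "t \<in> Mor C" "z \<in> Mor C" "x \<in> Mor C"
    "Src C k = Trg C z" "Src C t = Trg C z" "Src C z = Trg C x"
  shows "rw (xs @ [k]) z (ys @ [t]) z (rw xs k ys t \<alpha> z) x = rw xs k ys t \<alpha> (z \<cdot> x)"
proof -
  have "family (Src C k) (xs @ [k]) (ys @ [t]) (rw xs k ys t \<alpha>)"
    by (rule family_rw_fun) (use iso_betweenD[OF assms(1)] assms(2-7) in simp_all)
  then show ?thesis by (rule family_rw) (use assms in simp_all)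
qed

text \<open>The right-hand side is the compatibility equation for \<open>z, z'\<close> with
  \<open>rw\<close> by \<open>x\<close> applied to both members. It can thus be reached from that
  equation itself, or, as in \<open>compatible_faithful\<close>, from equality after whiskering with
  \<open>x\<close> alone.\<close>

lemma compatible_precomp_iff:
  assumes cmp: "comparison k t k' t' z z' \<sigma> \<tau>" and \<alpha>: "iso_between xs k ys t \<alpha>" and \<alpha>': "iso_between xs k' ys t' \<alpha>'"
    and x: "x \<in> Mor C" "Trg C x = Src C z"
  shows "compatible xs ys k t k' t' (z \<cdot> x) (z' \<cdot> x) (rw [k'] z' [k] z \<sigma> x) (rw [t] z [t'] z' \<tau> x) \<alpha> \<alpha>' \<longleftrightarrow>
    rw (xs @ [k']) z' (ys @ [t']) z' (lw ys \<tau> \<bullet> rw xs k ys t \<alpha> z \<bullet> lw xs \<sigma>) x =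
    rw (xs @ [k']) z' (ys @ [t']) z' (rw xs k' ys t' \<alpha>' z') x"
proof -
  note [simp] = comparisonD[OF cmp] x iso_betweenD[OF \<alpha>] iso_betweenD(3-)[OF \<alpha>']
  have 1: "rw (xs @ [k']) z' (ys @ [t']) z' (rw xs k' ys t' \<alpha>' z') x = rw xs k' ys t' \<alpha>' (z' \<cdot> x)"
    by (rule rw_rw[OF \<alpha>']) simp_all
  have "rw (xs @ [k']) z' (ys @ [t']) z' (lw ys \<tau> \<bullet> rw xs k ys t \<alpha> z \<bullet> lw xs \<sigma>) x =
      rw (ys @ [t]) z (ys @ [t']) z' (lw ys \<tau>) x \<bullet> rw (xs @ [k]) z (ys @ [t]) z (rw xs k ys t \<alpha> z) x \<bullet>
      rw (xs @ [k']) z' (xs @ [k]) z (lw xs \<sigma>) x"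
    by (rule rw_VComp3) simp_all
  also have "\<dots> = lw ys (rw [t] z [t'] z' \<tau> x) \<bullet> rw xs k ys t \<alpha> (z \<cdot> x) \<bullet> lw xs (rw [k'] z' [k] z \<sigma> x)"
    by (simp add: rw_lw rw_rw[OF \<alpha>])
  finally show ?thesis unfolding compatible_def 1 by simp
qed

lemma compatible_precomp:
  assumes "comparison k t k' t' z z' \<sigma> \<tau>" "iso_between xs k ys t \<alpha>" "iso_between xs k' ys t' \<alpha>'"
    and "x \<in> Mor C" "Trg C x = Src C z"
    and "compatible xs ys k t k' t' z z' \<sigma> \<tau> \<alpha> \<alpha>'"
  shows "compatible xs ys k t k' t' (z \<cdot> x) (z' \<cdot> x) (rw [k'] z' [k] z \<sigma> x) (rw [t] z [t'] z' \<tau> x) \<alpha> \<alpha>'"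
  unfolding compatible_precomp_iff[OF assms(1-5)] assms(6)[unfolded compatible_def] ..

lemma rw_paste:
  assumes Y: "family (Trg C k) xs0 (e # xs) Y" and Z: "family (Trg C t) (e # ys) ys0 Z"
    and "k \<in> Mor C" "t \<in> Mor C" "z \<in> Mor C" "Src C k = Trg C z" "Src C t = Trg C z"
    and \<alpha>: "iso_between xs k ys t \<alpha>"
  shows "rw xs0 k ys0 t (Z t \<bullet> (e \<rhd> \<alpha>) \<bullet> Y k) z = Z (t \<cdot> z) \<bullet> (e \<rhd> rw xs k ys t \<alpha> z) \<bullet> Y (k \<cdot> z)"
proof -
  note [simp] = assms(3-7) familyD(1,4-6)[OF Y] familyD(2,4-6)[OF Z] iso_betweenD[OF \<alpha>] iso_between_tgt[OF \<alpha>]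
  have e [simp]: "e \<in> Mor C" "Src C e = tgt xs (Trg C k)" using familyD(2)[OF Y] by auto
  have "rw xs0 k ys0 t (Z t \<bullet> (e \<rhd> \<alpha>) \<bullet> Y k) z =
      rw (e # ys) t ys0 t (Z t) z \<bullet> rw (e # xs) k (e # ys) t (e \<rhd> \<alpha>) z \<bullet> rw xs0 k (e # xs) k (Y k) z"
    by (rule rw_VComp3) simp_all
  then show ?thesis by (simp add: family_rw[OF Y] family_rw[OF Z] rw_lwhisk)
qed

text \<open>Naturality of \<open>Z\<close> at \<open>\<tau>\<close> and of \<open>Y\<close> at
  \<open>\<sigma>\<close> slides both comparison cells through the pasting to the inside of
  \<open>e \<rhd> _\<close>, where the compatibility of \<open>\<alpha>\<close> and
  \<open>\<alpha>'\<close> applies.\<close>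

lemma compatible_paste:
  assumes Y: "family (Trg C k) xs0 (e # xs) Y" and Z: "family (Trg C t) (e # ys) ys0 Z"
    and cmp: "comparison k t k' t' z z' \<sigma> \<tau>" and \<alpha>: "iso_between xs k ys t \<alpha>" and \<alpha>': "iso_between xs k' ys t' \<alpha>'"
    and c: "compatible xs ys k t k' t' z z' \<sigma> \<tau> \<alpha> \<alpha>'"
  shows "compatible xs0 ys0 k t k' t' z z' \<sigma> \<tau> (Z t \<bullet> (e \<rhd> \<alpha>) \<bullet> Y k) (Z t' \<bullet> (e \<rhd> \<alpha>') \<bullet> Y k')"
proof -
  note [simp] = comparisonD[OF cmp] familyD(1,4-6)[OF Y] familyD(2,4-6)[OF Z] iso_betweenD[OF \<alpha>] iso_betweenD(3-)[OF \<alpha>']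
    iso_between_tgt[OF \<alpha>]
  have e [simp]: "e \<in> Mor C" "Src C e = tgt xs (Trg C k)" using familyD(2)[OF Y] by auto
  have "lw ys0 \<tau> \<bullet> rw xs0 k ys0 t (Z t \<bullet> (e \<rhd> \<alpha>) \<bullet> Y k) z \<bullet> lw xs0 \<sigma> =
     lw ys0 \<tau> \<bullet> (Z (t \<cdot> z) \<bullet> (e \<rhd> rw xs k ys t \<alpha> z) \<bullet> Y (k \<cdot> z)) \<bullet> lw xs0 \<sigma>"
    by (subst rw_paste[OF Y Z]) (simp_all add: \<alpha>)
  also have "\<dots> = (lw ys0 \<tau> \<bullet> Z (t \<cdot> z)) \<bullet> (e \<rhd> rw xs k ys t \<alpha> z) \<bullet> (Y (k \<cdot> z) \<bullet> lw xs0 \<sigma>)" by simp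
  also have "\<dots> = (Z (t' \<cdot> z') \<bullet> (e \<rhd> lw ys \<tau>)) \<bullet> (e \<rhd> rw xs k ys t \<alpha> z) \<bullet> ((e \<rhd> lw xs \<sigma>) \<bullet> Y (k' \<cdot> z'))"
    using familyD(7)[OF Y, of \<sigma>] familyD(7)[OF Z, of \<tau>] by simp
  also have "\<dots> = Z (t' \<cdot> z') \<bullet> (e \<rhd> (lw ys \<tau> \<bullet> rw xs k ys t \<alpha> z \<bullet> lw xs \<sigma>)) \<bullet> Y (k' \<cdot> z')"
    by (simp add: whisker_VComp)
  also have "\<dots> = Z (t' \<cdot> z') \<bullet> (e \<rhd> rw xs k' ys t' \<alpha>' z') \<bullet> Y (k' \<cdot> z')"
    using c unfolding compatible_def by simp
  also have "\<dots> = rw xs0 k' ys0 t' (Z t' \<bullet> (e \<rhd> \<alpha>') \<bullet> Y k') z'"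
    by (subst rw_paste[where e = e and xs = xs and ys = ys]) (use Y Z \<alpha>' in simp_all)
  finally show ?thesis unfolding compatible_def .
qed

lemma compatible_single:
  assumes cmp: "comparison k t k' t' z z' \<sigma> \<tau>"
    and \<alpha>: "iso_between [x] k [y] t \<alpha>" and \<alpha>': "iso_between [x] k' [y] t' \<alpha>'"
    and c: "compatible [x] [y] k t k' t' z z' \<sigma> \<tau> \<alpha> \<alpha>'"
  shows "\<a>[y, t', z'] \<bullet> (y \<rhd> \<tau>) \<bullet> \<a>[y, t, z]\<^sup>- \<bullet> (\<alpha> \<lhd> z) \<bullet> \<a>[x, k, z] \<bullet> (x \<rhd> \<sigma>) \<bullet> \<a>[x, k', z']\<^sup>- = \<alpha>' \<lhd> z'"
proof -
  note [simp] = comparisonD[OF cmp] iso_betweenD(3-)[OF \<alpha>] iso_betweenD(3-)[OF \<alpha>']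
  have [simp]: "x \<in> Mor C" "y \<in> Mor C" "Src C x = Trg C k" "Src C y = Trg C t"
    using iso_betweenD(1,2)[OF \<alpha>] by simp_all
  have [simp]: "Trg C y = Trg C x" using iso_between_tgt[OF \<alpha>] by simp
  have c': "lw [y] \<tau> \<bullet> rw [x] k [y] t \<alpha> z \<bullet> lw [x] \<sigma> = rw [x] k' [y] t' \<alpha>' z'"
    using c unfolding compatible_def .
  have "\<a>[y, t', z'] \<bullet> (y \<rhd> \<tau>) \<bullet> \<a>[y, t, z]\<^sup>- \<bullet> (\<alpha> \<lhd> z) \<bullet> \<a>[x, k, z] \<bullet> (x \<rhd> \<sigma>) \<bullet> \<a>[x, k', z']\<^sup>- =
      \<a>[y, t', z'] \<bullet> (lw [y] \<tau> \<bullet> rw [x] k [y] t \<alpha> z \<bullet> lw [x] \<sigma>) \<bullet> \<a>[x, k', z']\<^sup>-"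
    by (simp add: rw_def)
  also have "\<dots> = \<alpha>' \<lhd> z'" unfolding c' by (simp add: rw_def)
  finally show ?thesis .
qed

end

section \<open>Consequences of the conditions (BF)\<close>

locale fractions = bicategory C for C :: "('o, 'm, 'c) bicat" (structure) +
  fixes W :: "'m set"
  assumes BF: "BF C W"
begin

lemma W_Mor: "w \<in> W \<Longrightarrow> w \<in> Mor C"
  using BF unfolding BF_def by blast

lemma W_Id1: "A \<in> Obj C \<Longrightarrow> Id1 C A \<in> W"
  using BF unfolding BF_def BF1_def by blast

lemma W_Comp: "w \<in> W \<Longrightarrow> v \<in> W \<Longrightarrow> Src C v = Trg C w \<Longrightarrow> v \<cdot> w \<in> W"
  using BF W_Mor unfolding BF_def BF2_def hom1_iff by blast

lemma W_iso: "w \<in> W \<Longrightarrow> invertible \<alpha> \<Longrightarrow> Dom C \<alpha> = v \<Longrightarrow> Cod C \<alpha> = w \<Longrightarrow> v \<in> W"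
  using BF unfolding BF_def BF5_def iso2_iff by blast

lemma W_iso': "w \<in> W \<Longrightarrow> invertible \<alpha> \<Longrightarrow> Dom C \<alpha> = w \<Longrightarrow> Cod C \<alpha> = v \<Longrightarrow> v \<in> W"
  using W_iso[of w "\<alpha>\<^sup>-" v] by simp

lemma W_square:
  assumes "w \<in> W" "f \<in> Mor C" "Trg C f = Trg C w"
  obtains w' f' \<alpha> where "w' \<in> W" "Trg C w' = Src C f" "f' \<in> Mor C" "Src C f' = Src C w'" "Trg C f' = Src C w"
    "invertible \<alpha>" "Dom C \<alpha> = f \<cdot> w'" "Cod C \<alpha> = w \<cdot> f'"
proof -
  have "BF3 C W" using BF unfolding BF_def by blast
  moreover have "\<guillemotleft>w : Src C w \<rightarrow> Trg C w\<guillemotright>" "\<guillemotleft>f : Src C f \<rightarrow> Trg C w\<guillemotright>" using assms W_Mor hom1_iff by blast+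
  ultimately have "\<exists>D w' f' \<alpha>. \<guillemotleft>w' : D \<rightarrow> Src C f\<guillemotright> \<and> w' \<in> W \<and> \<guillemotleft>f' : D \<rightarrow> Src C w\<guillemotright> \<and> \<guillemotleft>\<alpha> : f \<cdot> w' \<cong> w \<cdot> f'\<guillemotright>"
    using assms(1) unfolding BF3_def by blast
  then show ?thesis using that unfolding hom1_iff iso2_iff by blast
qed

section \<open>Lifting cells along elements of W: existence and uniqueness\<close>

lemma BF4_inputI:
  assumes "w \<in> W" "f1 \<in> Mor C" "f2 \<in> Mor C" "Trg C f1 = Src C w" "Trg C f2 = Src C w" "Src C f2 = Src C f1"
    "\<alpha> \<in> Cell C" "Dom C \<alpha> = w \<cdot> f1" "Cod C \<alpha> = w \<cdot> f2"
  shows "BF4_input C W w f1 f2 \<alpha>"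
  using assms W_Mor unfolding BF4_input_def hom1_iff hom2_iff by blast

text \<open>Conjugating a (BF4) solution with the canonical rebracketings absorbs the two
  associators of its defining equation, which becomes
  \<open>rw \<dots> \<alpha> v = w \<rhd> \<beta>'\<close>. Since \<open>\<alpha>\<close> is
  invertible, (BF4b) makes the solution invertible.\<close>

lemma BF4_triple_rw:
  assumes T: "BF4_triple C W w (act xs k) (act ys t) \<alpha> D v \<beta>"
    and "w \<in> W" "k \<in> Mor C" "t \<in> Mor C" "Src C t = Src C k" "Src C w = tgt xs (Trg C k)"
    and \<alpha>: "iso_between (w # xs) k (w # ys) t \<alpha>"
  defines "\<beta>' \<equiv> reassoc ys t v \<bullet> \<beta> \<bullet> (reassoc xs k v)\<^sup>-"
  shows "v \<in> W" "v \<in> Mor C" "Src C v = D" "Trg C v = Src C k" "iso_between xs (k \<cdot> v) ys (t \<cdot> v) \<beta>'"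
    "rw (w # xs) k (w # ys) t \<alpha> v = w \<rhd> \<beta>'"
proof -
  have w [simp]: "w \<in> Mor C" using assms W_Mor by blast
  note [simp] = assms(3-6) iso_betweenD(3-)[OF \<alpha>]
  have p [simp]: "path xs (Trg C k)" "path ys (Trg C t)" "tgt ys (Trg C t) = tgt xs (Trg C k)"
    using iso_betweenD[OF \<alpha>] assms(6) by auto
  show v [simp]: "v \<in> W" "v \<in> Mor C" "Src C v = D" "Trg C v = Src C k"
    using T unfolding BF4_triple_def hom1_iff by auto
  have \<beta>0 [simp]: "Dom C \<beta> = act xs k \<cdot> v" "Cod C \<beta> = act ys t \<cdot> v"
    using T unfolding BF4_triple_def hom2_iff by auto
  have eq: "(\<alpha> \<lhd> v) \<bullet> \<a>[w, act xs k, v] = \<a>[w, act ys t, v] \<bullet> (w \<rhd> \<beta>)"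
    using T unfolding BF4_triple_def by auto
  have "BF4b C W" using BF unfolding BF_def by blast
  moreover have "BF4_input C W w (act xs k) (act ys t) \<alpha>"
    by (rule BF4_inputI) (use assms(2) in simp_all)
  moreover have "\<guillemotleft>\<alpha> : w \<cdot> act xs k \<cong> w \<cdot> act ys t\<guillemotright>" by (simp add: iso2_iff)
  ultimately have "\<guillemotleft>\<beta> : act xs k \<cdot> v \<cong> act ys t \<cdot> v\<guillemotright>" using T unfolding BF4b_def by blast
  then have [simp]: "invertible \<beta>" by (simp add: iso2_iff)
  show "iso_between xs (k \<cdot> v) ys (t \<cdot> v) \<beta>'"
    unfolding iso_between_def \<beta>'_def by simp
  have "rw (w # xs) k (w # ys) t \<alpha> v = (w \<rhd> reassoc ys t v) \<bullet> \<a>[w, act ys t, v]\<^sup>- \<bullet>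
      ((\<alpha> \<lhd> v) \<bullet> \<a>[w, act xs k, v]) \<bullet> (w \<rhd> (reassoc xs k v)\<^sup>-)"
    by (simp add: rw_def)
  also have "\<dots> = w \<rhd> \<beta>'" unfolding eq \<beta>'_def by (simp add: whisker_VComp)
  finally show "rw (w # xs) k (w # ys) t \<alpha> v = w \<rhd> \<beta>'" .
qed

lemma W_lift:
  assumes "w \<in> W" "k \<in> Mor C" "t \<in> Mor C" "Src C t = Src C k" "Src C w = tgt xs (Trg C k)"
    and \<alpha>: "iso_between (w # xs) k (w # ys) t \<alpha>"
  obtains v \<beta> where "v \<in> W" "v \<in> Mor C" "Trg C v = Src C k" "iso_between xs (k \<cdot> v) ys (t \<cdot> v) \<beta>"
    "rw (w # xs) k (w # ys) t \<alpha> v = w \<rhd> \<beta>"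
proof -
  have "BF4_input C W w (act xs k) (act ys t) \<alpha>"
    by (rule BF4_inputI) (use iso_betweenD[OF \<alpha>] assms(1-5) W_Mor in simp_all)
  moreover have "BF4a C W" using BF unfolding BF_def by blast
  ultimately obtain D v \<beta> where "BF4_triple C W w (act xs k) (act ys t) \<alpha> D v \<beta>"
    unfolding BF4a_def by blast
  then show ?thesis using BF4_triple_rw(1,2,4,5,6)[OF _ assms] that by blast
qed

lemma W_faithful:
  assumes w: "w \<in> W" and \<beta>: "invertible \<beta>" "invertible \<beta>'" "Dom C \<beta>' = Dom C \<beta>" "Cod C \<beta>' = Cod C \<beta>"
    and t: "Src C w = Trg C (Dom C \<beta>)" and eq: "w \<rhd> \<beta> = w \<rhd> \<beta>'"
  obtains x where "x \<in> W" "x \<in> Mor C" "Trg C x = Src C (Dom C \<beta>)" "\<beta> \<lhd> x = \<beta>' \<lhd> x"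
proof -
  \<comment> \<open>Both \<open>(v, \<beta> \<lhd> v)\<close> and \<open>(v, \<beta>' \<lhd> v)\<close> solve the lifting problem for \<open>w \<rhd> \<beta>\<close>, for any \<open>v\<close> in \<open>W\<close>.\<close>
  define v where "v = Id1 C (Src C (Dom C \<beta>))"
  have Obj: "Src C (Dom C \<beta>) \<in> Obj C" by (rule Src_in) (use \<beta> in simp)
  have v [simp]: "v \<in> Mor C" "Src C v = Src C (Dom C \<beta>)" "Trg C v = Src C (Dom C \<beta>)"
    using Id1_in[OF Obj] by (simp_all add: v_def hom1_iff)
  have vW: "v \<in> W" unfolding v_def by (rule W_Id1[OF Obj])
  note [simp] = \<beta> t W_Mor[OF w]
  have triple: "BF4_triple C W w (Dom C \<beta>) (Cod C \<beta>) (w \<rhd> \<gamma>) (Src C v) v (\<gamma> \<lhd> v)"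
    if "invertible \<gamma>" "Dom C \<gamma> = Dom C \<beta>" "Cod C \<gamma> = Cod C \<beta>" for \<gamma>
    using that vW Assoc_natural'[of "Id2 C v" \<gamma> "Id2 C w"]
    unfolding BF4_triple_def hom1_iff hom2_iff by simp
  have "BF4c C W" using BF unfolding BF_def by blast
  moreover have "BF4_input C W w (Dom C \<beta>) (Cod C \<beta>) (w \<rhd> \<beta>)"
    by (rule BF4_inputI) (use w in simp_all)
  moreover note triple[of \<beta>, OF \<beta>(1) refl refl] triple[of \<beta>', OF \<beta>(2-4), folded eq]
  ultimately have "\<exists>E u u' \<zeta>. \<guillemotleft>u : E \<rightarrow> Src C v\<guillemotright> \<and> \<guillemotleft>u' : E \<rightarrow> Src C v\<guillemotright> \<and> \<guillemotleft>\<zeta> : v \<cdot> u \<cong> v \<cdot> u'\<guillemotright> \<and> v \<cdot> u \<in> W \<and>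
        \<a>[Cod C \<beta>, v, u']\<^sup>- \<bullet> ((\<beta>' \<lhd> v) \<lhd> u') \<bullet> \<a>[Dom C \<beta>, v, u'] \<bullet> (Dom C \<beta> \<rhd> \<zeta>) =
        (Cod C \<beta> \<rhd> \<zeta>) \<bullet> \<a>[Cod C \<beta>, v, u]\<^sup>- \<bullet> ((\<beta> \<lhd> v) \<lhd> u) \<bullet> \<a>[Dom C \<beta>, v, u]"
    unfolding BF4c_def by blast
  then obtain u u' \<zeta> where u: "u \<in> Mor C" "Trg C u = Src C v" "u' \<in> Mor C" "Trg C u' = Src C v"
    and \<zeta>: "invertible \<zeta>" "Dom C \<zeta> = v \<cdot> u" "Cod C \<zeta> = v \<cdot> u'" and vu: "v \<cdot> u \<in> W"
    and e: "\<a>[Cod C \<beta>, v, u']\<^sup>- \<bullet> ((\<beta>' \<lhd> v) \<lhd> u') \<bullet> \<a>[Dom C \<beta>, v, u'] \<bullet> (Dom C \<beta> \<rhd> \<zeta>) =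
        (Cod C \<beta> \<rhd> \<zeta>) \<bullet> \<a>[Cod C \<beta>, v, u]\<^sup>- \<bullet> ((\<beta> \<lhd> v) \<lhd> u) \<bullet> \<a>[Dom C \<beta>, v, u]"
    unfolding hom1_iff iso2_iff by blast
  note [simp] = u \<zeta>
  \<comment> \<open>Naturality of the associator in its first argument merges two successive
    whiskerings, which clears the equation of (BF4c) of associators.\<close>
  have nat: "\<a>[Cod C \<beta>, v, y]\<^sup>- \<bullet> ((\<gamma> \<lhd> v) \<lhd> y) \<bullet> \<a>[Dom C \<beta>, v, y] = \<gamma> \<lhd> (v \<cdot> y)"
    if "invertible \<gamma>" "Dom C \<gamma> = Dom C \<beta>" "Cod C \<gamma> = Cod C \<beta>" "y \<in> Mor C" "Trg C y = Src C v" for \<gamma> y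
  proof -
    have "\<a>[Cod C \<beta>, v, y] \<bullet> (\<gamma> \<lhd> (v \<cdot> y)) = ((\<gamma> \<lhd> v) \<lhd> y) \<bullet> \<a>[Dom C \<beta>, v, y]"
      using that Assoc_natural'[of "Id2 C y" "Id2 C v" \<gamma>] by simp
    from arg_cong[OF this, of "\<lambda>x. \<a>[Cod C \<beta>, v, y]\<^sup>- \<bullet> x", symmetric] show ?thesis
      by (rule trans) (use that in simp)
  qed
  have "(\<beta>' \<lhd> (v \<cdot> u')) \<bullet> (Dom C \<beta> \<rhd> \<zeta>) =
      (\<a>[Cod C \<beta>, v, u']\<^sup>- \<bullet> ((\<beta>' \<lhd> v) \<lhd> u') \<bullet> \<a>[Dom C \<beta>, v, u']) \<bullet> (Dom C \<beta> \<rhd> \<zeta>)"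
    by (subst nat) simp_all
  also have "\<dots> = (Cod C \<beta> \<rhd> \<zeta>) \<bullet> \<a>[Cod C \<beta>, v, u]\<^sup>- \<bullet> ((\<beta> \<lhd> v) \<lhd> u) \<bullet> \<a>[Dom C \<beta>, v, u]"
    unfolding e[symmetric] by simp
  also have "\<dots> = (Cod C \<beta> \<rhd> \<zeta>) \<bullet> (\<beta> \<lhd> (v \<cdot> u))" by (subst nat) simp_all
  finally have "(\<beta>' \<lhd> (v \<cdot> u')) \<bullet> (Dom C \<beta> \<rhd> \<zeta>) = (Cod C \<beta> \<rhd> \<zeta>) \<bullet> (\<beta> \<lhd> (v \<cdot> u))" .
  \<comment> \<open>The exchange law for \<open>\<zeta>\<close> and \<open>\<beta>'\<close> moves
    the whiskering of \<open>\<beta>'\<close> from \<open>v \<cdot> u'\<close> to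
    \<open>v \<cdot> u\<close>. Cancelling the invertible
    \<open>Cod C \<beta> \<rhd> \<zeta>\<close> then leaves \<open>v \<cdot> u\<close> as the
    required element of \<open>W\<close>.\<close>
  moreover have "(\<beta>' \<lhd> (v \<cdot> u')) \<bullet> (Dom C \<beta> \<rhd> \<zeta>) = (Cod C \<beta> \<rhd> \<zeta>) \<bullet> (\<beta>' \<lhd> (v \<cdot> u))"
    using whisker_exchange[of \<zeta> \<beta>'] by simp
  ultimately have "(Cod C \<beta> \<rhd> \<zeta>) \<bullet> (\<beta> \<lhd> (v \<cdot> u)) = (Cod C \<beta> \<rhd> \<zeta>) \<bullet> (\<beta>' \<lhd> (v \<cdot> u))"
    by (rule trans[OF sym])
  then have "\<beta> \<lhd> (v \<cdot> u) = \<beta>' \<lhd> (v \<cdot> u)"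
    by (rule invertible_cancel_left) simp_all
  then show ?thesis using that[of "v \<cdot> u"] vu by simp
qed

text \<open>Compatibility of the whiskered cells says that \<open>e \<rhd> _\<close> identifies the
  two members of the desired equation, so \<open>W_faithful\<close> makes them agree after
  whiskering with some \<open>x\<close> in \<open>W\<close>. The comparison absorbs
  \<open>x\<close>.\<close>

lemma compatible_faithful:
  assumes cmp: "comparison k t k' t' z z' \<sigma> \<tau>" and \<alpha>: "iso_between xs k ys t \<alpha>" and \<alpha>': "iso_between xs k' ys t' \<alpha>'"
    and e: "e \<in> W" "Src C e = tgt xs (Trg C k)"
    and c: "compatible (e # xs) (e # ys) k t k' t' z z' \<sigma> \<tau> (e \<rhd> \<alpha>) (e \<rhd> \<alpha>')"
  obtains x where "x \<in> W" "x \<in> Mor C" "Trg C x = Src C z"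
    "compatible xs ys k t k' t' (z \<cdot> x) (z' \<cdot> x) (rw [k'] z' [k] z \<sigma> x) (rw [t] z [t'] z' \<tau> x) \<alpha> \<alpha>'"
proof -
  note [simp] = comparisonD[OF cmp] W_Mor[OF e(1)] e(2) iso_betweenD[OF \<alpha>] iso_betweenD(3-)[OF \<alpha>'] iso_between_tgt[OF \<alpha>]
  have eq: "e \<rhd> (lw ys \<tau> \<bullet> rw xs k ys t \<alpha> z \<bullet> lw xs \<sigma>) = e \<rhd> rw xs k' ys t' \<alpha>' z'"
    using c unfolding compatible_def by (simp add: rw_lwhisk whisker_VComp)
  obtain x where x: "x \<in> W" "x \<in> Mor C" "Trg C x = Src C (Dom C (lw ys \<tau> \<bullet> rw xs k ys t \<alpha> z \<bullet> lw xs \<sigma>))"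
    "(lw ys \<tau> \<bullet> rw xs k ys t \<alpha> z \<bullet> lw xs \<sigma>) \<lhd> x = rw xs k' ys t' \<alpha>' z' \<lhd> x"
    by (rule W_faithful[OF e(1) _ _ _ _ _ eq]) simp_all
  have t: "Trg C x = Src C z" using x(3) by simp
  \<comment> \<open>The two rebracketings that make up \<open>rw\<close> do not depend on the cell,
    so equality after whiskering with \<open>x\<close> suffices.\<close>
  have "rw (xs @ [k']) z' (ys @ [t']) z' (lw ys \<tau> \<bullet> rw xs k ys t \<alpha> z \<bullet> lw xs \<sigma>) x =
    rw (xs @ [k']) z' (ys @ [t']) z' (rw xs k' ys t' \<alpha>' z') x"
    unfolding rw_def[of "xs @ [k']"] x(4) ..
  then show ?thesis
    using that[OF x(1,2) t] compatible_precomp_iff[OF cmp \<alpha> \<alpha>' x(2) t] by blast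
qed

lemma W_act_precomp:
  assumes "act xs k \<in> W" "x \<in> W" "path xs (Trg C k)" "k \<in> Mor C" "Trg C x = Src C k"
  shows "act xs (k \<cdot> x) \<in> W"
proof -
  have "act xs k \<cdot> x \<in> W" by (rule W_Comp) (use assms in simp_all)
  then show ?thesis
    by (rule W_iso'[of _ "reassoc xs k x"]) (use assms W_Mor in simp_all)
qed

text \<open>Neither \<open>k\<close> nor \<open>k'\<close> is assumed to lie in \<open>W\<close>,
  only their composites with \<open>m\<close>, which is in \<open>W\<close> itself. In the
  application \<open>m\<close> is \<open>(u \<cdot> u1) \<cdot> u2\<close>.\<close>

lemma comparison_exists:
  assumes \<gamma>: "iso_between xs k [e] t \<gamma>" and \<gamma>': "iso_between xs k' [e] t' \<gamma>'"
    and m: "m \<in> W" "m \<cdot> k \<in> W" "m \<cdot> k' \<in> W" "Src C m = Trg C k" and e: "e \<in> W"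
    and k: "k \<in> Mor C" "t \<in> Mor C" "k' \<in> Mor C" "t' \<in> Mor C" "Src C t = Src C k" "Src C t' = Src C k'"
      "Trg C k' = Trg C k" "Trg C t' = Trg C t"
  obtains z z' \<sigma> \<tau> where "comparison k t k' t' z z' \<sigma> \<tau>" "m \<cdot> k \<cdot> z \<in> W"
    "compatible xs [e] k t k' t' z z' \<sigma> \<tau> \<gamma> \<gamma>'"
proof -
  note [simp] = k W_Mor[OF m(1)] m(4) W_Mor[OF e] iso_betweenD[OF \<gamma>] iso_betweenD(3-)[OF \<gamma>']
  have te [simp]: "Trg C t = Src C e" "Trg C e = tgt xs (Trg C k)"
    using iso_betweenD(2)[OF \<gamma>] iso_between_tgt[OF \<gamma>] by simp_all
  obtain a b \<alpha> where a: "a \<in> W" "Trg C a = Src C (m \<cdot> k')"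
    and b: "b \<in> Mor C" "Src C b = Src C a" "Trg C b = Src C (m \<cdot> k)"
    and \<alpha>: "invertible \<alpha>" "Dom C \<alpha> = (m \<cdot> k') \<cdot> a" "Cod C \<alpha> = (m \<cdot> k) \<cdot> b"
    by (rule W_square[of "m \<cdot> k" "m \<cdot> k'"]) (use m in simp_all)
  note [simp] = W_Mor[OF a(1)] a(2)[simplified] b(1,2) b(3)[simplified] \<alpha>
  have lift1: "iso_between [m, k'] a [m, k] b (\<a>[m, k, b]\<^sup>- \<bullet> \<alpha> \<bullet> \<a>[m, k', a])"
    unfolding iso_between_def by simp
  obtain c \<sigma> where c: "c \<in> W" "c \<in> Mor C" "Trg C c = Src C a"
    and \<sigma>: "iso_between [k'] (a \<cdot> c) [k] (b \<cdot> c) \<sigma>"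
    by (rule W_lift[OF m(1) _ _ _ _ lift1]) simp_all
  note [simp] = c(2,3) iso_betweenD(3)[OF \<sigma>]
  define z where "z = b \<cdot> c"
  define z' where "z' = a \<cdot> c"
  have z [simp]: "z \<in> Mor C" "Trg C z = Src C k" "z' \<in> Mor C" "Trg C z' = Src C k'" "Src C z' = Src C z"
    "Dom C \<sigma> = k' \<cdot> z'" "Cod C \<sigma> = k \<cdot> z"
    by (simp_all add: z_def z'_def iso_betweenD(4,5)[OF \<sigma>])
  \<comment> \<open>Of the two morphisms only \<open>z'\<close> is a composite of elements of
    \<open>W\<close>. Membership is therefore shown for \<open>m \<cdot> k' \<cdot> z'\<close> and
    carried to \<open>m \<cdot> k \<cdot> z\<close> along \<open>m \<rhd> \<sigma>\<close>.\<close>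
  have z'W: "z' \<in> W" unfolding z'_def by (rule W_Comp) (use a c in simp_all)
  have "act [m, k'] z' \<in> W"
    using W_iso'[of "(m \<cdot> k') \<cdot> z'" "\<a>[m, k', z']\<^sup>-"] W_Comp[OF z'W m(3)] by simp
  then have mW: "m \<cdot> k \<cdot> z \<in> W"
    using W_iso'[of "m \<cdot> k' \<cdot> z'" "m \<rhd> \<sigma>"] by simp
  \<comment> \<open>The compatibility equation solved for the factor that \<open>\<tau>\<close> must
    supply; lifting \<open>\<kappa>\<close> along \<open>e\<close> yields \<open>\<tau>\<close> once
    \<open>x\<close> is precomposed.\<close>
  define \<kappa> where "\<kappa> = rw xs k' [e] t' \<gamma>' z' \<bullet> lw xs (\<sigma>\<^sup>-) \<bullet> (rw xs k [e] t \<gamma> z)\<^sup>-"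
  have lift2: "iso_between [e, t] z [e, t'] z' \<kappa>"
    unfolding iso_between_def \<kappa>_def by simp
  obtain x \<tau> where x: "x \<in> W" "x \<in> Mor C" "Trg C x = Src C z"
    and \<tau>: "iso_between [t] (z \<cdot> x) [t'] (z' \<cdot> x) \<tau>" "rw [e, t] z [e, t'] z' \<kappa> x = e \<rhd> \<tau>"
    by (rule W_lift[OF e _ _ _ _ lift2]) simp_all
  note [simp] = x(2,3) iso_betweenD(3-)[OF \<tau>(1)]
  have "comparison k t k' t' (z \<cdot> x) (z' \<cdot> x) (rw [k'] z' [k] z \<sigma> x) \<tau>"
    unfolding comparison_def by simp
  moreover have "m \<cdot> k \<cdot> z \<cdot> x \<in> W"
    using W_act_precomp[of "[m, k]" z x] mW x by simp
  moreover have "compatible xs [e] k t k' t' (z \<cdot> x) (z' \<cdot> x) (rw [k'] z' [k] z \<sigma> x) \<tau> \<gamma> \<gamma>'"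
  proof -
    have "lw [e] \<tau> \<bullet> rw xs k [e] t \<gamma> (z \<cdot> x) \<bullet> lw xs (rw [k'] z' [k] z \<sigma> x) =
        rw [e, t] z [e, t'] z' \<kappa> x \<bullet> rw (xs @ [k]) z ([e] @ [t]) z (rw xs k [e] t \<gamma> z) x \<bullet>
        rw (xs @ [k']) z' (xs @ [k]) z (lw xs \<sigma>) x"
      unfolding \<tau>(2) by (subst rw_rw[OF \<gamma>], simp_all add: rw_lw)
    also have "\<dots> = rw (xs @ [k']) z' [e, t'] z' (\<kappa> \<bullet> rw xs k [e] t \<gamma> z \<bullet> lw xs \<sigma>) x"
      by (subst rw_VComp3[of "xs @ [k']" z' "xs @ [k]" z "[e, t]" z "[e, t']" z' x]) (simp_all add: \<kappa>_def)
    also have "\<kappa> \<bullet> rw xs k [e] t \<gamma> z \<bullet> lw xs \<sigma> = rw xs k' [e] t' \<gamma>' z'"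
      unfolding \<kappa>_def by (simp flip: lw_VComp del: rw_invertible(2))
    also have "rw (xs @ [k']) z' [e, t'] z' (rw xs k' [e] t' \<gamma>' z') x = rw xs k' [e] t' \<gamma>' (z' \<cdot> x)"
      using rw_rw[OF \<gamma>', of z' x] by simp
    finally show ?thesis unfolding compatible_def .
  qed
  ultimately show ?thesis by (rule that)
qed

lemma C_choicesD:
  assumes "C_choices C W cW" "cW f v = (A, v', f', \<rho>)" "f \<in> Mor C" "v \<in> W" "Trg C f = Trg C v"
  shows "v' \<in> W" "Src C v' = A" "Trg C v' = Src C f" "f' \<in> Mor C" "Src C f' = A" "Trg C f' = Src C v"
    "invertible \<rho>" "Dom C \<rho> = f \<cdot> v'" "Cod C \<rho> = v \<cdot> f'"
proof -
  have "\<guillemotleft>f : Src C f \<rightarrow> Trg C v\<guillemotright>" "\<guillemotleft>v : Src C v \<rightarrow> Trg C v\<guillemotright>" using assms W_Mor hom1_iff by blast+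
  then have "\<guillemotleft>v' : A \<rightarrow> Src C f\<guillemotright> \<and> v' \<in> W \<and> \<guillemotleft>f' : A \<rightarrow> Src C v\<guillemotright> \<and> \<guillemotleft>\<rho> : f \<cdot> v' \<cong> v \<cdot> f'\<guillemotright>"
    using assms(1)[unfolded C_choices_def, rule_format, of f "Src C f" "Trg C v" v "Src C v"] assms(2,4) by simp
  then show "v' \<in> W" "Src C v' = A" "Trg C v' = Src C f" "f' \<in> Mor C" "Src C f' = A" "Trg C f' = Src C v"
    "invertible \<rho>" "Dom C \<rho> = f \<cdot> v'" "Cod C \<rho> = v \<cdot> f'"
    unfolding hom1_iff iso2_iff by blast+
qed

lemma D_choicesD:
  assumes "D_choices C W dW" "dW w f1 f2 \<alpha> = (D, v, \<beta>)" "BF4_input C W w f1 f2 \<alpha>"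
  shows "BF4_triple C W w f1 f2 \<alpha> D v \<beta>"
  using assms(1)[unfolded D_choices_def, rule_format, OF assms(3)] assms(2) by simp

end

section \<open>The associator data\<close>

text \<open>The objects are eliminated: \<open>A1\<close>, \<open>A2\<close>, \<open>B2\<close>,
  \<open>A3\<close> become the sources of \<open>u1\<close>, \<open>u2\<close>, \<open>v1\<close>,
  \<open>u3\<close>. Every typing equation is oriented towards the source or target of an element of
  \<open>W\<close>, so the simplifier decides composability.\<close>

locale associator_setup = fractions C W for C :: "('o, 'm, 'c) bicat" (structure) and W :: "'m set" +
  fixes u f v g w h u1 f1 \<delta> u2 l \<sigma> v1 g1 \<xi> u3 f2 \<eta>
  assumes in_W [simp]: "u \<in> W" "v \<in> W" "w \<in> W" "u1 \<in> W" "u2 \<in> W" "v1 \<in> W" "u3 \<in> W"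
    and in_Mor [simp]: "f \<in> Mor C" "g \<in> Mor C" "h \<in> Mor C" "f1 \<in> Mor C" "l \<in> Mor C" "g1 \<in> Mor C" "f2 \<in> Mor C"
    and Src_eq [simp]: "Src C f = Src C u" "Src C g = Src C v" "Src C h = Src C w"
      "Src C f1 = Src C u1" "Src C l = Src C u2" "Src C g1 = Src C v1" "Src C f2 = Src C u3"
    and Trg_eq [simp]: "Trg C f = Trg C v" "Trg C g = Trg C w" "Trg C u1 = Src C u" "Trg C f1 = Src C v"
      "Trg C u2 = Src C u1" "Trg C l = Src C w" "Trg C v1 = Src C v" "Trg C g1 = Src C w"
      "Trg C u3 = Src C u" "Trg C f2 = Src C v1"
    and squares [simp]: "invertible \<delta>" "Dom C \<delta> = f \<cdot> u1" "Cod C \<delta> = v \<cdot> f1"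
      "invertible \<sigma>" "Dom C \<sigma> = (g \<cdot> f1) \<cdot> u2" "Cod C \<sigma> = w \<cdot> l"
      "invertible \<xi>" "Dom C \<xi> = g \<cdot> v1" "Cod C \<xi> = w \<cdot> g1"
      "invertible \<eta>" "Dom C \<eta> = f \<cdot> u3" "Cod C \<eta> = (v \<cdot> v1) \<cdot> f2"
begin

lemma W_in_Mor [simp]: "u \<in> Mor C" "v \<in> Mor C" "w \<in> Mor C" "u1 \<in> Mor C" "u2 \<in> Mor C" "v1 \<in> Mor C" "u3 \<in> Mor C"
  by (rule W_Mor, simp)+

definition legs :: "'m \<Rightarrow> 'm \<Rightarrow> bool" where
  "legs u4 u5 \<longleftrightarrow> u4 \<in> Mor C \<and> u5 \<in> Mor C \<and> Trg C u4 = Src C u2 \<and> Trg C u5 = Src C u3 \<and> Src C u5 = Src C u4"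

lemma legsD:
  assumes "legs u4 u5"
  shows "u4 \<in> Mor C" "u5 \<in> Mor C" "Trg C u4 = Src C u2" "Trg C u5 = Src C u3" "Src C u5 = Src C u4"
  using assms unfolding legs_def by blast+

lemma legs_precomp: "legs u4 u5 \<Longrightarrow> x \<in> Mor C \<Longrightarrow> Trg C x = Src C u4 \<Longrightarrow> legs (u4 \<cdot> x) (u5 \<cdot> x)"
  unfolding legs_def by simp

abbreviation F1' where "F1' \<equiv> F1 C W (Src C u2) (Src C u3) u u1 u2 u3"
abbreviation F2' where "F2' \<equiv> F2 C f v u1 f1 \<delta> u2 v1 u3 f2 \<eta>"
abbreviation F3' where "F3' \<equiv> F3 C g w f1 u2 l \<sigma> v1 g1 \<xi> f2"

section \<open>Conditions (F1)-(F3) in right-bracketed form, and their pastings\<close>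

lemma F1_iff: "F1' A4 u4 u5 \<gamma> \<longleftrightarrow>
    legs u4 u5 \<and> Src C u4 = A4 \<and> act [u, u1, u2] u4 \<in> W \<and> iso_between [u1, u2] u4 [u3] u5 \<gamma>"
  unfolding F1_def legs_def hom1_iff iso2_iff iso_between_def by auto

lemma F2_iff:
  assumes "legs u4 u5"
  shows "F2' u4 u5 \<gamma> \<omega> \<longleftrightarrow> iso_between [f1, u2] u4 [v1, f2] u5 \<omega> \<and>
     v \<rhd> \<omega> = F2_paste C f v u1 f1 \<delta> u2 v1 u3 f2 \<eta> u4 u5 \<gamma>"
  using legsD[OF assms] unfolding F2_def iso2_iff iso_between_def by auto

lemma F3_iff:
  assumes "legs u4 u5"
  shows "F3' u4 u5 \<omega> \<rho> \<longleftrightarrow> iso_between [l] u4 [g1, f2] u5 \<rho> \<and>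
     w \<rhd> \<rho> = F3_paste C g w f1 u2 l \<sigma> v1 g1 \<xi> f2 u4 u5 \<omega>"
  using legsD[OF assms] unfolding F3_def iso2_iff iso_between_def by auto

text \<open>\<open>F2_paste\<close> splits at \<open>f \<rhd> \<gamma>\<close>: the part applied
  before it involves only \<open>u4\<close>, the part applied after it only \<open>u5\<close>, in
  each case as the trailing factor. These parts are families, here in \<open>u4\<close> and in
  \<open>family_F2_right\<close> in \<open>u5\<close>; the \<open>family_F3\<close> lemmas do the
  same around \<open>g \<rhd> \<omega>\<close>.\<close>

lemma family_F2_left:
  "family (Src C u2) [v, f1, u2] [f, u1, u2]
     (\<lambda>k. \<a>[f, u1, u2 \<cdot> k]\<^sup>- \<bullet> (\<delta>\<^sup>- \<lhd> (u2 \<cdot> k)) \<bullet> \<a>[v, f1, u2 \<cdot> k])"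
proof -
  have 1: "family (Src C u1) [v, f1] [v \<cdot> f1] (\<lambda>k. \<a>[v, f1, k])" by (rule family_Assoc) simp_all
  have 2: "family (Src C u1) [v \<cdot> f1] [f \<cdot> u1] (\<lambda>k. \<delta>\<^sup>- \<lhd> k)" by (rule family_rwhisk) simp_all
  have 3: "family (Src C u1) [f \<cdot> u1] [f, u1] (\<lambda>k. \<a>[f, u1, k]\<^sup>-)"
    by (rule family_inv, rule family_Assoc) simp_all
  have "family (Src C u1) [v, f1] [f, u1] (\<lambda>k. \<a>[f, u1, k]\<^sup>- \<bullet> (\<delta>\<^sup>- \<lhd> k) \<bullet> \<a>[v, f1, k])"
    by (intro family_VComp[OF _ 3] family_VComp[OF 1 2])
  from family_shift[OF this, of "[u2]" "Src C u2"] show ?thesis by simp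
qed

lemma family_F2_right:
  "family (Src C u3) [f, u3] [v, v1, f2]
     (\<lambda>k. \<a>[v, v1, f2 \<cdot> k]\<^sup>- \<bullet> \<a>[v \<cdot> v1, f2, k]\<^sup>- \<bullet> (\<eta> \<lhd> k) \<bullet> \<a>[f, u3, k])"
proof -
  have 1: "family (Src C u3) [f, u3] [f \<cdot> u3] (\<lambda>k. \<a>[f, u3, k])" by (rule family_Assoc) simp_all
  have 2: "family (Src C u3) [f \<cdot> u3] [(v \<cdot> v1) \<cdot> f2] (\<lambda>k. \<eta> \<lhd> k)" by (rule family_rwhisk) simp_all
  have 3: "family (Src C u3) [(v \<cdot> v1) \<cdot> f2] [v \<cdot> v1, f2] (\<lambda>k. \<a>[v \<cdot> v1, f2, k]\<^sup>-)"
    by (rule family_inv, rule family_Assoc) simp_all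
  have "family (Src C v1) [v \<cdot> v1] [v, v1] (\<lambda>k. \<a>[v, v1, k]\<^sup>-)"
    by (rule family_inv, rule family_Assoc) simp_all
  from family_shift[OF this, of "[f2]" "Src C u3"]
  have 4: "family (Src C u3) [v \<cdot> v1, f2] [v, v1, f2] (\<lambda>k. \<a>[v, v1, f2 \<cdot> k]\<^sup>-)" by simp
  show ?thesis by (intro family_VComp[OF _ 4] family_VComp[OF _ 3] family_VComp[OF 1 2])
qed

lemma F2_paste_eq:
  assumes "legs u4 u5" "iso_between [u1, u2] u4 [u3] u5 \<gamma>"
  shows "F2_paste C f v u1 f1 \<delta> u2 v1 u3 f2 \<eta> u4 u5 \<gamma> =
     (\<a>[v, v1, f2 \<cdot> u5]\<^sup>- \<bullet> \<a>[v \<cdot> v1, f2, u5]\<^sup>- \<bullet> (\<eta> \<lhd> u5) \<bullet> \<a>[f, u3, u5]) \<bullet> (f \<rhd> \<gamma>) \<bullet>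
     (\<a>[f, u1, u2 \<cdot> u4]\<^sup>- \<bullet> (\<delta>\<^sup>- \<lhd> (u2 \<cdot> u4)) \<bullet> \<a>[v, f1, u2 \<cdot> u4])"
proof -
  note [simp] = legsD[OF assms(1)] iso_betweenD(3-)[OF assms(2)]
  show ?thesis unfolding F2_paste_def by simp
qed

lemma F2_paste_iso:
  assumes "legs u4 u5" "iso_between [u1, u2] u4 [u3] u5 \<gamma>"
  shows "iso_between [v, f1, u2] u4 [v, v1, f2] u5 (F2_paste C f v u1 f1 \<delta> u2 v1 u3 f2 \<eta> u4 u5 \<gamma>)"
proof -
  note [simp] = legsD[OF assms(1)] iso_betweenD(3-)[OF assms(2)]
  show ?thesis unfolding F2_paste_def iso_between_def by simp
qed

text \<open>\<open>rw_paste\<close> with \<open>e = f\<close>: pasting commutes with precomposition,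
  so the equation of (F2) survives it.\<close>

lemma F2_paste_precomp:
  assumes "legs u4 u5" "iso_between [u1, u2] u4 [u3] u5 \<gamma>" "x \<in> Mor C" "Trg C x = Src C u4"
  shows "F2_paste C f v u1 f1 \<delta> u2 v1 u3 f2 \<eta> (u4 \<cdot> x) (u5 \<cdot> x) (rw [u1, u2] u4 [u3] u5 \<gamma> x) =
    rw [v, f1, u2] u4 [v, v1, f2] u5 (F2_paste C f v u1 f1 \<delta> u2 v1 u3 f2 \<eta> u4 u5 \<gamma>) x"
proof -
  note [simp] = legsD[OF assms(1)] assms(3,4) iso_betweenD(3-)[OF assms(2)]
  have i: "iso_between [u1, u2] (u4 \<cdot> x) [u3] (u5 \<cdot> x) (rw [u1, u2] u4 [u3] u5 \<gamma> x)"
    unfolding iso_between_def by simp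
  show ?thesis
    unfolding F2_paste_eq[OF assms(1,2)] F2_paste_eq[OF legs_precomp[OF assms(1,3,4)] i]
    by (rule sym, rule rw_paste[where Y = "\<lambda>k. \<a>[f, u1, u2 \<cdot> k]\<^sup>- \<bullet> (\<delta>\<^sup>- \<lhd> (u2 \<cdot> k)) \<bullet> \<a>[v, f1, u2 \<cdot> k]"
          and Z = "\<lambda>k. \<a>[v, v1, f2 \<cdot> k]\<^sup>- \<bullet> \<a>[v \<cdot> v1, f2, k]\<^sup>- \<bullet> (\<eta> \<lhd> k) \<bullet> \<a>[f, u3, k]"])
      (use family_F2_left family_F2_right assms(2) in simp_all)
qed

lemma family_F3_left:
  "family (Src C u2) [w, l] [g, f1, u2]
     (\<lambda>k. \<a>[g, f1, u2 \<cdot> k]\<^sup>- \<bullet> \<a>[g \<cdot> f1, u2, k]\<^sup>- \<bullet> (\<sigma>\<^sup>- \<lhd> k) \<bullet> \<a>[w, l, k])"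
proof -
  have 1: "family (Src C u2) [w, l] [w \<cdot> l] (\<lambda>k. \<a>[w, l, k])" by (rule family_Assoc) simp_all
  have 2: "family (Src C u2) [w \<cdot> l] [(g \<cdot> f1) \<cdot> u2] (\<lambda>k. \<sigma>\<^sup>- \<lhd> k)" by (rule family_rwhisk) simp_all
  have 3: "family (Src C u2) [(g \<cdot> f1) \<cdot> u2] [g \<cdot> f1, u2] (\<lambda>k. \<a>[g \<cdot> f1, u2, k]\<^sup>-)"
    by (rule family_inv, rule family_Assoc) simp_all
  have "family (Src C u1) [g \<cdot> f1] [g, f1] (\<lambda>k. \<a>[g, f1, k]\<^sup>-)"
    by (rule family_inv, rule family_Assoc) simp_all
  from family_shift[OF this, of "[u2]" "Src C u2"]
  have 4: "family (Src C u2) [g \<cdot> f1, u2] [g, f1, u2] (\<lambda>k. \<a>[g, f1, u2 \<cdot> k]\<^sup>-)" by simp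
  show ?thesis by (intro family_VComp[OF _ 4] family_VComp[OF _ 3] family_VComp[OF 1 2])
qed

lemma family_F3_right:
  "family (Src C u3) [g, v1, f2] [w, g1, f2]
     (\<lambda>k. \<a>[w, g1, f2 \<cdot> k]\<^sup>- \<bullet> (\<xi> \<lhd> (f2 \<cdot> k)) \<bullet> \<a>[g, v1, f2 \<cdot> k])"
proof -
  have 1: "family (Src C v1) [g, v1] [g \<cdot> v1] (\<lambda>k. \<a>[g, v1, k])" by (rule family_Assoc) simp_all
  have 2: "family (Src C v1) [g \<cdot> v1] [w \<cdot> g1] (\<lambda>k. \<xi> \<lhd> k)" by (rule family_rwhisk) simp_all
  have 3: "family (Src C v1) [w \<cdot> g1] [w, g1] (\<lambda>k. \<a>[w, g1, k]\<^sup>-)"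
    by (rule family_inv, rule family_Assoc) simp_all
  have "family (Src C v1) [g, v1] [w, g1] (\<lambda>k. \<a>[w, g1, k]\<^sup>- \<bullet> (\<xi> \<lhd> k) \<bullet> \<a>[g, v1, k])"
    by (intro family_VComp[OF _ 3] family_VComp[OF 1 2])
  from family_shift[OF this, of "[f2]" "Src C u3"] show ?thesis by simp
qed

lemma F3_paste_eq:
  assumes "legs u4 u5" "iso_between [f1, u2] u4 [v1, f2] u5 \<omega>"
  shows "F3_paste C g w f1 u2 l \<sigma> v1 g1 \<xi> f2 u4 u5 \<omega> =
     (\<a>[w, g1, f2 \<cdot> u5]\<^sup>- \<bullet> (\<xi> \<lhd> (f2 \<cdot> u5)) \<bullet> \<a>[g, v1, f2 \<cdot> u5]) \<bullet> (g \<rhd> \<omega>) \<bullet>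
     (\<a>[g, f1, u2 \<cdot> u4]\<^sup>- \<bullet> \<a>[g \<cdot> f1, u2, u4]\<^sup>- \<bullet> (\<sigma>\<^sup>- \<lhd> u4) \<bullet> \<a>[w, l, u4])"
proof -
  note [simp] = legsD[OF assms(1)] iso_betweenD(3-)[OF assms(2)]
  show ?thesis unfolding F3_paste_def by simp
qed

lemma F3_paste_iso:
  assumes "legs u4 u5" "iso_between [f1, u2] u4 [v1, f2] u5 \<omega>"
  shows "iso_between [w, l] u4 [w, g1, f2] u5 (F3_paste C g w f1 u2 l \<sigma> v1 g1 \<xi> f2 u4 u5 \<omega>)"
proof -
  note [simp] = legsD[OF assms(1)] iso_betweenD(3-)[OF assms(2)]
  show ?thesis unfolding F3_paste_def iso_between_def by simp
qed

lemma F3_paste_precomp: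
  assumes "legs u4 u5" "iso_between [f1, u2] u4 [v1, f2] u5 \<omega>" "x \<in> Mor C" "Trg C x = Src C u4"
  shows "F3_paste C g w f1 u2 l \<sigma> v1 g1 \<xi> f2 (u4 \<cdot> x) (u5 \<cdot> x) (rw [f1, u2] u4 [v1, f2] u5 \<omega> x) =
    rw [w, l] u4 [w, g1, f2] u5 (F3_paste C g w f1 u2 l \<sigma> v1 g1 \<xi> f2 u4 u5 \<omega>) x"
proof -
  note [simp] = legsD[OF assms(1)] assms(3,4) iso_betweenD(3-)[OF assms(2)]
  have i: "iso_between [f1, u2] (u4 \<cdot> x) [v1, f2] (u5 \<cdot> x) (rw [f1, u2] u4 [v1, f2] u5 \<omega> x)"
    unfolding iso_between_def by simp
  show ?thesis
    unfolding F3_paste_eq[OF assms(1,2)] F3_paste_eq[OF legs_precomp[OF assms(1,3,4)] i]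
    by (rule sym, rule rw_paste[where Z = "\<lambda>k. \<a>[w, g1, f2 \<cdot> k]\<^sup>- \<bullet> (\<xi> \<lhd> (f2 \<cdot> k)) \<bullet> \<a>[g, v1, f2 \<cdot> k]"
          and Y = "\<lambda>k. \<a>[g, f1, u2 \<cdot> k]\<^sup>- \<bullet> \<a>[g \<cdot> f1, u2, k]\<^sup>- \<bullet> (\<sigma>\<^sup>- \<lhd> k) \<bullet> \<a>[w, l, k]"])
      (use family_F3_left family_F3_right assms(2) in simp_all)
qed

section \<open>Stability under precomposition, and the data chosen for the associator\<close>

lemma F1_precomp:
  assumes "F1' A4 u4 u5 \<gamma>" "x \<in> W" "Trg C x = Src C u4"
  shows "F1' (Src C x) (u4 \<cdot> x) (u5 \<cdot> x) (rw [u1, u2] u4 [u3] u5 \<gamma> x)"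
proof -
  have L: "legs u4 u5" and W: "act [u, u1, u2] u4 \<in> W" and i: "iso_between [u1, u2] u4 [u3] u5 \<gamma>"
    using assms(1) unfolding F1_iff by blast+
  note [simp] = W_Mor[OF assms(2)] assms(3) legsD[OF L] iso_betweenD(3-)[OF i]
  have "act [u, u1, u2] (u4 \<cdot> x) \<in> W" by (rule W_act_precomp[OF W assms(2)]) simp_all
  moreover have "iso_between [u1, u2] (u4 \<cdot> x) [u3] (u5 \<cdot> x) (rw [u1, u2] u4 [u3] u5 \<gamma> x)"
    unfolding iso_between_def by simp
  ultimately show ?thesis
    unfolding F1_iff using legs_precomp[OF L, of x] by simp
qed

text \<open>The lift along \<open>w\<close> that produces \<open>\<rho>\<close> precomposes the data
  once more after \<open>\<omega>\<close> has been found, and (F2) has to persist.\<close>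

lemma F2_precomp:
  assumes "F1' A4 u4 u5 \<gamma>" "F2' u4 u5 \<gamma> \<omega>" "x \<in> W" "Trg C x = Src C u4"
  shows "F2' (u4 \<cdot> x) (u5 \<cdot> x) (rw [u1, u2] u4 [u3] u5 \<gamma> x) (rw [f1, u2] u4 [v1, f2] u5 \<omega> x)"
proof -
  have L: "legs u4 u5" and i: "iso_between [u1, u2] u4 [u3] u5 \<gamma>"
    using assms(1) unfolding F1_iff by blast+
  have j: "iso_between [f1, u2] u4 [v1, f2] u5 \<omega>"
    and e: "v \<rhd> \<omega> = F2_paste C f v u1 f1 \<delta> u2 v1 u3 f2 \<eta> u4 u5 \<gamma>"
    using assms(2) unfolding F2_iff[OF L] by blast+
  note [simp] = W_Mor[OF assms(3)] assms(4) legsD[OF L] iso_betweenD(3-)[OF j]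
  have "legs (u4 \<cdot> x) (u5 \<cdot> x)" by (rule legs_precomp[OF L]) simp_all
  moreover have "iso_between [f1, u2] (u4 \<cdot> x) [v1, f2] (u5 \<cdot> x) (rw [f1, u2] u4 [v1, f2] u5 \<omega> x)"
    unfolding iso_between_def by simp
  moreover have "v \<rhd> rw [f1, u2] u4 [v1, f2] u5 \<omega> x =
      F2_paste C f v u1 f1 \<delta> u2 v1 u3 f2 \<eta> (u4 \<cdot> x) (u5 \<cdot> x) (rw [u1, u2] u4 [u3] u5 \<gamma> x)"
    by (subst F2_paste_precomp[OF L i]) (simp_all add: rw_lwhisk flip: e)
  ultimately show ?thesis by (simp only: F2_iff)
qed

lemma reassoc_pair:
  assumes "x \<in> Mor C" "y \<in> Mor C" "t \<in> Mor C" "p \<in> Mor C"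
    "Src C x = Trg C y" "Src C y = Trg C t" "Src C t = Trg C p"
  shows "invertible (rebracket C x y t p)" "reassoc [x, y] t p = (rebracket C x y t p)\<^sup>-"
  using assms by (simp_all add: rebracket_def)

text \<open>\<open>\<gamma>'\<close> and \<open>\<omega>'\<close> have the form in which
  \<open>frac_assoc\<close> produces them. Since \<open>rebracket\<close> is inverse to
  \<open>reassoc\<close>, they are \<open>rw\<close> of \<open>\<gamma>\<close> and the rebracketed
  solution of \<open>BF4_triple_rw\<close>.\<close>

lemma F2_of_triple:
  assumes F1: "F1' A4 t s \<gamma>" and T: "BF4_triple C W v (f1 \<cdot> u2 \<cdot> t) (v1 \<cdot> f2 \<cdot> s)
      (F2_paste C f v u1 f1 \<delta> u2 v1 u3 f2 \<eta> t s \<gamma>) D p \<omega>"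
  defines "\<gamma>' \<equiv> \<a>[u3, s, p]\<^sup>- \<bullet> (\<gamma> \<lhd> p) \<bullet> rebracket C u1 u2 t p"
    and "\<omega>' \<equiv> (rebracket C v1 f2 s p)\<^sup>- \<bullet> \<omega> \<bullet> rebracket C f1 u2 t p"
  shows "F1' D (t \<cdot> p) (s \<cdot> p) \<gamma>'" "F2' (t \<cdot> p) (s \<cdot> p) \<gamma>' \<omega>'"
proof -
  have L: "legs t s" and i: "iso_between [u1, u2] t [u3] s \<gamma>"
    using F1 unfolding F1_iff by blast+
  note [simp] = legsD[OF L] iso_betweenD(3-)[OF i]
  have T': "BF4_triple C W v (act [f1, u2] t) (act [v1, f2] s)
      (F2_paste C f v u1 f1 \<delta> u2 v1 u3 f2 \<eta> t s \<gamma>) D p \<omega>" using T by simp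
  have "Src C v = tgt [f1, u2] (Trg C t)" by simp
  note B = BF4_triple_rw[OF T' in_W(2) legsD(1,2,5)[OF L] this F2_paste_iso[OF L i]]
  note [simp] = B(2-4)
  have \<gamma>: "\<gamma>' = rw [u1, u2] t [u3] s \<gamma> p"
    unfolding rw_def \<gamma>'_def using reassoc_pair[of u1 u2 t p] by simp
  have \<omega>: "\<omega>' = reassoc [v1, f2] s p \<bullet> \<omega> \<bullet> (reassoc [f1, u2] t p)\<^sup>-"
    unfolding \<omega>'_def using reassoc_pair[of f1 u2 t p] reassoc_pair[of v1 f2 s p] by simp
  show "F1' D (t \<cdot> p) (s \<cdot> p) \<gamma>'"
    unfolding \<gamma> using F1_precomp[OF F1 B(1,4)] by simp
  have "legs (t \<cdot> p) (s \<cdot> p)" by (rule legs_precomp[OF L]) simp_all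
  moreover have "v \<rhd> \<omega>' = F2_paste C f v u1 f1 \<delta> u2 v1 u3 f2 \<eta> (t \<cdot> p) (s \<cdot> p) \<gamma>'"
    unfolding \<omega> \<gamma> F2_paste_precomp[OF L i B(2,4)] B(6)[symmetric] ..
  ultimately show "F2' (t \<cdot> p) (s \<cdot> p) \<gamma>' \<omega>'"
    using B(5) by (simp only: F2_iff \<omega>)
qed

text \<open>The associator does not record the final \<open>\<omega>'\<close>, hence the
  existential; the witness is \<open>\<omega>\<close> precomposed with \<open>q\<close>.\<close>

lemma F3_of_triple:
  assumes F1: "F1' A4 t s \<gamma>" and F2: "F2' t s \<gamma> \<omega>"
    and T: "BF4_triple C W w (l \<cdot> t) (g1 \<cdot> f2 \<cdot> s) (F3_paste C g w f1 u2 l \<sigma> v1 g1 \<xi> f2 t s \<omega>) D q \<rho>"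
  defines "\<gamma>' \<equiv> \<a>[u3, s, q]\<^sup>- \<bullet> (\<gamma> \<lhd> q) \<bullet> rebracket C u1 u2 t q"
    and "\<rho>' \<equiv> (rebracket C g1 f2 s q)\<^sup>- \<bullet> \<rho> \<bullet> \<a>[l, t, q]"
  shows "F1' D (t \<cdot> q) (s \<cdot> q) \<gamma>'" "\<exists>\<omega>'. F2' (t \<cdot> q) (s \<cdot> q) \<gamma>' \<omega>' \<and> F3' (t \<cdot> q) (s \<cdot> q) \<omega>' \<rho>'"
proof -
  have L: "legs t s" and i: "iso_between [u1, u2] t [u3] s \<gamma>"
    using F1 unfolding F1_iff by blast+
  have j: "iso_between [f1, u2] t [v1, f2] s \<omega>"
    using F2 unfolding F2_iff[OF L] by blast
  note [simp] = legsD[OF L] iso_betweenD(3-)[OF i] iso_betweenD(3-)[OF j]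
  have T': "BF4_triple C W w (act [l] t) (act [g1, f2] s) (F3_paste C g w f1 u2 l \<sigma> v1 g1 \<xi> f2 t s \<omega>) D q \<rho>"
    using T by simp
  have "Src C w = tgt [l] (Trg C t)" by simp
  note B = BF4_triple_rw[OF T' in_W(3) legsD(1,2,5)[OF L] this F3_paste_iso[OF L j]]
  note [simp] = B(2-4)
  have \<gamma>: "\<gamma>' = rw [u1, u2] t [u3] s \<gamma> q"
    unfolding rw_def \<gamma>'_def using reassoc_pair[of u1 u2 t q] by simp
  have \<rho>: "\<rho>' = reassoc [g1, f2] s q \<bullet> \<rho> \<bullet> (reassoc [l] t q)\<^sup>-"
    unfolding \<rho>'_def using reassoc_pair[of g1 f2 s q] by simp
  show "F1' D (t \<cdot> q) (s \<cdot> q) \<gamma>'"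
    unfolding \<gamma> using F1_precomp[OF F1 B(1,4)] by simp
  have L': "legs (t \<cdot> q) (s \<cdot> q)" by (rule legs_precomp[OF L]) simp_all
  have "w \<rhd> \<rho>' = F3_paste C g w f1 u2 l \<sigma> v1 g1 \<xi> f2 (t \<cdot> q) (s \<cdot> q) (rw [f1, u2] t [v1, f2] s \<omega> q)"
    unfolding \<rho> F3_paste_precomp[OF L j B(2,4)] B(6)[symmetric] ..
  then have "F3' (t \<cdot> q) (s \<cdot> q) (rw [f1, u2] t [v1, f2] s \<omega> q) \<rho>'"
    using B(5) L' by (simp only: F3_iff \<rho>)
  moreover have "F2' (t \<cdot> q) (s \<cdot> q) \<gamma>' (rw [f1, u2] t [v1, f2] s \<omega> q)"
    unfolding \<gamma> by (rule F2_precomp[OF F1 F2 B(1,4)])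
  ultimately show "\<exists>\<omega>'. F2' (t \<cdot> q) (s \<cdot> q) \<gamma>' \<omega>' \<and> F3' (t \<cdot> q) (s \<cdot> q) \<omega>' \<rho>'"
    by blast
qed

text \<open>(F2) makes \<open>v \<rhd> \<omega>\<close> a pasting of \<open>\<gamma>\<close> by
  families that are the same for both sets of data, so compatibility is inherited through
  \<open>compatible_paste\<close>.\<close>

lemma compatible_F2:
  assumes F1: "F1' A4 u4 u5 \<gamma>" "F1' A4' u4' u5' \<gamma>'" and F2: "F2' u4 u5 \<gamma> \<omega>" "F2' u4' u5' \<gamma>' \<omega>'"
    and cmp: "comparison u4 u5 u4' u5' z z' \<alpha> \<beta>"
    and c: "compatible [u1, u2] [u3] u4 u5 u4' u5' z z' \<alpha> \<beta> \<gamma> \<gamma>'"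
  shows "compatible [v, f1, u2] [v, v1, f2] u4 u5 u4' u5' z z' \<alpha> \<beta> (v \<rhd> \<omega>) (v \<rhd> \<omega>')"
proof -
  have L: "legs u4 u5" "legs u4' u5'"
    and i: "iso_between [u1, u2] u4 [u3] u5 \<gamma>" "iso_between [u1, u2] u4' [u3] u5' \<gamma>'"
    using F1 unfolding F1_iff by blast+
  have e: "v \<rhd> \<omega> = F2_paste C f v u1 f1 \<delta> u2 v1 u3 f2 \<eta> u4 u5 \<gamma>"
    "v \<rhd> \<omega>' = F2_paste C f v u1 f1 \<delta> u2 v1 u3 f2 \<eta> u4' u5' \<gamma>'"
    using F2 unfolding F2_iff[OF L(1)] F2_iff[OF L(2)] by blast+
  show ?thesis unfolding e F2_paste_eq[OF L(1) i(1)] F2_paste_eq[OF L(2) i(2)]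
    by (rule compatible_paste[OF family_F2_left[folded legsD(3)[OF L(1)]] family_F2_right[folded legsD(4)[OF L(1)]] cmp i c])
qed

lemma compatible_F3:
  assumes L: "legs u4 u5" "legs u4' u5'" and F3: "F3' u4 u5 \<omega> \<rho>" "F3' u4' u5' \<omega>' \<rho>'"
    and i: "iso_between [f1, u2] u4 [v1, f2] u5 \<omega>" "iso_between [f1, u2] u4' [v1, f2] u5' \<omega>'"
    and cmp: "comparison u4 u5 u4' u5' z z' \<alpha> \<beta>"
    and c: "compatible [f1, u2] [v1, f2] u4 u5 u4' u5' z z' \<alpha> \<beta> \<omega> \<omega>'"
  shows "compatible [w, l] [w, g1, f2] u4 u5 u4' u5' z z' \<alpha> \<beta> (w \<rhd> \<rho>) (w \<rhd> \<rho>')"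
proof -
  have e: "w \<rhd> \<rho> = F3_paste C g w f1 u2 l \<sigma> v1 g1 \<xi> f2 u4 u5 \<omega>"
    "w \<rhd> \<rho>' = F3_paste C g w f1 u2 l \<sigma> v1 g1 \<xi> f2 u4' u5' \<omega>'"
    using F3 unfolding F3_iff[OF L(1)] F3_iff[OF L(2)] by blast+
  show ?thesis unfolding e F3_paste_eq[OF L(1) i(1)] F3_paste_eq[OF L(2) i(2)]
    by (rule compatible_paste[OF family_F3_left[folded legsD(3)[OF L(1)]] family_F3_right[folded legsD(4)[OF L(1)]] cmp i c])
qed

text \<open>Two refinements of the comparison for \<open>\<gamma>\<close>: \<open>x\<close> cancels
  \<open>v\<close> and makes the \<open>\<omega>\<close> cells match, \<open>y\<close> cancels
  \<open>w\<close> and makes the \<open>\<rho>\<close> cells match. The match for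
  \<open>\<gamma>\<close> is carried along both; the one for \<open>\<omega>\<close> serves only to
  reach \<open>\<rho>\<close>.\<close>

lemma data_comparison:
  assumes F1: "F1' A4 u4 u5 \<gamma>" "F1' A4' u4' u5' \<gamma>'" and F2: "F2' u4 u5 \<gamma> \<omega>" "F2' u4' u5' \<gamma>' \<omega>'"
    and F3: "F3' u4 u5 \<omega> \<rho>" "F3' u4' u5' \<omega>' \<rho>'"
  obtains z z' \<alpha> \<beta> where "comparison u4 u5 u4' u5' z z' \<alpha> \<beta>" "((u \<cdot> u1) \<cdot> u2) \<cdot> u4 \<cdot> z \<in> W"
    "compatible [u1, u2] [u3] u4 u5 u4' u5' z z' \<alpha> \<beta> \<gamma> \<gamma>'"
    "compatible [l] [g1, f2] u4 u5 u4' u5' z z' \<alpha> \<beta> \<rho> \<rho>'"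
proof -
  have L: "legs u4 u5" "legs u4' u5'" and W: "act [u, u1, u2] u4 \<in> W" "act [u, u1, u2] u4' \<in> W"
    and i: "iso_between [u1, u2] u4 [u3] u5 \<gamma>" "iso_between [u1, u2] u4' [u3] u5' \<gamma>'"
    using F1 unfolding F1_iff by blast+
  have j: "iso_between [f1, u2] u4 [v1, f2] u5 \<omega>" "iso_between [f1, u2] u4' [v1, f2] u5' \<omega>'"
    using F2 unfolding F2_iff[OF L(1)] F2_iff[OF L(2)] by blast+
  have k: "iso_between [l] u4 [g1, f2] u5 \<rho>" "iso_between [l] u4' [g1, f2] u5' \<rho>'"
    using F3 unfolding F3_iff[OF L(1)] F3_iff[OF L(2)] by blast+
  \<comment> \<open>Passes from the bracketing of (F1) to the one used by fraction composition;
    (BF5) along associators keeps membership in \<open>W\<close>.\<close>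
  have mW: "((u \<cdot> u1) \<cdot> u2) \<cdot> x \<in> W" if "act [u, u1, u2] x \<in> W" "x \<in> Mor C" "Trg C x = Src C u2" for x
    by (rule W_iso'[OF that(1), of "\<a>[u \<cdot> u1, u2, x] \<bullet> \<a>[u, u1, u2 \<cdot> x]"]) (use that in simp_all)
  note witness = that
  show ?thesis
  proof (rule comparison_exists[OF i, where m = "(u \<cdot> u1) \<cdot> u2"])
    show "(u \<cdot> u1) \<cdot> u2 \<in> W" by (intro W_Comp) simp_all
    show "((u \<cdot> u1) \<cdot> u2) \<cdot> u4 \<in> W" "((u \<cdot> u1) \<cdot> u2) \<cdot> u4' \<in> W"
      using W legsD[OF L(1)] legsD[OF L(2)] by (simp_all only: mW)
    fix z z' \<alpha> \<beta>
    assume cmp: "comparison u4 u5 u4' u5' z z' \<alpha> \<beta>" and zW: "((u \<cdot> u1) \<cdot> u2) \<cdot> u4 \<cdot> z \<in> W"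
      and c: "compatible [u1, u2] [u3] u4 u5 u4' u5' z z' \<alpha> \<beta> \<gamma> \<gamma>'"
    note [simp] = legsD[OF L(1)] legsD[OF L(2)]
    have "Src C v = tgt [f1, u2] (Trg C u4)" by simp
    then obtain x where x: "x \<in> W" "x \<in> Mor C" "Trg C x = Src C z"
      and cx: "compatible [f1, u2] [v1, f2] u4 u5 u4' u5' (z \<cdot> x) (z' \<cdot> x) (rw [u4'] z' [u4] z \<alpha> x) (rw [u5] z [u5'] z' \<beta> x) \<omega> \<omega>'"
      by (rule compatible_faithful[OF cmp j in_W(2) _ compatible_F2[OF F1 F2 cmp c]])
    note cmpx = comparison_precomp[OF cmp x(2,3)]
    have "Src C w = tgt [l] (Trg C u4)" by simp
    then obtain y where y: "y \<in> W" "y \<in> Mor C" "Trg C y = Src C (z \<cdot> x)"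
      and cy: "compatible [l] [g1, f2] u4 u5 u4' u5' ((z \<cdot> x) \<cdot> y) ((z' \<cdot> x) \<cdot> y)
        (rw [u4'] (z' \<cdot> x) [u4] (z \<cdot> x) (rw [u4'] z' [u4] z \<alpha> x) y)
        (rw [u5] (z \<cdot> x) [u5'] (z' \<cdot> x) (rw [u5] z [u5'] z' \<beta> x) y) \<rho> \<rho>'"
      by (rule compatible_faithful[OF cmpx k in_W(3) _ compatible_F3[OF L F3 j cmpx cx]])
    note [simp] = comparisonD(5-8)[OF cmp]
    have "act [(u \<cdot> u1) \<cdot> u2, u4] (z \<cdot> x) \<in> W"
      by (rule W_act_precomp[OF _ x(1)]) (use zW x in simp_all)
    then have "act [(u \<cdot> u1) \<cdot> u2, u4] ((z \<cdot> x) \<cdot> y) \<in> W"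
      by (rule W_act_precomp[OF _ y(1)]) (use x y in simp_all)
    then show ?thesis
      using witness[OF comparison_precomp[OF cmpx y(2,3)] _
          compatible_precomp[OF cmpx i y(2,3) compatible_precomp[OF cmp i x(2,3) c]] cy] by simp
  qed (use legsD[OF L(1)] legsD[OF L(2)] in simp_all)
qed

text \<open>The rebracketings on either side of \<open>u \<rhd> \<gamma>\<close> and of
  \<open>h \<rhd> \<rho>\<close> in \<open>assoc_quintuple\<close>, put in the form that
  \<open>compatible_paste\<close> expects.\<close>

lemma family_quintuple:
  "family (Src C u2) [(u \<cdot> u1) \<cdot> u2] [u, u1, u2] (\<lambda>k. \<a>[u, u1, u2 \<cdot> k]\<^sup>- \<bullet> \<a>[u \<cdot> u1, u2, k]\<^sup>-)"
  "family (Src C u3) [u, u3] [u \<cdot> u3] (\<lambda>k. \<a>[u, u3, k])"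
  "family (Src C u2) [h \<cdot> l] [h, l] (\<lambda>k. \<a>[h, l, k]\<^sup>-)"
  "family (Src C u3) [h, g1, f2] [(h \<cdot> g1) \<cdot> f2] (\<lambda>k. \<a>[h \<cdot> g1, f2, k] \<bullet> \<a>[h, g1, f2 \<cdot> k])"
proof -
  have "family (Src C u1) [u \<cdot> u1] [u, u1] (\<lambda>k. \<a>[u, u1, k]\<^sup>-)"
    by (rule family_inv, rule family_Assoc) simp_all
  from family_shift[OF this, of "[u2]" "Src C u2"]
  have 1: "family (Src C u2) [u \<cdot> u1, u2] [u, u1, u2] (\<lambda>k. \<a>[u, u1, u2 \<cdot> k]\<^sup>-)" by simp
  have 2: "family (Src C u2) [(u \<cdot> u1) \<cdot> u2] [u \<cdot> u1, u2] (\<lambda>k. \<a>[u \<cdot> u1, u2, k]\<^sup>-)"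
    by (rule family_inv, rule family_Assoc) simp_all
  show "family (Src C u2) [(u \<cdot> u1) \<cdot> u2] [u, u1, u2] (\<lambda>k. \<a>[u, u1, u2 \<cdot> k]\<^sup>- \<bullet> \<a>[u \<cdot> u1, u2, k]\<^sup>-)"
    by (rule family_VComp[OF 2 1])
  show "family (Src C u3) [u, u3] [u \<cdot> u3] (\<lambda>k. \<a>[u, u3, k])" by (rule family_Assoc) simp_all
  show "family (Src C u2) [h \<cdot> l] [h, l] (\<lambda>k. \<a>[h, l, k]\<^sup>-)"
    by (rule family_inv, rule family_Assoc) simp_all
  have "family (Src C v1) [h, g1] [h \<cdot> g1] (\<lambda>k. \<a>[h, g1, k])" by (rule family_Assoc) simp_all
  from family_shift[OF this, of "[f2]" "Src C u3"]
  have 3: "family (Src C u3) [h, g1, f2] [h \<cdot> g1, f2] (\<lambda>k. \<a>[h, g1, f2 \<cdot> k])" by simp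
  have 4: "family (Src C u3) [h \<cdot> g1, f2] [(h \<cdot> g1) \<cdot> f2] (\<lambda>k. \<a>[h \<cdot> g1, f2, k])"
    by (rule family_Assoc) simp_all
  show "family (Src C u3) [h, g1, f2] [(h \<cdot> g1) \<cdot> f2] (\<lambda>k. \<a>[h \<cdot> g1, f2, k] \<bullet> \<a>[h, g1, f2 \<cdot> k])"
    by (rule family_VComp[OF 3 4])
qed

definition cell_left where
  "cell_left u4 u5 \<gamma> = \<a>[u, u3, u5] \<bullet> (u \<rhd> \<gamma>) \<bullet> \<a>[u, u1, u2 \<cdot> u4]\<^sup>- \<bullet> \<a>[u \<cdot> u1, u2, u4]\<^sup>-"

text \<open>Grouped as \<open>Z u5 \<bullet> (h \<rhd> \<rho>) \<bullet> Y u4\<close> to fit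
  \<open>compatible_paste\<close>; it agrees with the entry of the quintuple by
  associativity.\<close>

definition cell_right where
  "cell_right u4 u5 \<rho> = (\<a>[h \<cdot> g1, f2, u5] \<bullet> \<a>[h, g1, f2 \<cdot> u5]) \<bullet> (h \<rhd> \<rho>) \<bullet> \<a>[h, l, u4]\<^sup>-"

lemma assoc_quintuple_eq:
  assumes "legs u4 u5" "iso_between [l] u4 [g1, f2] u5 \<rho>"
  shows "assoc_quintuple C u h u1 u2 l g1 u3 f2 A4 u4 u5 \<gamma> \<rho> = (A4, u4, u5, cell_left u4 u5 \<gamma>, cell_right u4 u5 \<rho>)"
proof -
  note [simp] = legsD[OF assms(1)] iso_betweenD(3-)[OF assms(2)]
  show ?thesis unfolding assoc_quintuple_def cell_left_def cell_right_def by simp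
qed

lemma cell_left_iso:
  assumes "legs u4 u5" "iso_between [u1, u2] u4 [u3] u5 \<gamma>"
  shows "iso_between [(u \<cdot> u1) \<cdot> u2] u4 [u \<cdot> u3] u5 (cell_left u4 u5 \<gamma>)"
proof -
  note [simp] = legsD[OF assms(1)] iso_betweenD(3-)[OF assms(2)]
  show ?thesis unfolding cell_left_def iso_between_def by simp
qed

lemma cell_right_iso:
  assumes "legs u4 u5" "iso_between [l] u4 [g1, f2] u5 \<rho>"
  shows "iso_between [h \<cdot> l] u4 [(h \<cdot> g1) \<cdot> f2] u5 (cell_right u4 u5 \<rho>)"
proof -
  note [simp] = legsD[OF assms(1)] iso_betweenD(3-)[OF assms(2)]
  show ?thesis unfolding cell_right_def iso_between_def by simp
qed

abbreviation source_frac where "source_frac \<equiv> (Src C u2, (u \<cdot> u1) \<cdot> u2, h \<cdot> l)"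
abbreviation target_frac where "target_frac \<equiv> (Src C u3, u \<cdot> u3, (h \<cdot> g1) \<cdot> f2)"

lemma quintuple_in_reps:
  assumes F1: "F1' A4 u4 u5 \<gamma>" and F3: "F3' u4 u5 \<omega> \<rho>"
  shows "assoc_quintuple C u h u1 u2 l g1 u3 f2 A4 u4 u5 \<gamma> \<rho> \<in> frac_reps C W source_frac target_frac"
proof -
  have L: "legs u4 u5" and A4: "Src C u4 = A4" and W: "act [u, u1, u2] u4 \<in> W"
    and i: "iso_between [u1, u2] u4 [u3] u5 \<gamma>"
    using F1 unfolding F1_iff by blast+
  have k: "iso_between [l] u4 [g1, f2] u5 \<rho>" using F3 unfolding F3_iff[OF L] by blast
  note [simp] = legsD[OF L] A4
  note [simp] = iso_betweenD(3-)[OF cell_left_iso[OF L i]] iso_betweenD(3-)[OF cell_right_iso[OF L k]]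
  have "((u \<cdot> u1) \<cdot> u2) \<cdot> u4 \<in> W"
    by (rule W_iso'[OF W, of "\<a>[u \<cdot> u1, u2, u4] \<bullet> \<a>[u, u1, u2 \<cdot> u4]"]) simp_all
  then show ?thesis
    unfolding assoc_quintuple_eq[OF L k] by (simp add: hom1_iff hom2_iff iso2_iff)
qed

lemma quintuples_equiv:
  assumes F1: "F1' A4 u4 u5 \<gamma>" "F1' A4' u4' u5' \<gamma>'" and F2: "F2' u4 u5 \<gamma> \<omega>" "F2' u4' u5' \<gamma>' \<omega>'"
    and F3: "F3' u4 u5 \<omega> \<rho>" "F3' u4' u5' \<omega>' \<rho>'"
  shows "(assoc_quintuple C u h u1 u2 l g1 u3 f2 A4 u4 u5 \<gamma> \<rho>, assoc_quintuple C u h u1 u2 l g1 u3 f2 A4' u4' u5' \<gamma>' \<rho>')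
    \<in> frac_equiv C W source_frac target_frac"
proof -
  have L: "legs u4 u5" "legs u4' u5'" and A4: "Src C u4 = A4" "Src C u4' = A4'"
    and i: "iso_between [u1, u2] u4 [u3] u5 \<gamma>" "iso_between [u1, u2] u4' [u3] u5' \<gamma>'"
    using F1 unfolding F1_iff by blast+
  have k: "iso_between [l] u4 [g1, f2] u5 \<rho>" "iso_between [l] u4' [g1, f2] u5' \<rho>'"
    using F3 unfolding F3_iff[OF L(1)] F3_iff[OF L(2)] by blast+
  obtain z z' \<alpha> \<beta> where cmp: "comparison u4 u5 u4' u5' z z' \<alpha> \<beta>" and zW: "((u \<cdot> u1) \<cdot> u2) \<cdot> u4 \<cdot> z \<in> W"
    and c\<gamma>: "compatible [u1, u2] [u3] u4 u5 u4' u5' z z' \<alpha> \<beta> \<gamma> \<gamma>'"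
    and c\<rho>: "compatible [l] [g1, f2] u4 u5 u4' u5' z z' \<alpha> \<beta> \<rho> \<rho>'"
    by (rule data_comparison[OF F1 F2 F3])
  have "compatible [(u \<cdot> u1) \<cdot> u2] [u \<cdot> u3] u4 u5 u4' u5' z z' \<alpha> \<beta> (cell_left u4 u5 \<gamma>) (cell_left u4' u5' \<gamma>')"
    unfolding cell_left_def
    by (rule compatible_paste[OF family_quintuple(1)[folded legsD(3)[OF L(1)]]
          family_quintuple(2)[folded legsD(4)[OF L(1)]] cmp i c\<gamma>])
  note left = compatible_single[OF cmp cell_left_iso[OF L(1) i(1)] cell_left_iso[OF L(2) i(2)] this]
  have "compatible [h \<cdot> l] [(h \<cdot> g1) \<cdot> f2] u4 u5 u4' u5' z z' \<alpha> \<beta> (cell_right u4 u5 \<rho>) (cell_right u4' u5' \<rho>')"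
    unfolding cell_right_def
    by (rule compatible_paste[OF family_quintuple(3)[folded legsD(3)[OF L(1)]]
          family_quintuple(4)[folded legsD(4)[OF L(1)]] cmp k c\<rho>])
  note right = compatible_single[OF cmp cell_right_iso[OF L(1) k(1)] cell_right_iso[OF L(2) k(2)] this]
  have "\<guillemotleft>z : Src C z \<rightarrow> A4\<guillemotright>" "\<guillemotleft>z' : Src C z \<rightarrow> A4'\<guillemotright>" "\<guillemotleft>\<alpha> : u4' \<cdot> z' \<cong> u4 \<cdot> z\<guillemotright>" "\<guillemotleft>\<beta> : u5 \<cdot> z \<cong> u5' \<cdot> z'\<guillemotright>"
    using comparisonD[OF cmp] A4 by (simp_all add: hom1_iff iso2_iff)
  moreover note quintuple_in_reps[OF F1(1) F3(1), unfolded assoc_quintuple_eq[OF L(1) k(1)]]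
    quintuple_in_reps[OF F1(2) F3(2), unfolded assoc_quintuple_eq[OF L(2) k(2)]] zW left right
  ultimately show ?thesis
    unfolding assoc_quintuple_eq[OF L(1) k(1)] assoc_quintuple_eq[OF L(2) k(2)] frac_equiv.simps
      mem_Collect_eq prod.case by blast
qed

text \<open>The names follow the nested \<open>let\<close> of \<open>frac_assoc\<close>, so that
  unfolding the choices turns its value literally into the class of a quintuple, whose data are
  shown to satisfy (F1)-(F3).\<close>

lemma frac_assoc_eq_class:
  assumes cW: "C_choices C W cW" and dW: "D_choices C W dW"
    and choices: "cW f v = (A1, u1, f1, \<delta>)" "cW (g \<cdot> f1) w = (A2, u2, l, \<sigma>)"
      "cW g w = (B2, v1, g1, \<xi>)" "cW f (v \<cdot> v1) = (A3, u3, f2, \<eta>)"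
  obtains A4 u4 u5 \<gamma> \<omega> \<rho> where "F1' A4 u4 u5 \<gamma>" "F2' u4 u5 \<gamma> \<omega>" "F3' u4 u5 \<omega> \<rho>"
    "frac_assoc C W cW dW (C', w, h) (B', v, g) (A', u, f) =
       frac_equiv C W (frac_comp C cW (C', w, h) (frac_comp C cW (B', v, g) (A', u, f)))
         (frac_comp C cW (frac_comp C cW (C', w, h) (B', v, g)) (A', u, f)) ``
         {assoc_quintuple C u h u1 u2 l g1 u3 f2 A4 u4 u5 \<gamma> \<rho>}"
proof -
  obtain E t s \<gamma>0 where c0: "cW (u1 \<cdot> u2) u3 = (E, t, s, \<gamma>0)" by (metis prod_cases4)
  define \<gamma>1 where "\<gamma>1 = \<gamma>0 \<bullet> \<a>[u1, u2, t]"
  note c = C_choicesD[OF cW c0, simplified]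
  note [simp] = c(2-) W_Mor[OF c(1)]
  \<comment> \<open>The square is chosen for \<open>u1 \<cdot> u2\<close> against \<open>u3\<close>
    in \<open>W\<close>, so its leg \<open>t\<close> is in \<open>W\<close>; this gives the
    membership required by (F1).\<close>
  have "((u \<cdot> u1) \<cdot> u2) \<cdot> t \<in> W" by (intro W_Comp) (use c(1) in simp_all)
  then have tW: "act [u, u1, u2] t \<in> W"
    using W_iso'[of "((u \<cdot> u1) \<cdot> u2) \<cdot> t" "\<a>[u, u1, u2 \<cdot> t]\<^sup>- \<bullet> \<a>[u \<cdot> u1, u2, t]\<^sup>-"] by simp
  have L1: "legs t s" unfolding legs_def by simp
  have i1: "iso_between [u1, u2] t [u3] s \<gamma>1" unfolding iso_between_def \<gamma>1_def by simp
  have F1_1: "F1' E t s \<gamma>1" unfolding F1_iff using L1 i1 tW by simp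
  define \<alpha>1 where "\<alpha>1 = F2_paste C f v u1 f1 \<delta> u2 v1 u3 f2 \<eta> t s \<gamma>1"
  obtain D p \<omega>0 where d0: "dW v (f1 \<cdot> u2 \<cdot> t) (v1 \<cdot> f2 \<cdot> s) \<alpha>1 = (D, p, \<omega>0)" by (metis prod_cases3)
  note [simp] = iso_betweenD(3-)[OF F2_paste_iso[OF L1 i1], folded \<alpha>1_def]
  have T0: "BF4_triple C W v (f1 \<cdot> u2 \<cdot> t) (v1 \<cdot> f2 \<cdot> s) \<alpha>1 D p \<omega>0"
    by (rule D_choicesD[OF dW d0], rule BF4_inputI) simp_all
  define \<gamma>2 where "\<gamma>2 = \<a>[u3, s, p]\<^sup>- \<bullet> (\<gamma>1 \<lhd> p) \<bullet> rebracket C u1 u2 t p"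
  define \<omega>2 where "\<omega>2 = (rebracket C v1 f2 s p)\<^sup>- \<bullet> \<omega>0 \<bullet> rebracket C f1 u2 t p"
  note F_2 = F2_of_triple[OF F1_1 T0[unfolded \<alpha>1_def], folded \<gamma>2_def \<omega>2_def]
  have L2: "legs (t \<cdot> p) (s \<cdot> p)" using F_2(1) unfolding F1_iff by blast
  have j2: "iso_between [f1, u2] (t \<cdot> p) [v1, f2] (s \<cdot> p) \<omega>2" using F_2(2) unfolding F2_iff[OF L2] by blast
  define \<alpha>2 where "\<alpha>2 = F3_paste C g w f1 u2 l \<sigma> v1 g1 \<xi> f2 (t \<cdot> p) (s \<cdot> p) \<omega>2"
  obtain A4 q \<rho>0 where d1: "dW w (l \<cdot> t \<cdot> p) (g1 \<cdot> f2 \<cdot> s \<cdot> p) \<alpha>2 = (A4, q, \<rho>0)" by (metis prod_cases3)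
  note [simp] = iso_betweenD(3-)[OF F3_paste_iso[OF L2 j2], folded \<alpha>2_def] legsD[OF L2]
  have "BF4_input C W w (l \<cdot> t \<cdot> p) (g1 \<cdot> f2 \<cdot> s \<cdot> p) \<alpha>2"
    by (rule BF4_inputI) simp_all
  note T1 = D_choicesD[OF dW d1 this]
  define \<gamma> where "\<gamma> = \<a>[u3, s \<cdot> p, q]\<^sup>- \<bullet> (\<gamma>2 \<lhd> q) \<bullet> rebracket C u1 u2 (t \<cdot> p) q"
  define \<rho> where "\<rho> = (rebracket C g1 f2 (s \<cdot> p) q)\<^sup>- \<bullet> \<rho>0 \<bullet> \<a>[l, t \<cdot> p, q]"
  note F_3 = F3_of_triple[OF F_2 T1[unfolded \<alpha>2_def], folded \<gamma>_def \<rho>_def]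
  obtain \<omega> where \<omega>: "F2' ((t \<cdot> p) \<cdot> q) ((s \<cdot> p) \<cdot> q) \<gamma> \<omega>" "F3' ((t \<cdot> p) \<cdot> q) ((s \<cdot> p) \<cdot> q) \<omega> \<rho>"
    using F_3(2) by blast
  show ?thesis
  proof (rule that[OF F_3(1) \<omega>])
    show "frac_assoc C W cW dW (C', w, h) (B', v, g) (A', u, f) =
       frac_equiv C W (frac_comp C cW (C', w, h) (frac_comp C cW (B', v, g) (A', u, f)))
         (frac_comp C cW (frac_comp C cW (C', w, h) (B', v, g)) (A', u, f)) ``
         {assoc_quintuple C u h u1 u2 l g1 u3 f2 A4 ((t \<cdot> p) \<cdot> q) ((s \<cdot> p) \<cdot> q) \<gamma> \<rho>}"
      unfolding frac_assoc.simps choices prod.case Let_def c0 \<gamma>1_def[symmetric] \<alpha>1_def[symmetric] d0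
        \<gamma>2_def[symmetric] \<omega>2_def[symmetric] \<alpha>2_def[symmetric] d1 \<gamma>_def[symmetric] \<rho>_def[symmetric] ..
  qed
qed

end

theorem proposition4p1:
  fixes \<C> :: "('o, 'm, 'c) bicat" (structure)
    and W :: "'m set"
    and cW :: "'m \<Rightarrow> 'm \<Rightarrow> 'o \<times> 'm \<times> 'm \<times> 'c"
    and dW :: "'m \<Rightarrow> 'm \<Rightarrow> 'm \<Rightarrow> 'c \<Rightarrow> 'o \<times> 'm \<times> 'c"
  assumes "bicategory \<C>" and "BF \<C> W"
    and "C_choices \<C> W cW" and "D_choices \<C> W dW"
    and "(A', u, f) \<in> frac_mor \<C> W A B"
    and "(B', v, g) \<in> frac_mor \<C> W B C"
    and "(C', w, h) \<in> frac_mor \<C> W C D"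
    and "cW f v = (A1, u1, f1, \<delta>)"
    and "cW (g \<cdot> f1) w = (A2, u2, l, \<sigma>)"
    and "cW g w = (B2, v1, g1, \<xi>)"
    and "cW f (v \<cdot> v1) = (A3, u3, f2, \<eta>)"
    and "F1 \<C> W A2 A3 u u1 u2 u3 A4 u4 u5 \<gamma>"
    and "F2 \<C> f v u1 f1 \<delta> u2 v1 u3 f2 \<eta> u4 u5 \<gamma> \<omega>"
    and "F3 \<C> g w f1 u2 l \<sigma> v1 g1 \<xi> f2 u4 u5 \<omega> \<rho>"
  defines "hgf \<equiv> frac_comp \<C> cW (C', w, h) (frac_comp \<C> cW (B', v, g) (A', u, f))"
    and "hgf' \<equiv> frac_comp \<C> cW (frac_comp \<C> cW (C', w, h) (B', v, g)) (A', u, f)"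
    and "\<Theta> \<equiv> frac_assoc \<C> W cW dW (C', w, h) (B', v, g) (A', u, f)"
  shows "hgf = (A2, (u \<cdot> u1) \<cdot> u2, h \<cdot> l) \<and> hgf' = (A3, u \<cdot> u3, (h \<cdot> g1) \<cdot> f2) \<and>
    \<Theta> \<in> frac_cells \<C> W hgf hgf' \<and>
    assoc_quintuple \<C> u h u1 u2 l g1 u3 f2 A4 u4 u5 \<gamma> \<rho> \<in> \<Theta> \<and>
    (\<forall>A4' u4' u5' \<gamma>' \<omega>' \<rho>'.
       F1 \<C> W A2 A3 u u1 u2 u3 A4' u4' u5' \<gamma>' \<longrightarrow>
       F2 \<C> f v u1 f1 \<delta> u2 v1 u3 f2 \<eta> u4' u5' \<gamma>' \<omega>' \<longrightarrow>
       F3 \<C> g w f1 u2 l \<sigma> v1 g1 \<xi> f2 u4' u5' \<omega>' \<rho>' \<longrightarrow>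
       (assoc_quintuple \<C> u h u1 u2 l g1 u3 f2 A4' u4' u5' \<gamma>' \<rho>',
        assoc_quintuple \<C> u h u1 u2 l g1 u3 f2 A4 u4 u5 \<gamma> \<rho>) \<in> frac_equiv \<C> W hgf hgf')"
proof -
  interpret fractions \<C> W
    using assms(1,2) by (simp add: fractions_def fractions_axioms_def)
  have U: "u \<in> W" "Src \<C> u = A'" "Trg \<C> u = A" "f \<in> Mor \<C>" "Src \<C> f = A'" "Trg \<C> f = B"
    and V: "v \<in> W" "Src \<C> v = B'" "Trg \<C> v = B" "g \<in> Mor \<C>" "Src \<C> g = B'" "Trg \<C> g = C"
    and H: "w \<in> W" "Src \<C> w = C'" "Trg \<C> w = C" "h \<in> Mor \<C>" "Src \<C> h = C'" "Trg \<C> h = D"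
    using assms(5-7) unfolding frac_mor_def hom1_iff by blast+
  have c1: "u1 \<in> W" "Src \<C> u1 = A1" "Trg \<C> u1 = Src \<C> f" "f1 \<in> Mor \<C>" "Src \<C> f1 = A1" "Trg \<C> f1 = Src \<C> v"
    "invertible \<delta>" "Dom \<C> \<delta> = f \<cdot> u1" "Cod \<C> \<delta> = v \<cdot> f1"
    by (rule C_choicesD[OF assms(3,8)]; simp add: U V H)+
  have c2: "u2 \<in> W" "Src \<C> u2 = A2" "Trg \<C> u2 = Src \<C> (g \<cdot> f1)" "l \<in> Mor \<C>" "Src \<C> l = A2" "Trg \<C> l = Src \<C> w"
    "invertible \<sigma>" "Dom \<C> \<sigma> = (g \<cdot> f1) \<cdot> u2" "Cod \<C> \<sigma> = w \<cdot> l"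
    by (rule C_choicesD[OF assms(3,9)]; simp add: U V H c1)+
  have c3: "v1 \<in> W" "Src \<C> v1 = B2" "Trg \<C> v1 = Src \<C> g" "g1 \<in> Mor \<C>" "Src \<C> g1 = B2" "Trg \<C> g1 = Src \<C> w"
    "invertible \<xi>" "Dom \<C> \<xi> = g \<cdot> v1" "Cod \<C> \<xi> = w \<cdot> g1"
    by (rule C_choicesD[OF assms(3,10)]; simp add: U V H)+
  have vv1: "v \<cdot> v1 \<in> W" by (rule W_Comp) (simp_all add: c3 U V)
  have c4: "u3 \<in> W" "Src \<C> u3 = A3" "Trg \<C> u3 = Src \<C> f" "f2 \<in> Mor \<C>" "Src \<C> f2 = A3" "Trg \<C> f2 = Src \<C> (v \<cdot> v1)"
    "invertible \<eta>" "Dom \<C> \<eta> = f \<cdot> u3" "Cod \<C> \<eta> = (v \<cdot> v1) \<cdot> f2"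
    by (rule C_choicesD[OF assms(3,11)]; simp add: U V H c3 vv1 W_Mor)+
  interpret associator_setup \<C> W u f v g w h u1 f1 \<delta> u2 l \<sigma> v1 g1 \<xi> u3 f2 \<eta>
    by unfold_locales (use U V H c1 c2 c3 c4 W_Mor[OF V(1)] W_Mor[OF c3(1)] in simp_all)
  have hgf: "hgf = source_frac" "hgf' = target_frac"
    unfolding hgf_def hgf'_def by (simp_all add: assms(8-11) c2 c4)
  \<comment> \<open>\<open>A2\<close> and \<open>A3\<close> are replaced by the sources of
    \<open>u2\<close> and \<open>u3\<close>, the form in which the locale speaks of
    (F1)-(F3).\<close>
  note given = assms(12-14)[folded c2(2) c4(2)]
  obtain A5 u4c u5c \<gamma>c \<omega>c \<rho>c where canonical: "F1' A5 u4c u5c \<gamma>c" "F2' u4c u5c \<gamma>c \<omega>c" "F3' u4c u5c \<omega>c \<rho>c"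
    and \<Theta>: "\<Theta> = frac_equiv \<C> W hgf hgf' `` {assoc_quintuple \<C> u h u1 u2 l g1 u3 f2 A5 u4c u5c \<gamma>c \<rho>c}"
    unfolding \<Theta>_def hgf_def hgf'_def
    by (rule frac_assoc_eq_class[OF assms(3,4,8-11)])
  have "\<Theta> \<in> frac_cells \<C> W hgf hgf'"
    unfolding \<Theta> frac_cells_def hgf by (rule quotientI, rule quintuple_in_reps[OF canonical(1,3)])
  \<comment> \<open>The class is the image of the chosen quintuple under \<open>frac_equiv\<close>,
    so the chosen data come first in the pair; for the last claim the new data do.\<close>
  moreover have "assoc_quintuple \<C> u h u1 u2 l g1 u3 f2 A4 u4 u5 \<gamma> \<rho> \<in> \<Theta>"
    unfolding \<Theta> hgf Image_singleton_iff
    by (rule quintuples_equiv[OF canonical(1) given(1) canonical(2) given(2) canonical(3) given(3)])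
  moreover have "(assoc_quintuple \<C> u h u1 u2 l g1 u3 f2 A4' u4' u5' \<gamma>' \<rho>',
        assoc_quintuple \<C> u h u1 u2 l g1 u3 f2 A4 u4 u5 \<gamma> \<rho>) \<in> frac_equiv \<C> W hgf hgf'"
    if "F1 \<C> W A2 A3 u u1 u2 u3 A4' u4' u5' \<gamma>'" "F2' u4' u5' \<gamma>' \<omega>'" "F3' u4' u5' \<omega>' \<rho>'" for A4' u4' u5' \<gamma>' \<omega>' \<rho>'
    unfolding hgf
    by (rule quintuples_equiv[OF that(1)[folded c2(2) c4(2)] given(1) that(2) given(2) that(3) given(3)])
  ultimately show ?thesis
    using hgf unfolding c2(2) c4(2) by blast
qed

end
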